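(* Let $d\ge 3$ be an integer and let $1\le p<d$ be real. Let $(X_i)_{i\ge1}$ and $(Y_i)_{i\ge1}$ be independent families of i.i.d. uniform random variables on $[0,1]^d$. Then, both almost surely and in $L^1(\mathbb{P})$, $$\lim_{n\to\infty} n^{\frac pd}\,W_p^p\left(\frac1n\sum_{i=1}^n\delta_{X_i},\frac1n\sum_{i=1}^n\delta_{Y_i}\right)=f^{\mathrm{bi}}_\infty,$$ where $f^{\mathrm{bi}}_\infty=f^{\mathrm{bi}}_\infty(p,d)\in(0,\infty)$ is the constant $$f^{\mathrm{bi}}_\infty=\lim_{n\to\infty} n^{\frac pd}\,\mathbb{E}\left[W_p^p\left(\frac1n\sum_{i=1}^n\delta_{X_i},\frac1n\sum_{i=1}^n\delta_{Y_i}\right)\right]$$ (this limit exists and is finite and strictly positive).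
   Context: For probability measures $\mu,\lambda$ on $[0,1]^d$, $W_p(\mu,\lambda)=\left(\min_\pi\int|x-y|^p\,d\pi(x,y)\right)^{1/p}$ is the Wasserstein distance of order $p$, the minimum being over couplings $\pi$ of $\mu$ and $\lambda$, and $|\cdot|$ the Euclidean norm. *)

theory Defs
  imports "HOL-Probability.Probability"
begin

definition couplings :: "'a measure \<Rightarrow> 'b measure \<Rightarrow> ('a \<times> 'b) measure set" where
  "couplings \<mu> \<nu> =
    {\<pi>. sets \<pi> = sets (\<mu> \<Otimes>\<^sub>M \<nu>) \<and> distr \<pi> \<mu> fst = \<mu> \<and> distr \<pi> \<nu> snd = \<nu>}"

text \<open>
  For Borel probability measures the infimum below is attained, so it is the minimal transport cost.
  The cost is computed in the extended nonnegative reals because the Bochner integral would assign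
  cost 0 to couplings of infinite cost. For measures carried by a bounded set (such as the unit
  cube) all costs are finite and the conversion by \<^const>\<open>enn2real\<close> loses nothing. Measures on the
  cube are represented as Borel measures on the whole space carried by the cube, which does not
  change the couplings.
\<close>

definition Wasserstein ::
  "real \<Rightarrow> 'a::euclidean_space measure \<Rightarrow> 'a measure \<Rightarrow> real" where
  "Wasserstein p \<mu> \<nu> =
    enn2real (INF \<pi>\<in>couplings \<mu> \<nu>. \<integral>\<^sup>+ (x, y). ennreal (norm (x - y) powr p) \<partial>\<pi>) powr (1 / p)"

text \<open>The empirical measure of the first \<open>n\<close> points of a sequence (indexed from 0), for \<open>n > 0\<close>;
  \<open>emeasure_empirical\<close> gives the usual form as an average of Dirac measures.\<close>

definition empirical :: "nat \<Rightarrow> (nat \<Rightarrow> 'a::topological_space) \<Rightarrow> 'a measure" where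
  "empirical n x = distr (uniform_count_measure {..<n}) borel x"

lemma sets_empirical [simp, measurable_cong]: "sets (empirical n x) = sets borel"
  by (simp add: empirical_def)

lemma emeasure_empirical:
  assumes "n > 0" and A: "A \<in> sets borel"
  shows "emeasure (empirical n x) A = ennreal (1 / n) * (\<Sum>i<n. emeasure (return borel (x i)) A)"
proof -
  have "emeasure (empirical n x) A = emeasure (uniform_count_measure {..<n}) (x -` A \<inter> {..<n})"
    unfolding empirical_def using A by (subst emeasure_distr) (auto simp: space_uniform_count_measure measurable_def sets_uniform_count_measure)
  also have "\<dots> = ennreal (real (card (x -` A \<inter> {..<n})) / real n)"
    by (subst emeasure_uniform_count_measure) auto
  also have "\<dots> = ennreal (1 / n) * ennreal (real (card (x -` A \<inter> {..<n})))"
    by (subst ennreal_mult[symmetric]) auto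
  also have "ennreal (real (card (x -` A \<inter> {..<n}))) = (\<Sum>i<n. indicator A (x i))"
  proof -
    have "(\<Sum>i<n. indicator A (x i) :: ennreal) = (\<Sum>i<n. indicator (x -` A) i)"
      by (simp add: indicator_def)
    also have "\<dots> = of_nat (card ({..<n} \<inter> x -` A))"
      by (simp add: indicator_def sum.If_cases Int_def)
    finally show ?thesis
      by (simp add: Int_commute ennreal_of_nat_eq_real_of_nat)
  qed
  finally show ?thesis
    using A by simp
qed

lemma prob_space_empirical:
  assumes "n > 0"
  shows "prob_space (empirical n x)"
  unfolding empirical_def using assms
  by (intro prob_space.prob_space_distr prob_space_uniform_count_measure) auto

abbreviation unif_cube :: "(real ^ 'n::finite) measure" where
  "unif_cube \<equiv> uniform_measure lborel (cbox 0 1)"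

abbreviation unif_seq :: "(nat \<Rightarrow> real ^ 'n::finite) measure" where
  "unif_seq \<equiv> \<Pi>\<^sub>M i\<in>UNIV. unif_cube"

definition scaled_cost ::
  "real \<Rightarrow> nat \<Rightarrow> (nat \<Rightarrow> real ^ 'n::finite) \<Rightarrow> (nat \<Rightarrow> real ^ 'n) \<Rightarrow> real" where
  "scaled_cost p n x y =
    real n powr (p / real CARD('n)) * Wasserstein p (empirical n x) (empirical n y) powr p"

text \<open>
  The limiting constant as a function of \<open>p\<close> and the dimension \<open>CARD('n)\<close> only: the expectation
  depends only on the joint law of the two samples, so it is taken on the product space, whose
  coordinates are independent uniform points.
\<close>

definition f_bi_infty :: "'n::finite itself \<Rightarrow> real \<Rightarrow> real" where
  "f_bi_infty (_ :: 'n itself) p =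
    lim (\<lambda>n. \<integral>z. scaled_cost p n (fst z) (snd z)
      \<partial>(unif_seq \<Otimes>\<^sub>M (unif_seq :: (nat \<Rightarrow> real ^ 'n) measure)))"

end

theory Submission
  imports Defs "HOL-Real_Asymp.Real_Asymp"
begin

text \<open>
  Cut a sample of \<open>n = a + 1 + b\<close> uniform points of the cube, in one coordinate direction, at its
  \<open>(a + 1)\<close>-th order statistic \<open>t\<close>. Given the separating point, the \<open>a\<close> points below and the \<open>b\<close> points
  above it are uniform samples of two boxes, so the two samples can be matched box by box although
  the numbers of points in fixed boxes would differ. As \<open>t\<close> has a Beta law, replacing it by its mean moves
  the points by \<open>O(n^(-1/2))\<close>, which for \<open>d \<ge> 3\<close> is negligible against the typical matching distance \<open>n^(-1/d)\<close>;
  the cost of the separating points is negligible since \<open>p < d\<close>. Cutting into \<open>K^d\<close> equal boxes thus shows that the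
  rescaled expected cost is almost invariant under \<open>n \<mapsto> K^d * n\<close>, and together with subadditivity of the
  matching cost this forces convergence.

  For the almost sure limit, note that \<open>W\<^sub>p\<close> is a Lipschitz function of the points with constant of order \<open>n^(-1/max 2 p)\<close>, so
  by dimension-free Gaussian concentration on the cube (Maurey's property \<open>\<tau>\<close>, from the
  one-dimensional Prekopa-Leindler inequality) its fluctuations are \<open>o(n^(-1/d))\<close> outside events of
  summable probability, again because \<open>p < d\<close> and \<open>d \<ge> 3\<close>. Convergence in mean follows by Scheffe's argument.
\<close>

text \<open>Everything is measured by the p-th root of the total cost of \<open>n\<close> matched
  pairs, where errors add up by Minkowski. The expected size there is
  \<open>n powr (1/p - 1/d)\<close>. Displacing all points by \<open>n powr (-1/2)\<close> costs
  \<open>n powr (1/p - 1/2)\<close>, the separating pair costs \<open>O(1)\<close>; so the error of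
  a cut has exponent \<open>max 0 (1/p - 1/2)\<close>, which is below \<open>1/p - 1/d\<close>
  exactly when \<open>2 < d\<close> and \<open>p < d\<close>. The Lipschitz constant of the root in
  the Euclidean norm of all points has the same exponent, so one inequality serves both the
  recursion and the concentration. Two obstacles shape the rest. Expectations and p-th roots do not
  commute, so perturbation bounds are kept as families of linear inequalities with a parameter
  \<open>\<theta>\<close>, integrated for fixed \<open>\<theta>\<close>, and put into Minkowski form
  only afterwards. And cuts in one direction at a time produce boxes that are not cubes, so the
  expected cost is studied as a function of a vector \<open>s\<close> of side lengths, with errors
  that depend on \<open>s\<close> only through a factor \<open>norm s\<close>.\<close>

section \<open>Weighted convexity and Minkowski inequalities for powers\<close>

lemma powr_add_convex:
  fixes a b p \<theta> :: real
  assumes "0 \<le> a" "0 \<le> b" "1 \<le> p" "0 < \<theta>" "\<theta> < 1"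
  shows "(a + b) powr p \<le> (1 - \<theta>) powr (1 - p) * a powr p + \<theta> powr (1 - p) * b powr p"
proof -
  have ge1: "1 \<le> t powr (1 - p)" if "0 < t" "t < 1" for t :: real
    using powr_mono'[of "1 - p" 0 t] that assms by simp
  consider "a = 0" | "b = 0" | "0 < a" "0 < b" using assms by linarith
  then show ?thesis
  proof cases
    case 1
    then show ?thesis using ge1[of \<theta>] assms mult_right_mono[of 1 "\<theta> powr (1 - p)" "b powr p"] by simp
  next
    case 2
    then show ?thesis using ge1[of "1 - \<theta>"] assms mult_right_mono[of 1 "(1 - \<theta>) powr (1 - p)" "a powr p"] by simp
  next
    case 3
    have t: "t * (x / t) powr p = t powr (1 - p) * x powr p" if "0 < t" "0 < x" for t x :: real
    proof -
      have "t powr (1 - p) = t / t powr p"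
        using that powr_mult_base[of t "-p"] by (simp add: powr_minus_divide)
      then show ?thesis using that by (simp add: powr_divide)
    qed
    have "(a + b) powr p = ((1 - \<theta>) *\<^sub>R (a / (1 - \<theta>)) + \<theta> *\<^sub>R (b / \<theta>)) powr p" using assms by simp
    also have "\<dots> \<le> (1 - \<theta>) * (a / (1 - \<theta>)) powr p + \<theta> * (b / \<theta>) powr p"
      using assms 3 by (intro convex_onD[OF powr_convex]) auto
    finally show ?thesis using t[of \<theta> b] t[of "1 - \<theta>" a] assms 3 by simp
  qed
qed

text \<open>The infimum over \<open>\<theta>\<close> of the right-hand side in the hypothesis is
  \<open>(B powr (1/p) + C powr (1/p)) powr p\<close>. So the family of linear bounds is a form of
  Minkowski's inequality that survives integration and infima, and the root form is recovered from
  it afterwards.\<close>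

lemma minkowski_from_convex:
  fixes A B C p :: real
  assumes "0 \<le> B" "0 \<le> C" "1 \<le> p"
    and *: "\<And>\<theta>. 0 < \<theta> \<Longrightarrow> \<theta> < 1 \<Longrightarrow> A \<le> (1 - \<theta>) powr (1 - p) * B + \<theta> powr (1 - p) * C"
    and "0 \<le> A"
  shows "A powr (1/p) \<le> B powr (1/p) + C powr (1/p)"
proof (rule field_le_epsilon)
  fix e :: real assume e: "0 < e"
  \<comment> \<open>The optimal \<open>\<theta>\<close> is the share of the root of \<open>C\<close>
    in the sum of both roots; the summand \<open>e/2\<close> keeps both positive and hence
    \<open>\<theta>\<close> strictly between 0 and 1.\<close>
  define b where "b = B powr (1/p) + e/2"
  define c where "c = C powr (1/p) + e/2"
  have bc: "0 < b" "0 < c" unfolding b_def c_def using e by (simp_all add: add_nonneg_pos)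
  define \<theta> where "\<theta> = c / (b + c)"
  have th: "0 < \<theta>" "\<theta> < 1" "1 - \<theta> = b / (b + c)" using bc by (simp_all add: \<theta>_def field_simps)
  have B: "B \<le> b powr p"
  proof -
    have "B = (B powr (1/p)) powr p" using assms by (simp add: powr_powr)
    also have "\<dots> \<le> b powr p" unfolding b_def using e assms by (intro powr_mono2) auto
    finally show ?thesis .
  qed
  have C: "C \<le> c powr p"
  proof -
    have "C = (C powr (1/p)) powr p" using assms by (simp add: powr_powr)
    also have "\<dots> \<le> c powr p" unfolding c_def using e assms by (intro powr_mono2) auto
    finally show ?thesis .
  qed
  have red: "(x / (b + c)) powr (1 - p) * x powr p = (b + c) powr (p - 1) * x" if "0 < x" for x
  proof -
    have "(x / (b + c)) powr (1 - p) * x powr p = x powr (1 - p) * x powr p / (b + c) powr (1 - p)"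
      using that bc by (simp add: powr_divide)
    also have "x powr (1 - p) * x powr p = x" using that by (simp add: powr_add[symmetric])
    also have "x / (b + c) powr (1 - p) = (b + c) powr (p - 1) * x"
      using powr_minus_divide[of "b+c" "p - 1"] by (simp add: powr_minus_divide field_simps)
    finally show ?thesis .
  qed
  have "A \<le> (1 - \<theta>) powr (1 - p) * B + \<theta> powr (1 - p) * C" using *[OF th(1,2)] .
  also have "\<dots> \<le> (1 - \<theta>) powr (1 - p) * b powr p + \<theta> powr (1 - p) * c powr p"
    using B C by (intro add_mono mult_left_mono) auto
  also have "\<dots> = (b + c) powr (p - 1) * b + (b + c) powr (p - 1) * c"
    unfolding th(3) unfolding \<theta>_def using bc red by simp
  also have "\<dots> = (b + c) powr (p - 1) * (b + c) powr 1" using bc by (simp add: algebra_simps)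
  also have "\<dots> = (b + c) powr p" by (simp only: powr_add[symmetric]) simp
  finally have "A powr (1/p) \<le> ((b + c) powr p) powr (1/p)" using assms by (intro powr_mono2) auto
  also have "\<dots> = b + c" using assms bc by (simp add: powr_powr)
  finally show "A powr (1/p) \<le> B powr (1/p) + C powr (1/p) + e" by (simp add: b_def c_def)
qed

section \<open>Optimal matching costs\<close>

text \<open>Matchings are relaxed to doubly stochastic matrices: for a transport cost this loses nothing,
  and it makes the comparison with couplings elementary.\<close>

definition dstoch :: "'i set \<Rightarrow> ('i \<Rightarrow> 'i \<Rightarrow> real) set" where
  "dstoch I = {P. (\<forall>i\<in>I. \<forall>j\<in>I. 0 \<le> P i j) \<and> (\<forall>i\<in>I. (\<Sum>j\<in>I. P i j) = 1) \<and> (\<forall>j\<in>I. (\<Sum>i\<in>I. P i j) = 1)}"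

definition tcost :: "real \<Rightarrow> 'i set \<Rightarrow> ('i \<Rightarrow> 'i \<Rightarrow> real) \<Rightarrow> ('i \<Rightarrow> 'a::real_normed_vector) \<Rightarrow> ('i \<Rightarrow> 'a) \<Rightarrow> real" where
  "tcost p I P x y = (\<Sum>i\<in>I. \<Sum>j\<in>I. P i j * norm (x i - y j) powr p)"

definition mcost :: "real \<Rightarrow> 'i set \<Rightarrow> ('i \<Rightarrow> 'a::real_normed_vector) \<Rightarrow> ('i \<Rightarrow> 'a) \<Rightarrow> real" where
  "mcost p I x y = (INF P\<in>dstoch I. tcost p I P x y)"

lemma dstoch_id: "finite I \<Longrightarrow> (\<lambda>i j. if i = j then 1 else 0) \<in> dstoch I"
  by (auto simp: dstoch_def)

lemma tcost_nonneg: "P \<in> dstoch I \<Longrightarrow> 0 \<le> tcost p I P x y"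
  unfolding tcost_def dstoch_def by (intro sum_nonneg mult_nonneg_nonneg) auto

lemma mcost_le: "P \<in> dstoch I \<Longrightarrow> mcost p I x y \<le> tcost p I P x y"
  unfolding mcost_def by (intro cINF_lower bdd_belowI2[where m = 0] tcost_nonneg)

lemma mcost_greatest:
  "finite I \<Longrightarrow> (\<And>P. P \<in> dstoch I \<Longrightarrow> c \<le> tcost p I P x y) \<Longrightarrow> c \<le> mcost p I x y"
  unfolding mcost_def using dstoch_id by (intro cINF_greatest) auto

lemma mcost_nonneg: "finite I \<Longrightarrow> 0 \<le> mcost p I x y"
  by (intro mcost_greatest tcost_nonneg)

lemma mcost_cong:
  assumes "\<And>i. i \<in> I \<Longrightarrow> x i = x' i" "\<And>i. i \<in> I \<Longrightarrow> y i = y' i"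
  shows "mcost p I x y = mcost p I x' y'"
proof -
  have "tcost p I P x y = tcost p I P x' y'" for P
    unfolding tcost_def using assms by (intro sum.cong refl) simp
  then show ?thesis by (simp add: mcost_def)
qed

lemma mcost_le_diag:
  assumes "finite I"
  shows "mcost p I x y \<le> (\<Sum>i\<in>I. norm (x i - y i) powr p)"
proof -
  have "tcost p I (\<lambda>i j. if i = j then 1 else 0) x y = (\<Sum>i\<in>I. norm (x i - y i) powr p)"
  proof -
    have "(if i = j then 1 else 0) * a = (if i = j then a else 0)" for i j :: 'a and a :: real by simp
    then show ?thesis using assms by (simp add: tcost_def)
  qed
  then show ?thesis using mcost_le[OF dstoch_id[OF assms], of p x y] by simp
qed

lemma mcost_le_card:
  assumes "finite I" "\<And>i. i \<in> I \<Longrightarrow> norm (x i - y i) \<le> D" "0 \<le> p"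
  shows "mcost p I x y \<le> real (card I) * D powr p"
proof -
  have "(\<Sum>i\<in>I. norm (x i - y i) powr p) \<le> (\<Sum>i\<in>I. D powr p)"
    using assms by (intro sum_mono powr_mono2) auto
  then show ?thesis using mcost_le_diag[OF assms(1), of p x y] by simp
qed

text \<open>Block-diagonal matrices are doubly stochastic, so matching the two parts separately is
  allowed. This is the source of subadditivity and of the splitting at a cut.\<close>

lemma mcost_union:
  assumes "finite I" "finite J" "I \<inter> J = {}"
  shows "mcost p (I \<union> J) x y \<le> mcost p I x y + mcost p J x y"
proof -
  have *: "mcost p (I \<union> J) x y \<le> tcost p I P x y + tcost p J Q x y"
    if P: "P \<in> dstoch I" and Q: "Q \<in> dstoch J" for P Q
  proof -
    define R where "R i j = (if i \<in> I \<and> j \<in> I then P i j else if i \<in> J \<and> j \<in> J then Q i j else 0)" for i j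
    have IJ: "\<And>i. i \<in> I \<Longrightarrow> i \<notin> J" "\<And>i. i \<in> J \<Longrightarrow> i \<notin> I" using assms by auto
    have R: "\<And>i j. i \<in> I \<Longrightarrow> j \<in> I \<Longrightarrow> R i j = P i j" "\<And>i j. i \<in> J \<Longrightarrow> j \<in> J \<Longrightarrow> R i j = Q i j"
      "\<And>i j. i \<in> I \<Longrightarrow> j \<in> J \<Longrightarrow> R i j = 0" "\<And>i j. i \<in> J \<Longrightarrow> j \<in> I \<Longrightarrow> R i j = 0"
      using IJ by (auto simp: R_def)
    have "R \<in> dstoch (I \<union> J)"
      using P Q assms unfolding dstoch_def by (auto simp: sum.union_disjoint R)
    moreover have "tcost p (I \<union> J) R x y = tcost p I P x y + tcost p J Q x y"
      unfolding tcost_def using assms by (simp add: sum.union_disjoint R)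
    ultimately show ?thesis using mcost_le by metis
  qed
  \<comment> \<open>The infima over the two blocks are taken one after the other.\<close>
  have "mcost p (I \<union> J) x y - tcost p I P x y \<le> mcost p J x y" if P: "P \<in> dstoch I" for P
    using *[OF P] assms by (intro mcost_greatest) (auto simp: algebra_simps)
  then have "mcost p (I \<union> J) x y - mcost p J x y \<le> mcost p I x y"
    using assms by (intro mcost_greatest) (auto simp: algebra_simps)
  then show ?thesis by simp
qed

lemma mcost_reindex_le:
  assumes h: "bij_betw h I J" and k: "bij_betw k I J" and "finite J"
  shows "mcost p I (\<lambda>i. x (h i)) (\<lambda>i. y (k i)) \<le> mcost p J x y"
proof (rule mcost_greatest[OF assms(3)])
  fix Q assume Q: "Q \<in> dstoch J"
  have *: "(\<Sum>i\<in>I. f (h i)) = (\<Sum>j\<in>J. f j)" "(\<Sum>i\<in>I. f (k i)) = (\<Sum>j\<in>J. f j)" for f :: "_ \<Rightarrow> real"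
    using sum.reindex_bij_betw[OF h] sum.reindex_bij_betw[OF k] by auto
  have mem: "h i \<in> J" "k i \<in> J" if "i \<in> I" for i using that h k by (auto simp: bij_betw_def)
  have "(\<lambda>i j. Q (h i) (k j)) \<in> dstoch I"
    using Q mem unfolding dstoch_def by (auto simp: *(2)[of "\<lambda>j. Q _ j"] *(1)[of "\<lambda>i. Q i _"])
  moreover have "tcost p I (\<lambda>i j. Q (h i) (k j)) (\<lambda>i. x (h i)) (\<lambda>i. y (k i)) = tcost p J Q x y"
    unfolding tcost_def
    by (simp add: *(2)[of "\<lambda>j. Q _ j * norm (x _ - y j) powr p"]
        *(1)[of "\<lambda>i. \<Sum>j\<in>J. Q i j * norm (x i - y j) powr p"])
  ultimately show "mcost p I (\<lambda>i. x (h i)) (\<lambda>i. y (k i)) \<le> tcost p J Q x y" using mcost_le by metis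
qed

text \<open>Labels carry no information, so each sample may be relabelled by a bijection of its own.
  The cut of a sample is available for symmetric functions only, and it will be applied to each
  sample separately.\<close>

lemma mcost_reindex:
  assumes h: "bij_betw h I J" and k: "bij_betw k I J" and "finite J"
  shows "mcost p I (\<lambda>i. x (h i)) (\<lambda>i. y (k i)) = mcost p J x y"
proof (rule antisym)
  show "mcost p I (\<lambda>i. x (h i)) (\<lambda>i. y (k i)) \<le> mcost p J x y" by (rule mcost_reindex_le[OF assms])
  have fI: "finite I" using assms bij_betw_finite by blast
  have "mcost p J x y = mcost p J (\<lambda>j. x (h (inv_into I h j))) (\<lambda>j. y (k (inv_into I k j)))"
    using h k by (intro mcost_cong) (auto simp: bij_betw_inv_into_right)
  also have "\<dots> \<le> mcost p I (\<lambda>i. x (h i)) (\<lambda>i. y (k i))"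
    by (rule mcost_reindex_le[OF bij_betw_inv_into[OF h] bij_betw_inv_into[OF k] fI,
          where x = "\<lambda>i. x (h i)" and y = "\<lambda>i. y (k i)"])
  finally show "mcost p J x y \<le> mcost p I (\<lambda>i. x (h i)) (\<lambda>i. y (k i))" .
qed

text \<open>One matrix serves the original and the moved points. As its rows and columns sum to 1,
  the displacement of each point is counted with total weight 1, and the double sums of
  displacements collapse to single ones. The factor \<open>2 powr (p - 1)\<close> comes from
  separating the displacements of the two samples with weights \<open>1/2\<close>.\<close>

lemma mcost_perturb:
  assumes "finite I" "1 \<le> p" "0 < \<theta>" "\<theta> < 1"
  shows "mcost p I x y \<le> (1 - \<theta>) powr (1 - p) * mcost p I x' y' +
    \<theta> powr (1 - p) * (2 powr (p - 1) * ((\<Sum>i\<in>I. norm (x i - x' i) powr p) + (\<Sum>i\<in>I. norm (y i - y' i) powr p)))"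
    (is "_ \<le> ?A * _ + ?B * (?c * (?dx + ?dy))")
proof -
  have pos: "0 < ?A" "0 < ?B" using assms by auto
  have "mcost p I x y \<le> ?A * tcost p I P x' y' + ?B * (?c * (?dx + ?dy))" if P: "P \<in> dstoch I" for P
  proof -
    have Pnn: "0 \<le> P i j" if "i \<in> I" "j \<in> I" for i j using that P by (auto simp: dstoch_def)
    have pt: "norm (x i - y j) powr p \<le> ?A * norm (x' i - y' j) powr p
        + ?B * (?c * (norm (x i - x' i) powr p + norm (y j - y' j) powr p))" for i j
    proof -
      let ?u = "norm (x' i - y' j)" and ?v = "norm (x i - x' i)" and ?w = "norm (y j - y' j)"
      have "norm (x i - y j) = norm ((x' i - y' j) + ((x i - x' i) - (y j - y' j)))" by simp
      then have "norm (x i - y j) \<le> ?u + (?v + ?w)"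
        using norm_triangle_ineq[of "x' i - y' j" "(x i - x' i) - (y j - y' j)"]
          norm_triangle_ineq4[of "x i - x' i" "y j - y' j"] by linarith
      then have "norm (x i - y j) powr p \<le> (?u + (?v + ?w)) powr p" using assms by (intro powr_mono2) auto
      also have "\<dots> \<le> ?A * ?u powr p + ?B * (?v + ?w) powr p" using assms by (intro powr_add_convex) auto
      also have "(?v + ?w) powr p \<le> (1 - 1/2) powr (1 - p) * ?v powr p + (1/2) powr (1 - p) * ?w powr p"
        using assms by (intro powr_add_convex) auto
      also have "(1 - 1/2 :: real) powr (1 - p) = ?c"
        using powr_divide[of 1 2 "1 - p"] powr_minus_divide[of 2 "1 - p"] by (simp add: powr_minus_divide)
      also have "(1/2 :: real) powr (1 - p) = ?c"
        using powr_divide[of 1 2 "1 - p"] powr_minus_divide[of 2 "1 - p"] by (simp add: powr_minus_divide)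
      finally show ?thesis using pos by (simp add: algebra_simps)
    qed
    have "mcost p I x y \<le> tcost p I P x y" by (rule mcost_le[OF P])
    also have "\<dots> \<le> (\<Sum>i\<in>I. \<Sum>j\<in>I. P i j * (?A * norm (x' i - y' j) powr p
        + ?B * (?c * (norm (x i - x' i) powr p + norm (y j - y' j) powr p))))"
      unfolding tcost_def using pt Pnn by (intro sum_mono mult_left_mono) auto
    also have "\<dots> = ?A * tcost p I P x' y' + ?B * (?c * ((\<Sum>i\<in>I. \<Sum>j\<in>I. P i j * norm (x i - x' i) powr p)
         + (\<Sum>i\<in>I. \<Sum>j\<in>I. P i j * norm (y j - y' j) powr p)))"
      unfolding tcost_def by (simp add: sum_distrib_left sum.distrib algebra_simps)
    also have "(\<Sum>i\<in>I. \<Sum>j\<in>I. P i j * norm (x i - x' i) powr p) = ?dx"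
      using P by (simp add: dstoch_def sum_distrib_right[symmetric])
    also have "(\<Sum>i\<in>I. \<Sum>j\<in>I. P i j * norm (y j - y' j) powr p) = ?dy"
      using P by (subst sum.swap) (simp add: dstoch_def sum_distrib_right[symmetric])
    finally show ?thesis .
  qed
  then have "(mcost p I x y - ?B * (?c * (?dx + ?dy))) / ?A \<le> mcost p I x' y'"
    using assms pos by (intro mcost_greatest) (auto simp: pos_divide_le_eq algebra_simps)
  then show ?thesis using pos by (simp add: pos_divide_le_eq algebra_simps)
qed

lemma mcost_root_perturb:
  assumes "finite I" "1 \<le> p"
  shows "mcost p I x y powr (1/p) \<le> mcost p I x' y' powr (1/p) +
    (2 powr (p - 1) * ((\<Sum>i\<in>I. norm (x i - x' i) powr p) + (\<Sum>i\<in>I. norm (y i - y' i) powr p))) powr (1/p)"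
  using assms by (intro minkowski_from_convex mcost_perturb mcost_nonneg mult_nonneg_nonneg add_nonneg_nonneg sum_nonneg) auto

lemma mcost_root_diff:
  assumes "finite I" "1 \<le> p"
  shows "\<bar>mcost p I x y powr (1/p) - mcost p I x' y' powr (1/p)\<bar> \<le>
    (2 powr (p - 1) * ((\<Sum>i\<in>I. norm (x i - x' i) powr p) + (\<Sum>i\<in>I. norm (y i - y' i) powr p))) powr (1/p)"
  using mcost_root_perturb[OF assms, of x y x' y'] mcost_root_perturb[OF assms, of x' y' x y]
  by (simp add: norm_minus_commute abs_le_iff)

text \<open>An infimum of uncountably many functions need not be measurable. Instead the p-th root
  is continuous in the product topology: its deviation from the value at \<open>z0\<close> is at
  most \<open>h\<close>, a continuous function of finitely many coordinates with
  \<open>h z0 = 0\<close>. With countably many factors the Borel sets are those of the product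
  measure.\<close>

lemma mcost_measurable_UNIV:
  assumes "finite I" "1 \<le> p"
  shows "(\<lambda>z. mcost p I (fst z) (snd z)) \<in> borel_measurable
    ((\<Pi>\<^sub>M i\<in>UNIV. borel) \<Otimes>\<^sub>M (\<Pi>\<^sub>M i\<in>UNIV. (borel :: 'a::euclidean_space measure)) :: ((nat \<Rightarrow> 'a) \<times> (nat \<Rightarrow> 'a)) measure)"
proof -
  let ?r = "\<lambda>z :: (nat \<Rightarrow> 'a) \<times> (nat \<Rightarrow> 'a). mcost p I (fst z) (snd z) powr (1/p)"
  have co: "continuous_on UNIV (\<lambda>z :: (nat \<Rightarrow> 'a) \<times> (nat \<Rightarrow> 'a). fst z i)"
    "continuous_on UNIV (\<lambda>z :: (nat \<Rightarrow> 'a) \<times> (nat \<Rightarrow> 'a). snd z i)" for i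
    using continuous_on_compose2[of UNIV "\<lambda>x. x i" UNIV fst] continuous_on_compose2[of UNIV "\<lambda>x. x i" UNIV snd]
      continuous_on_fst[OF continuous_on_id] continuous_on_snd[OF continuous_on_id]
    by auto
  have "isCont ?r z0" for z0
  proof -
    define h where "h z = (2 powr (p - 1) * ((\<Sum>i\<in>I. norm (fst z i - fst z0 i) powr p) + (\<Sum>i\<in>I. norm (snd z i - snd z0 i) powr p))) powr (1/p)"
      for z :: "(nat \<Rightarrow> 'a) \<times> (nat \<Rightarrow> 'a)"
    have "continuous_on UNIV h" unfolding h_def using assms
      by (intro continuous_intros continuous_on_powr' co)
         (auto intro!: mult_nonneg_nonneg add_nonneg_nonneg sum_nonneg)
    then have "isCont h z0" by (cases z0) (simp add: continuous_on_eq_continuous_at)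
    moreover have "h z0 = 0" by (simp add: h_def)
    ultimately have h: "(h \<longlongrightarrow> 0) (at z0)" by (simp add: isCont_def)
    have "norm (?r z - ?r z0) \<le> h z" for z
      unfolding h_def using mcost_root_diff[OF assms] by simp
    then have "((\<lambda>z. ?r z - ?r z0) \<longlongrightarrow> 0) (at z0)"
      by (intro Lim_null_comparison[OF always_eventually h] allI)
    then show ?thesis unfolding isCont_def by (rule LIM_zero_cancel)
  qed
  then have "continuous_on UNIV ?r" by (intro continuous_at_imp_continuous_on) blast
  then have "?r \<in> borel_measurable borel" by (rule borel_measurable_continuous_onI)
  then have "(\<lambda>z. ?r z powr p) \<in> borel_measurable borel" by (rule powr_real_measurable[OF _ borel_measurable_const])
  moreover have "?r z powr p = mcost p I (fst z) (snd z)" for z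
    using assms mcost_nonneg[of I p "fst z" "snd z"] by (simp add: powr_powr)
  ultimately have *: "(\<lambda>z. mcost p I (fst z) (snd z)) \<in> borel_measurable (borel :: ((nat \<Rightarrow> 'a) \<times> (nat \<Rightarrow> 'a)) measure)" by simp
  have **: "sets ((\<Pi>\<^sub>M i\<in>UNIV. borel) \<Otimes>\<^sub>M (\<Pi>\<^sub>M i\<in>UNIV. borel) :: ((nat \<Rightarrow> 'a) \<times> (nat \<Rightarrow> 'a)) measure) = sets borel"
    unfolding borel_prod[symmetric] by (intro sets_pair_measure_cong sets_PiM_equal_borel)
  show ?thesis using * unfolding measurable_cong_sets[OF ** refl] .
qed

lemma mcost_measurable:
  assumes "finite I" "1 \<le> p"
    and f: "\<And>i. i \<in> I \<Longrightarrow> (\<lambda>w. f w i) \<in> borel_measurable M"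
    and g: "\<And>i. i \<in> I \<Longrightarrow> (\<lambda>w. g w i) \<in> borel_measurable M"
  shows "(\<lambda>w. mcost p I (f w) (g w :: nat \<Rightarrow> 'a::euclidean_space)) \<in> borel_measurable M"
proof -
  \<comment> \<open>Nothing is assumed about coordinates outside \<open>I\<close>; as the cost
    ignores them, they are set to 0.\<close>
  let ?f = "\<lambda>w i. if i \<in> I then f w i else 0" and ?g = "\<lambda>w i. if i \<in> I then g w i else 0"
  have "(\<lambda>w. (?f w, ?g w)) \<in> M \<rightarrow>\<^sub>M (\<Pi>\<^sub>M i\<in>UNIV. borel) \<Otimes>\<^sub>M (\<Pi>\<^sub>M i\<in>UNIV. borel)"
  proof (intro measurable_Pair measurable_PiM_single')
    show "(\<lambda>w. ?f w i) \<in> borel_measurable M" for i using f by (cases "i \<in> I") auto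
    show "(\<lambda>w. ?g w i) \<in> borel_measurable M" for i using g by (cases "i \<in> I") auto
  qed auto
  from measurable_compose[OF this mcost_measurable_UNIV[OF assms(1,2)]]
  have "(\<lambda>w. mcost p I (?f w) (?g w)) \<in> borel_measurable M" by simp
  moreover have "mcost p I (?f w) (?g w) = mcost p I (f w) (g w)" for w
    by (rule mcost_cong) auto
  ultimately show ?thesis by simp
qed

section \<open>Couplings of empirical measures and doubly stochastic matrices\<close>

lemma measurable_uniform_count_measure:
  "f \<in> A \<rightarrow> space N \<Longrightarrow> f \<in> uniform_count_measure A \<rightarrow>\<^sub>M N"
  by (auto simp: measurable_def sets_uniform_count_measure space_uniform_count_measure)

lemma nn_integral_empirical:
  assumes "0 < n" and [measurable]: "f \<in> borel_measurable borel"
  shows "(\<integral>\<^sup>+ a. f a \<partial>empirical n x) = (\<Sum>i<n. f (x i)) / of_nat n"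
proof -
  have "(\<integral>\<^sup>+ a. f a \<partial>empirical n x) = (\<integral>\<^sup>+ i. f (x i) \<partial>uniform_count_measure {..<n})"
    unfolding empirical_def by (subst nn_integral_distr) (auto intro: measurable_uniform_count_measure)
  also have "\<dots> = (\<Sum>i<n. ennreal (1 / n) * f (x i))"
    unfolding uniform_count_measure_def by (subst nn_integral_point_measure_finite) auto
  also have "\<dots> = (\<Sum>i<n. f (x i)) / of_nat n"
  proof -
    have "ennreal (1 / n) = inverse (of_nat n)"
      using assms by (simp add: ennreal_of_nat_eq_real_of_nat inverse_ennreal inverse_eq_divide)
    then show ?thesis by (simp add: sum_distrib_left[symmetric] divide_ennreal_def mult.commute)
  qed
  finally show ?thesis .
qed

lemma AE_empirical:
  fixes x :: "nat \<Rightarrow> 'a::euclidean_space"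
  shows "AE a in empirical n x. a \<in> x ` {..<n}"
proof -
  have "finite (x ` {..<n})" by simp
  then have [measurable]: "x ` {..<n} \<in> sets borel" by (intro borel_closed finite_imp_closed)
  show ?thesis unfolding empirical_def
    by (subst AE_distr_iff) (auto intro: measurable_uniform_count_measure simp: space_uniform_count_measure)
qed

lemma sum_ennreal2:
  assumes "\<And>i j. i \<in> I \<Longrightarrow> j \<in> J \<Longrightarrow> 0 \<le> f i j"
  shows "(\<Sum>i\<in>I. \<Sum>j\<in>J. ennreal (f i j)) = ennreal (\<Sum>i\<in>I. \<Sum>j\<in>J. f i j)"
proof -
  have "(\<Sum>i\<in>I. \<Sum>j\<in>J. ennreal (f i j)) = (\<Sum>i\<in>I. ennreal (\<Sum>j\<in>J. f i j))"
    using assms by (intro sum.cong refl sum_ennreal) auto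
  also have "\<dots> = ennreal (\<Sum>i\<in>I. \<Sum>j\<in>J. f i j)"
    using assms by (intro sum_ennreal sum_nonneg) auto
  finally show ?thesis .
qed

lemma ennreal_tcost:
  fixes n :: nat
  assumes "\<And>i j. i < n \<Longrightarrow> j < n \<Longrightarrow> 0 \<le> P i j"
  shows "ennreal (tcost p {..<n} P x y / n) =
    (\<Sum>i<n. \<Sum>j<n. ennreal (P i j / n) * ennreal (norm (x i - y j) powr p))"
proof -
  have "ennreal (tcost p {..<n} P x y / n) = (\<Sum>i<n. \<Sum>j<n. ennreal (P i j * norm (x i - y j) powr p / n))"
    unfolding tcost_def sum_divide_distrib using assms by (intro sum_ennreal2[symmetric]) auto
  also have "\<dots> = (\<Sum>i<n. \<Sum>j<n. ennreal (P i j / n) * ennreal (norm (x i - y j) powr p))"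
    using assms by (intro sum.cong refl) (simp add: ennreal_mult[symmetric])
  finally show ?thesis .
qed

text \<open>The mass \<open>P i j / n\<close> is placed on index pairs and only then pushed to the
  points, so coinciding sample points make no difference. Row and column sums equal to 1 turn into
  the two marginals.\<close>

lemma coupling_of_dstoch:
  fixes x y :: "nat \<Rightarrow> 'a::euclidean_space"
  assumes n: "0 < n" and P: "P \<in> dstoch {..<n}"
  shows "\<exists>\<pi>\<in>couplings (empirical n x) (empirical n y).
    (\<integral>\<^sup>+ (a, b). ennreal (norm (a - b) powr p) \<partial>\<pi>) = ennreal (tcost p {..<n} P x y / n)"
proof -
  let ?I = "{..<n} \<times> {..<n}"
  define q where "q = point_measure ?I (\<lambda>(i, j). ennreal (P i j / n))"
  define \<pi> where "\<pi> = distr q (borel \<Otimes>\<^sub>M borel) (\<lambda>(i, j). (x i, y j))"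
  have Pnn: "0 \<le> P i j" if "i < n" "j < n" for i j using that P by (auto simp: dstoch_def)
  have q: "(\<integral>\<^sup>+ z. g z \<partial>q) = (\<Sum>i<n. \<Sum>j<n. ennreal (P i j / n) * g (i, j))" for g
    unfolding q_def by (subst nn_integral_point_measure_finite) (auto simp: sum.cartesian_product case_prod_beta)
  have mq: "f \<in> q \<rightarrow>\<^sub>M N" if "f \<in> ?I \<rightarrow> space N" for f N
    unfolding q_def using that by simp
  have \<pi>: "(\<integral>\<^sup>+ z. g z \<partial>\<pi>) = (\<Sum>i<n. \<Sum>j<n. ennreal (P i j / n) * g (x i, y j))"
    if [measurable]: "g \<in> borel_measurable (borel \<Otimes>\<^sub>M borel)" for g
    unfolding \<pi>_def by (subst nn_integral_distr) (auto intro!: mq simp: q space_pair_measure)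
  have s: "sets \<pi> = sets (borel \<Otimes>\<^sub>M borel)" by (simp add: \<pi>_def)
  have row: "(\<Sum>j<n. ennreal (P i j / n)) = ennreal (1 / n)" if "i < n" for i
    using that P Pnn by (subst sum_ennreal) (auto simp: dstoch_def sum_divide_distrib[symmetric])
  have col: "(\<Sum>i<n. ennreal (P i j / n)) = ennreal (1 / n)" if "j < n" for j
    using that P Pnn by (subst sum_ennreal) (auto simp: dstoch_def sum_divide_distrib[symmetric])
  have emp: "emeasure (empirical n w) A = (\<Sum>i<n. ennreal (1 / n) * indicator A (w i))"
    if "A \<in> sets borel" for A and w :: "nat \<Rightarrow> 'a"
    using emeasure_empirical[OF n that, of w] that by (simp add: sum_distrib_left)
  have "distr \<pi> (empirical n x) fst = empirical n x"
  proof (rule measure_eqI)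
    fix A assume "A \<in> sets (distr \<pi> (empirical n x) fst)"
    then have [measurable]: "A \<in> sets borel" by simp
    have [measurable]: "fst \<in> \<pi> \<rightarrow>\<^sub>M empirical n x"
      using s by (simp cong: measurable_cong_sets)
    have "emeasure (distr \<pi> (empirical n x) fst) A = (\<integral>\<^sup>+ a. indicator A a \<partial>distr \<pi> (empirical n x) fst)" by simp
    also have "\<dots> = (\<integral>\<^sup>+ z. indicator A (fst z) \<partial>\<pi>)" by (subst nn_integral_distr) auto
    also have "\<dots> = (\<Sum>i<n. \<Sum>j<n. ennreal (P i j / n) * indicator A (x i))" by (subst \<pi>) auto
    also have "\<dots> = (\<Sum>i<n. ennreal (1/n) * indicator A (x i))"
      by (intro sum.cong refl) (simp add: sum_distrib_right[symmetric] row)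
    finally show "emeasure (distr \<pi> (empirical n x) fst) A = emeasure (empirical n x) A"
      by (simp add: emp)
  qed simp
  moreover have "distr \<pi> (empirical n y) snd = empirical n y"
  proof (rule measure_eqI)
    fix A assume "A \<in> sets (distr \<pi> (empirical n y) snd)"
    then have [measurable]: "A \<in> sets borel" by simp
    have [measurable]: "snd \<in> \<pi> \<rightarrow>\<^sub>M empirical n y"
      using s by (simp cong: measurable_cong_sets)
    have "emeasure (distr \<pi> (empirical n y) snd) A = (\<integral>\<^sup>+ a. indicator A a \<partial>distr \<pi> (empirical n y) snd)" by simp
    also have "\<dots> = (\<integral>\<^sup>+ z. indicator A (snd z) \<partial>\<pi>)" by (subst nn_integral_distr) auto
    also have "\<dots> = (\<Sum>i<n. \<Sum>j<n. ennreal (P i j / n) * indicator A (y j))" by (subst \<pi>) auto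
    also have "\<dots> = (\<Sum>j<n. \<Sum>i<n. ennreal (P i j / n) * indicator A (y j))" by (rule sum.swap)
    also have "\<dots> = (\<Sum>i<n. ennreal (1/n) * indicator A (y i))"
      by (intro sum.cong refl) (simp add: sum_distrib_right[symmetric] col)
    finally show "emeasure (distr \<pi> (empirical n y) snd) A = emeasure (empirical n y) A"
      by (simp add: emp)
  qed simp
  moreover have "sets \<pi> = sets (empirical n x \<Otimes>\<^sub>M empirical n y)"
    unfolding s by (intro sets_pair_measure_cong) auto
  ultimately have "\<pi> \<in> couplings (empirical n x) (empirical n y)" by (simp add: couplings_def)
  moreover have "(\<integral>\<^sup>+ (a, b). ennreal (norm (a - b) powr p) \<partial>\<pi>) = ennreal (tcost p {..<n} P x y / n)"
    using Pnn by (subst \<pi>) (auto simp: ennreal_tcost)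
  ultimately show ?thesis by blast
qed

text \<open>A matrix is read off from the coupling: its entries are \<open>n\<close> times the mass
  sent from index \<open>i\<close> to index \<open>j\<close>. Sample points may coincide, and then
  the mass of an atom is divided equally among the indices that share it.\<close>

lemma coupling_cost_ge_mcost:
  fixes x y :: "nat \<Rightarrow> 'a::euclidean_space"
  assumes n: "0 < n" and \<pi>: "\<pi> \<in> couplings (empirical n x) (empirical n y)"
  shows "ennreal (mcost p {..<n} x y / n) \<le> (\<integral>\<^sup>+ (a, b). ennreal (norm (a - b) powr p) \<partial>\<pi>)"
proof -
  have "sets (empirical n x \<Otimes>\<^sub>M empirical n y) = sets (borel \<Otimes>\<^sub>M borel :: ('a \<times> 'a) measure)"
    by (intro sets_pair_measure_cong) auto
  then have s [measurable_cong]: "sets \<pi> = sets (borel \<Otimes>\<^sub>M borel)"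
    and d: "distr \<pi> (empirical n x) fst = empirical n x" "distr \<pi> (empirical n y) snd = empirical n y"
    using \<pi> by (auto simp: couplings_def)
  have [measurable]: "fst \<in> \<pi> \<rightarrow>\<^sub>M empirical n x" "snd \<in> \<pi> \<rightarrow>\<^sub>M empirical n y"
    using s by (auto cong: measurable_cong_sets)
  have fst: "(\<integral>\<^sup>+ z. f (fst z) \<partial>\<pi>) = (\<Sum>i<n. f (x i)) / of_nat n"
    if [measurable]: "f \<in> borel_measurable borel" for f
  proof -
    have "(\<integral>\<^sup>+ z. f (fst z) \<partial>\<pi>) = (\<integral>\<^sup>+ a. f a \<partial>distr \<pi> (empirical n x) fst)" by (subst nn_integral_distr) auto
    then show ?thesis unfolding d by (simp add: nn_integral_empirical n)
  qed
  have snd: "(\<integral>\<^sup>+ z. f (snd z) \<partial>\<pi>) = (\<Sum>i<n. f (y i)) / of_nat n"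
    if [measurable]: "f \<in> borel_measurable borel" for f
  proof -
    have "(\<integral>\<^sup>+ z. f (snd z) \<partial>\<pi>) = (\<integral>\<^sup>+ a. f a \<partial>distr \<pi> (empirical n y) snd)" by (subst nn_integral_distr) auto
    then show ?thesis unfolding d by (simp add: nn_integral_empirical n)
  qed
  have AE: "AE z in \<pi>. fst z \<in> x ` {..<n}" "AE z in \<pi>. snd z \<in> y ` {..<n}"
    by (rule AE_distrD[of fst \<pi> "empirical n x"], simp, unfold d, rule AE_empirical)
      (rule AE_distrD[of snd \<pi> "empirical n y"], simp, unfold d, rule AE_empirical)
  \<comment> \<open>\<open>m w a\<close> is the multiplicity of \<open>a\<close> in the sample. The
    functions \<open>e w i\<close> form a partition of unity on the sample points
    (\<open>e1\<close>), and each has integral \<open>1 / n\<close> against the empirical measure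
    (\<open>e2\<close>).\<close>
  define m where "m w a = card {k\<in>{..<n}. w k = a}" for w :: "nat \<Rightarrow> 'a" and a
  have m_pos: "0 < m w (w k)" if "k < n" for w k
    using that by (auto simp: m_def card_gt_0_iff)
  have [measurable]: "{a} \<in> sets borel" for a :: 'a by simp
  define e where "e w i a = ennreal (indicator {w i} a / m w (w i))" for w :: "nat \<Rightarrow> 'a" and i a
  have [measurable]: "e w i \<in> borel_measurable borel" for w i unfolding e_def by measurable
  have cnt: "(\<Sum>k<n. indicator {w i} (w k) :: real) = m w (w i)" for w :: "nat \<Rightarrow> 'a" and i
    by (simp add: m_def indicator_def sum.If_cases Int_def)
  have e1: "(\<Sum>i<n. e w i a) = 1" if a: "a \<in> w ` {..<n}" for w a
  proof -
    have "(\<Sum>i<n. e w i a) = ennreal (\<Sum>i<n. indicator {w i} a / m w (w i))"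
      unfolding e_def by (intro sum_ennreal) auto
    also have "(\<Sum>i<n. indicator {w i} a / m w (w i)) = (\<Sum>i<n. indicator {a} (w i) / m w a)"
      by (intro sum.cong refl) (auto simp: indicator_def)
    also have "\<dots> = 1" using a cnt[of w] m_pos[of _ w] by (auto simp: sum_divide_distrib[symmetric])
    finally show ?thesis by simp
  qed
  have e2: "(\<Sum>k<n. e w i (w k)) = 1" if "i < n" for w i
  proof -
    have "(\<Sum>k<n. e w i (w k)) = ennreal (\<Sum>k<n. indicator {w i} (w k) / m w (w i))"
      unfolding e_def by (intro sum_ennreal) auto
    also have "\<dots> = 1" using cnt[of w i] m_pos[OF that, of w] by (simp add: sum_divide_distrib[symmetric])
    finally show ?thesis .
  qed
  define r where "r i j = (\<integral>\<^sup>+ z. e x i (fst z) * e y j (snd z) \<partial>\<pi>)" for i j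
  have row: "(\<Sum>j<n. r i j) = ennreal (1 / n)" if i: "i < n" for i
  proof -
    have "(\<Sum>j<n. r i j) = (\<integral>\<^sup>+ z. e x i (fst z) * (\<Sum>j<n. e y j (snd z)) \<partial>\<pi>)"
      unfolding r_def sum_distrib_left by (subst nn_integral_sum) auto
    also have "\<dots> = (\<integral>\<^sup>+ z. e x i (fst z) \<partial>\<pi>)"
      using AE(2) by (intro nn_integral_cong_AE) (auto simp: e1)
    also have "\<dots> = ennreal (1 / n)" using n
      by (simp add: fst e2 i ennreal_of_nat_eq_real_of_nat divide_ennreal ennreal_1[symmetric] del: ennreal_1)
    finally show ?thesis .
  qed
  have col: "(\<Sum>i<n. r i j) = ennreal (1 / n)" if j: "j < n" for j
  proof -
    have "(\<Sum>i<n. r i j) = (\<integral>\<^sup>+ z. (\<Sum>i<n. e x i (fst z)) * e y j (snd z) \<partial>\<pi>)"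
      unfolding r_def sum_distrib_right by (subst nn_integral_sum) auto
    also have "\<dots> = (\<integral>\<^sup>+ z. e y j (snd z) \<partial>\<pi>)"
      using AE(1) by (intro nn_integral_cong_AE) (auto simp: e1)
    also have "\<dots> = ennreal (1 / n)" using n
      by (simp add: snd e2 j ennreal_of_nat_eq_real_of_nat divide_ennreal ennreal_1[symmetric] del: ennreal_1)
    finally show ?thesis .
  qed
  define P where "P i j = n * enn2real (r i j)" for i j
  have fin: "r i j < \<top>" if "i < n" "j < n" for i j
  proof -
    have "r i j \<le> (\<Sum>j<n. r i j)" using that by (intro member_le_sum) auto
    also have "\<dots> < \<top>" using row that by simp
    finally show ?thesis .
  qed
  have rP: "r i j = ennreal (P i j / n)" if "i < n" "j < n" for i j
    using n fin[OF that] by (simp add: P_def less_top)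
  have Pnn: "0 \<le> P i j" for i j by (simp add: P_def)
  have "P \<in> dstoch {..<n}"
  proof -
    have "(\<Sum>j<n. P i j) = 1" if "i < n" for i
    proof -
      have "ennreal (\<Sum>j<n. P i j / n) = (\<Sum>j<n. r i j)"
        using that Pnn by (subst sum_ennreal[symmetric]) (auto simp: rP)
      then have "ennreal (\<Sum>j<n. P i j / n) = ennreal (1 / n)" using row[OF that] by simp
      then have "(\<Sum>j<n. P i j / n) = 1 / n" using Pnn by (subst (asm) ennreal_inj) (auto simp: sum_nonneg)
      then show ?thesis using n by (simp add: sum_divide_distrib[symmetric])
    qed
    moreover have "(\<Sum>i<n. P i j) = 1" if "j < n" for j
    proof -
      have "ennreal (\<Sum>i<n. P i j / n) = (\<Sum>i<n. r i j)"
        using that Pnn by (subst sum_ennreal[symmetric]) (auto simp: rP)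
      then have "ennreal (\<Sum>i<n. P i j / n) = ennreal (1 / n)" using col[OF that] by simp
      then have "(\<Sum>i<n. P i j / n) = 1 / n" using Pnn by (subst (asm) ennreal_inj) (auto simp: sum_nonneg)
      then show ?thesis using n by (simp add: sum_divide_distrib[symmetric])
    qed
    ultimately show ?thesis using Pnn by (auto simp: dstoch_def)
  qed
  then have "ennreal (mcost p {..<n} x y / n) \<le> ennreal (tcost p {..<n} P x y / n)"
    by (intro ennreal_leI divide_right_mono mcost_le) auto
  also have "\<dots> = (\<Sum>i<n. \<Sum>j<n. r i j * ennreal (norm (x i - y j) powr p))"
    using Pnn by (simp add: ennreal_tcost rP)
  \<comment> \<open>Where the integrand does not vanish, the two points are \<open>x i\<close> and
    \<open>y j\<close>. So the constant distance can be replaced by the actual one, after which the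
    partition of unity sums to 1.\<close>
  also have "\<dots> = (\<Sum>i<n. \<Sum>j<n. \<integral>\<^sup>+ z. e x i (fst z) * e y j (snd z) * ennreal (norm (fst z - snd z) powr p) \<partial>\<pi>)"
  proof (intro sum.cong refl)
    fix i j
    have "r i j * ennreal (norm (x i - y j) powr p) = (\<integral>\<^sup>+ z. e x i (fst z) * e y j (snd z) * ennreal (norm (x i - y j) powr p) \<partial>\<pi>)"
      unfolding r_def by (subst nn_integral_multc) auto
    also have "\<dots> = (\<integral>\<^sup>+ z. e x i (fst z) * e y j (snd z) * ennreal (norm (fst z - snd z) powr p) \<partial>\<pi>)"
      by (intro nn_integral_cong) (auto simp: e_def indicator_def)
    finally show "r i j * ennreal (norm (x i - y j) powr p) = \<dots>" .
  qed
  also have "\<dots> = (\<integral>\<^sup>+ z. (\<Sum>i<n. e x i (fst z)) * (\<Sum>j<n. e y j (snd z)) * ennreal (norm (fst z - snd z) powr p) \<partial>\<pi>)"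
    unfolding sum_product unfolding sum_distrib_right by (simp add: nn_integral_sum)
  also have "\<dots> = (\<integral>\<^sup>+ z. ennreal (norm (fst z - snd z) powr p) \<partial>\<pi>)"
    using AE by (intro nn_integral_cong_AE) (auto simp: e1)
  finally show ?thesis by (simp add: case_prod_unfold)
qed

text \<open>The two comparisons bound the infimum from both sides. The identity matrix shows that it
  is finite, so nothing is lost by \<open>enn2real\<close>.\<close>

lemma Wasserstein_empirical:
  fixes x y :: "nat \<Rightarrow> 'a::euclidean_space"
  assumes n: "0 < n" and p: "1 \<le> p"
  shows "Wasserstein p (empirical n x) (empirical n y) powr p = mcost p {..<n} x y / n"
proof -
  define C where "C = (INF \<pi>\<in>couplings (empirical n x) (empirical n y). \<integral>\<^sup>+ (x, y). ennreal (norm (x - y) powr p) \<partial>\<pi>)"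
  have up: "C \<le> ennreal (tcost p {..<n} P x y / n)" if "P \<in> dstoch {..<n}" for P
    using coupling_of_dstoch[OF n that, of x y p] unfolding C_def by (auto intro: INF_lower2)
  have lo: "ennreal (mcost p {..<n} x y / n) \<le> C"
    unfolding C_def using coupling_cost_ge_mcost[OF n] by (intro INF_greatest) auto
  have fin: "C < \<top>"
    using up[OF dstoch_id] by (simp add: order_le_less_trans[OF _ ennreal_less_top])
  have "enn2real C * n \<le> tcost p {..<n} P x y" if "P \<in> dstoch {..<n}" for P
  proof -
    have "enn2real C \<le> tcost p {..<n} P x y / n"
      using up[OF that] tcost_nonneg[OF that, of p x y] by (intro enn2real_leI) auto
    then show ?thesis using n by (simp add: pos_le_divide_eq)
  qed
  then have "enn2real C * n \<le> mcost p {..<n} x y" by (intro mcost_greatest) auto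
  moreover have "mcost p {..<n} x y / n \<le> enn2real C"
    using lo fin enn2real_mono[OF lo fin] mcost_nonneg[of "{..<n}" p x y] by simp
  ultimately have "enn2real C = mcost p {..<n} x y / n" using n by (simp add: field_simps)
  then show ?thesis using p mcost_nonneg[of "{..<n}" p x y]
    unfolding Wasserstein_def C_def[symmetric] by (simp add: powr_powr)
qed

section \<open>Cutting a uniform sample at an order statistic\<close>

text \<open>Fubini, one coordinate at a time: each coordinate trades its weight \<open>g\<close> for
  the constant \<open>c\<close> and the substitution \<open>T\<close>. With an indicator as
  \<open>g\<close>, this describes independent points restricted to a set as images under
  \<open>T\<close> of independent points.\<close>

lemma nn_integral_PiM_prod:
  fixes g :: "'a \<Rightarrow> ennreal"
  assumes "finite I" and sM: "sigma_finite_measure M" and sN: "sigma_finite_measure N"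
    and g [measurable]: "g \<in> borel_measurable M" and T [measurable]: "T \<in> N \<rightarrow>\<^sub>M M"
    and *: "\<And>f. f \<in> borel_measurable M \<Longrightarrow> (\<integral>\<^sup>+ x. f x * g x \<partial>M) = c * (\<integral>\<^sup>+ x. f (T x) \<partial>N)"
    and F: "F \<in> borel_measurable (PiM I (\<lambda>_. M))"
  shows "(\<integral>\<^sup>+ x. F x * (\<Prod>i\<in>I. g (x i)) \<partial>PiM I (\<lambda>_. M)) = c ^ card I * (\<integral>\<^sup>+ x. F (\<lambda>i\<in>I. T (x i)) \<partial>PiM I (\<lambda>_. N))"
  using assms(1) F
proof (induction I arbitrary: F)
  case empty
  then show ?case by (simp add: PiM_empty nn_integral_count_space_finite)
next
  case (insert i I)
  interpret M: product_sigma_finite "\<lambda>_. M" using sM by (simp add: product_sigma_finite_def)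
  interpret N: product_sigma_finite "\<lambda>_. N" using sN by (simp add: product_sigma_finite_def)
  note [measurable] = insert.prems
  have up [measurable]: "(\<lambda>y. x(i := y)) \<in> M \<rightarrow>\<^sub>M PiM (insert i I) (\<lambda>_. M)" if "x \<in> space (PiM I (\<lambda>_. M))" for x
    using that insert.hyps by (intro measurable_component_update) auto
  have add [measurable]: "(\<lambda>p. (fst p)(i := T (snd p))) \<in> PiM I (\<lambda>_. M) \<Otimes>\<^sub>M N \<rightarrow>\<^sub>M PiM (insert i I) (\<lambda>_. M)"
    by (rule measurable_fun_upd[where J = I]) auto
  have F'[measurable]: "(\<lambda>x. \<integral>\<^sup>+ y. F (x(i := T y)) \<partial>N) \<in> borel_measurable (PiM I (\<lambda>_. M))"
    using measurable_compose[OF add insert.prems]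
    by (intro sigma_finite_measure.borel_measurable_nn_integral[OF sN]) (simp add: case_prod_beta')
  have "(\<integral>\<^sup>+ x. F x * (\<Prod>i\<in>insert i I. g (x i)) \<partial>PiM (insert i I) (\<lambda>_. M))
    = (\<integral>\<^sup>+ x. \<integral>\<^sup>+ y. F (x(i := y)) * (\<Prod>j\<in>insert i I. g ((x(i := y)) j)) \<partial>M \<partial>PiM I (\<lambda>_. M))"
    using insert.hyps by (subst M.product_nn_integral_insert) auto
  also have "\<dots> = (\<integral>\<^sup>+ x. c * (\<integral>\<^sup>+ y. F (x(i := T y)) \<partial>N) * (\<Prod>j\<in>I. g (x j)) \<partial>PiM I (\<lambda>_. M))"
  proof (rule nn_integral_cong)
    fix x assume x: "x \<in> space (PiM I (\<lambda>_. M))"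
    note [measurable] = up[OF x]
    have [measurable]: "(\<lambda>y. F (x(i := y))) \<in> borel_measurable M" by measurable
    have "(\<Prod>j\<in>insert i I. g ((x(i := y)) j)) = g y * (\<Prod>j\<in>I. g (x j))" for y
      using insert.hyps by (auto intro!: prod.cong arg_cong2[where f = "(*)"])
    then have "(\<integral>\<^sup>+ y. F (x(i := y)) * (\<Prod>j\<in>insert i I. g ((x(i := y)) j)) \<partial>M)
      = (\<integral>\<^sup>+ y. (F (x(i := y)) * g y) * (\<Prod>j\<in>I. g (x j)) \<partial>M)" by (simp add: mult.assoc)
    also have "\<dots> = (\<integral>\<^sup>+ y. F (x(i := y)) * g y \<partial>M) * (\<Prod>j\<in>I. g (x j))"
      by (intro nn_integral_multc) measurable
    also have "(\<integral>\<^sup>+ y. F (x(i := y)) * g y \<partial>M) = c * (\<integral>\<^sup>+ y. F (x(i := T y)) \<partial>N)"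
      by (rule *) measurable
    finally show "(\<integral>\<^sup>+ y. F (x(i := y)) * (\<Prod>j\<in>insert i I. g ((x(i := y)) j)) \<partial>M)
      = c * (\<integral>\<^sup>+ y. F (x(i := T y)) \<partial>N) * (\<Prod>j\<in>I. g (x j))" .
  qed
  also have "\<dots> = c * (\<integral>\<^sup>+ x. (\<integral>\<^sup>+ y. F (x(i := T y)) \<partial>N) * (\<Prod>j\<in>I. g (x j)) \<partial>PiM I (\<lambda>_. M))"
    unfolding mult.assoc by (intro nn_integral_cmult) measurable
  also have "\<dots> = c * (c ^ card I * (\<integral>\<^sup>+ x. (\<integral>\<^sup>+ y. F ((\<lambda>j\<in>I. T (x j))(i := T y)) \<partial>N) \<partial>PiM I (\<lambda>_. N)))"
    by (subst insert.IH[OF F']) auto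
  also have "(\<integral>\<^sup>+ x. (\<integral>\<^sup>+ y. F ((\<lambda>j\<in>I. T (x j))(i := T y)) \<partial>N) \<partial>PiM I (\<lambda>_. N))
    = (\<integral>\<^sup>+ x. (\<integral>\<^sup>+ y. F (\<lambda>j\<in>insert i I. T ((x(i := y)) j)) \<partial>N) \<partial>PiM I (\<lambda>_. N))"
    using insert.hyps by (intro nn_integral_cong arg_cong[where f = F]) (auto simp: fun_eq_iff)
  also have "\<dots> = (\<integral>\<^sup>+ x. F (\<lambda>j\<in>insert i I. T (x j)) \<partial>PiM (insert i I) (\<lambda>_. N))"
    using insert.hyps by (subst N.product_nn_integral_insert) auto
  finally have "(\<integral>\<^sup>+ x. F x * (\<Prod>i\<in>insert i I. g (x i)) \<partial>PiM (insert i I) (\<lambda>_. M))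
    = c * (c ^ card I * (\<integral>\<^sup>+ x. F (\<lambda>j\<in>insert i I. T (x j)) \<partial>PiM (insert i I) (\<lambda>_. N)))" .
  moreover have "card (insert i I) = Suc (card I)" using insert.hyps by simp
  ultimately show ?case by (simp only: power_Suc mult.assoc)
qed

section \<open>The uniform law on the cube and on its slabs\<close>

lemma unif_cube_one: "emeasure lborel (cbox 0 1 :: (real^'n) set) = 1"
proof -
  have "(0::real^'n) \<bullet> b \<le> 1 \<bullet> b \<and> (1::real^'n) \<bullet> b = 1" if "b \<in> Basis" for b
    using that by (auto simp: Basis_vec_def inner_axis)
  then show ?thesis by (simp add: prod_ennreal)
qed

lemma prob_space_unif_cube: "prob_space (unif_cube :: (real^'n) measure)"
  by (intro prob_space_uniform_measure) (simp_all add: unif_cube_one)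

lemma sigma_finite_unif_cube: "sigma_finite_measure (unif_cube :: (real^'n) measure)"
  using prob_space_unif_cube by (rule prob_space_imp_sigma_finite)

lemma nn_integral_unif_cube:
  assumes [measurable]: "f \<in> borel_measurable borel"
  shows "(\<integral>\<^sup>+ x. f x \<partial>(unif_cube :: (real^'n) measure)) = (\<integral>\<^sup>+ x. f x * indicator (cbox 0 1) x \<partial>lborel)"
  using assms by (subst nn_integral_uniform_measure) (auto simp: unif_cube_one divide_ennreal_def)

lemma AE_unif_cube: "AE x in (unif_cube :: (real^'n) measure). x \<in> cbox 0 1"
  by (rule AE_uniform_measureI) (auto simp: unif_cube_one)

lemma mem_cbox_01: "x \<in> cbox 0 (1::real^'n) \<longleftrightarrow> (\<forall>i. 0 \<le> x $ i \<and> x $ i \<le> 1)"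
  by (auto simp: mem_box_cart)

lemma AE_unif_cube_coord_neq: "AE x in (unif_cube :: (real^'n) measure). x $ k \<noteq> c"
proof -
  have "{x::real^'n. x $ k = c} \<in> null_sets lebesgue"
    using negligible_standard_hyperplane[of "axis k 1 :: real^'n" c]
    by (simp add: negligible_iff_null_sets cart_eq_inner_axis[symmetric])
  then have "AE x in lebesgue. (x::real^'n) $ k \<noteq> c" by (auto dest: AE_not_in)
  then have "AE x in lborel. (x::real^'n) $ k \<noteq> c" by (simp add: AE_completion_iff)
  then show ?thesis by (intro AE_uniform_measureI) auto
qed

text \<open>With \<open>a = 0\<close> the same map also acts on vectors of side lengths, where it
  multiplies the \<open>k\<close>-th side by \<open>s\<close>.\<close>

definition aff :: "'n \<Rightarrow> real \<Rightarrow> real \<Rightarrow> real^'n \<Rightarrow> real^'n" where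
  "aff k a s x = (\<chi> i. if i = k then a + s * x $ i else x $ i)"

lemma aff_nth [simp]: "aff k a s x $ i = (if i = k then a + s * x $ i else x $ i)"
  by (simp add: aff_def)

lemma borel_measurable_vecI:
  "(\<And>i. (\<lambda>x. f x $ i) \<in> borel_measurable M) \<Longrightarrow> (f :: _ \<Rightarrow> real^'n) \<in> borel_measurable M"
  by (subst borel_measurable_euclidean_space) (auto simp: Basis_vec_def inner_axis)

lemma borel_measurable_vec_nth [measurable]:
  "f \<in> borel_measurable M \<Longrightarrow> (\<lambda>x. (f x :: real^'n) $ i) \<in> borel_measurable M"
  by (simp add: cart_eq_inner_axis)

lemma borel_measurable_aff [measurable]:
  assumes [measurable]: "a \<in> borel_measurable M" "s \<in> borel_measurable M" "f \<in> borel_measurable M"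
  shows "(\<lambda>x. aff k (a x) (s x) (f x)) \<in> borel_measurable M"
proof (rule borel_measurable_vecI)
  show "(\<lambda>x. aff k (a x) (s x) (f x) $ i) \<in> borel_measurable M" for i by (cases "i = k") auto
qed

lemma nn_integral_lborel_aff:
  assumes [measurable]: "f \<in> borel_measurable borel" and s: "0 < s"
  shows "(\<integral>\<^sup>+ x. f x \<partial>lborel) = ennreal s * (\<integral>\<^sup>+ x. f (aff k a s x) \<partial>(lborel :: (real^'n) measure))"
proof -
  define c :: "real^'n \<Rightarrow> real" where "c j = (if j = axis k 1 then s else 1)" for j
  define T where "T x = axis k a + (\<Sum>j\<in>Basis. (c j * (x \<bullet> j)) *\<^sub>R j)" for x :: "real^'n"
  have T: "T x = aff k a s x" for x
  proof (rule euclidean_eqI)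
    fix b :: "real^'n" assume b: "b \<in> Basis"
    then obtain i where i: "b = axis i 1" by (auto simp: Basis_vec_def)
    have "T x \<bullet> b = axis k a \<bullet> b + c b * (x \<bullet> b)" using b by (simp add: T_def inner_add_left)
    also have "\<dots> = aff k a s x \<bullet> b" by (auto simp: c_def i inner_axis axis_eq_axis) (auto simp: axis_def)
    finally show "T x \<bullet> b = aff k a s x \<bullet> b" .
  qed
  have "(\<Prod>j\<in>Basis. \<bar>c j\<bar>) = (\<Prod>j\<in>(Basis :: (real^'n) set). if j = axis k 1 then s else 1)"
    using s by (intro prod.cong) (auto simp: c_def)
  also have "\<dots> = s" by (subst prod.delta) auto
  finally have pr: "(\<Prod>j\<in>Basis. \<bar>c j\<bar>) = s" .
  have "lborel = density (distr lborel borel T) (\<lambda>_. \<Prod>j\<in>Basis. \<bar>c j\<bar>)"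
    unfolding T_def using s by (intro lborel_affine_euclidean) (auto simp: c_def)
  then have "lborel = density (distr lborel borel (aff k a s)) (\<lambda>_. ennreal s)"
    unfolding pr T[abs_def] .
  then have "(\<integral>\<^sup>+ x. f x \<partial>lborel) = (\<integral>\<^sup>+ x. f x \<partial>density (distr lborel borel (aff k a s)) (\<lambda>_. ennreal s))" by simp
  also have "\<dots> = (\<integral>\<^sup>+ x. ennreal s * f (aff k a s x) \<partial>lborel)"
    by (subst nn_integral_density) (auto simp: nn_integral_distr)
  also have "\<dots> = ennreal s * (\<integral>\<^sup>+ x. f (aff k a s x) \<partial>lborel)"
    by (intro nn_integral_cmult) measurable
  finally show ?thesis .
qed

lemma nn_integral_cube_slab:
  assumes [measurable]: "f \<in> borel_measurable borel" and s: "0 < s" "0 \<le> a" "a + s \<le> 1"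
  shows "(\<integral>\<^sup>+ x. f x * indicator {x. a \<le> x $ k \<and> x $ k \<le> a + s} x \<partial>(unif_cube :: (real^'n) measure))
    = ennreal s * (\<integral>\<^sup>+ x. f (aff k a s x) \<partial>unif_cube)"
proof -
  have *: "indicator {x. a \<le> x $ k \<and> x $ k \<le> a + s} (aff k a s x) * indicator (cbox 0 1) (aff k a s x)
    = (indicator (cbox 0 1) x :: ennreal)" for x :: "real^'n"
  proof (cases "x \<in> cbox 0 1")
    case True
    then have "0 \<le> s * x $ k" "s * x $ k \<le> s" using s mult_left_mono[of "x $ k" 1 s] by (auto simp: mem_cbox_01)
    then have "0 \<le> a + s * x $ k" "a \<le> a + s * x $ k" "a + s * x $ k \<le> a + s" "a + s * x $ k \<le> 1"
      using s by linarith+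
    then show ?thesis using True by (simp add: indicator_def mem_cbox_01)
  next
    case False
    then obtain i where i: "\<not> (0 \<le> x $ i \<and> x $ i \<le> 1)" by (auto simp: mem_cbox_01)
    have "\<not> (aff k a s x \<in> cbox 0 1 \<and> a \<le> a + s * x $ k \<and> a + s * x $ k \<le> a + s)"
    proof (cases "i = k")
      case True
      then have "\<not> (0 \<le> s * x $ k \<and> s * x $ k \<le> s)" using i s
        by (auto simp: zero_le_mult_iff mult_le_cancel_left2)
      then show ?thesis by auto
    next
      case False
      then show ?thesis using i by (auto simp: mem_cbox_01 intro!: exI[of _ i])
    qed
    then show ?thesis using False by (auto simp: indicator_def)
  qed
  have "(\<integral>\<^sup>+ x. f x * indicator {x. a \<le> x $ k \<and> x $ k \<le> a + s} x \<partial>(unif_cube :: (real^'n) measure))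
    = (\<integral>\<^sup>+ x. f x * indicator {x. a \<le> x $ k \<and> x $ k \<le> a + s} x * indicator (cbox 0 1) x \<partial>lborel)"
    by (intro nn_integral_unif_cube) measurable
  also have "\<dots> = ennreal s * (\<integral>\<^sup>+ x. f (aff k a s x) * indicator (cbox 0 1) x \<partial>lborel)"
    by (subst nn_integral_lborel_aff[OF _ s(1), of _ k a]) (auto simp: * mult.assoc)
  also have "\<dots> = ennreal s * (\<integral>\<^sup>+ x. f (aff k a s x) \<partial>unif_cube)"
    by (subst nn_integral_unif_cube) auto
  finally show ?thesis .
qed

text \<open>Hyperplanes orthogonal to an axis are null sets, so integrating out one of two points
  first shows that ties have probability zero. Without ties the order statistics are
  unambiguous.\<close>

lemma AE_unif_distinct:
  assumes "finite I"
  shows "AE x in PiM I (\<lambda>_. (unif_cube :: (real^'n) measure)). inj_on (\<lambda>i. x i $ k) I"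
proof -
  let ?P = "PiM I (\<lambda>_. (unif_cube :: (real^'n) measure))"
  interpret U: product_sigma_finite "\<lambda>_. (unif_cube :: (real^'n) measure)"
    using sigma_finite_unif_cube by (simp add: product_sigma_finite_def)
  interpret P: product_prob_space "\<lambda>_. (unif_cube :: (real^'n) measure)" I
    using prob_space_unif_cube by (intro product_prob_spaceI)
  have "AE x in ?P. x i $ k \<noteq> x j $ k" if ij: "i \<in> I" "j \<in> I" "i \<noteq> j" for i j
  proof -
    have I: "I = insert i (I - {i})" using ij by auto
    have [measurable]: "(\<lambda>x. x i $ k) \<in> borel_measurable ?P" "(\<lambda>x. x j $ k) \<in> borel_measurable ?P"
      using ij by (auto intro!: borel_measurable_vec_nth measurable_component_singleton)
    define G :: "(_ \<Rightarrow> real^'n) \<Rightarrow> ennreal" where "G x = (if x i $ k = x j $ k then 1 else 0)" for x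
    have G: "G \<in> borel_measurable (PiM (insert i (I - {i})) (\<lambda>_. unif_cube))"
      unfolding I[symmetric] G_def by measurable
    have "(\<integral>\<^sup>+ x. G x \<partial>PiM (insert i (I - {i})) (\<lambda>_. unif_cube))
       = (\<integral>\<^sup>+ x. \<integral>\<^sup>+ y. G (x(i := y)) \<partial>unif_cube \<partial>PiM (I - {i}) (\<lambda>_. unif_cube))"
      using assms by (intro U.product_nn_integral_insert G) auto
    also have "\<dots> = (\<integral>\<^sup>+ x. 0 \<partial>PiM (I - {i}) (\<lambda>_. (unif_cube :: (real^'n) measure)))"
    proof (rule nn_integral_cong)
      fix x :: "_ \<Rightarrow> real^'n"
      have "(\<integral>\<^sup>+ y. G (x(i := y)) \<partial>(unif_cube :: (real^'n) measure)) = (\<integral>\<^sup>+ y. 0 \<partial>(unif_cube :: (real^'n) measure))"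
        using AE_unif_cube_coord_neq[of k "x j $ k"] ij by (intro nn_integral_cong_AE) (auto simp: G_def elim!: eventually_mono)
      then show "(\<integral>\<^sup>+ y. G (x(i := y)) \<partial>(unif_cube :: (real^'n) measure)) = 0" by simp
    qed
    finally have *: "(\<integral>\<^sup>+ x. G x \<partial>PiM (insert i (I - {i})) (\<lambda>_. unif_cube)) = 0" by simp
    have "(\<integral>\<^sup>+ x. indicator {x\<in>space ?P. x i $ k = x j $ k} x \<partial>?P) = (\<integral>\<^sup>+ x. G x \<partial>?P)"
      by (intro nn_integral_cong) (auto simp: indicator_def G_def)
    then have "(\<integral>\<^sup>+ x. indicator {x\<in>space ?P. x i $ k = x j $ k} x \<partial>?P) = 0"
      using *[unfolded I[symmetric]] by (rule trans)
    then have "emeasure ?P {x\<in>space ?P. x i $ k = x j $ k} = 0" by (subst (asm) nn_integral_indicator) measurable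
    then show ?thesis by (intro AE_I[where N = "{x\<in>space ?P. x i $ k = x j $ k}"]) auto
  qed
  then have "AE x in ?P. \<forall>i\<in>I. \<forall>j\<in>I. i \<noteq> j \<longrightarrow> x i $ k \<noteq> x j $ k"
    using assms by (intro AE_finite_allI) auto
  then show ?thesis by (auto simp: inj_on_def elim!: eventually_mono)
qed

text \<open>For a sample with distinct \<open>k\<close>-th coordinates, the number of relabellings that put the
  \<open>a\<close> lowest points first and the next one at index \<open>a\<close> does not depend on the sample. So a symmetric
  function may be integrated over the samples already labelled in this way.\<close>

definition cut_perms :: "nat \<Rightarrow> nat \<Rightarrow> (nat \<Rightarrow> real) \<Rightarrow> (nat \<Rightarrow> nat) set" where
  "cut_perms n a w = {\<sigma>. \<sigma> permutes {..<n} \<and> (\<forall>j<a. w (\<sigma> j) \<le> w (\<sigma> a)) \<and> (\<forall>j\<in>{a<..<n}. w (\<sigma> a) \<le> w (\<sigma> j))}"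

text \<open>Composition with the permutation \<open>\<tau>\<close> that sorts \<open>w\<close>
  carries the relabellings of the already sorted sample \<open>real\<close> bijectively to those of
  \<open>w\<close>. The number itself is never computed.\<close>

lemma card_cut_perms:
  assumes "inj_on w {..<n}" and a: "a < n"
  shows "card (cut_perms n a w) = card (cut_perms n a real)"
proof -
  let ?M = "w ` {..<n}"
  have cM: "card ?M = n" using assms by (simp add: card_image)
  define h where "h i = sorted_list_of_set ?M ! i" for i
  have len: "length (sorted_list_of_set ?M) = n" using cM by simp
  have h: "bij_betw h {..<n} ?M"
    unfolding h_def using len by (intro bij_betw_nth) auto
  have h2: "strict_mono_on {..<n} h"
    using sorted_wrt_nth_less[OF strict_sorted_list_of_set[of ?M]] len
    by (auto simp: strict_mono_on_def h_def)
  have wb: "bij_betw w {..<n} ?M" using assms by (simp add: bij_betw_def)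
  define \<tau> where "\<tau> i = (if i < n then inv_into {..<n} w (h i) else i)" for i
  have "bij_betw (inv_into {..<n} w \<circ> h) {..<n} {..<n}"
    using h bij_betw_inv_into[OF wb] by (rule bij_betw_trans)
  then have "bij_betw \<tau> {..<n} {..<n}"
    by (rule bij_betw_cong[THEN iffD1, rotated]) (simp add: \<tau>_def)
  then have \<tau>: "\<tau> permutes {..<n}" by (rule bij_imp_permutes) (simp add: \<tau>_def)
  have w\<tau>: "w (\<tau> i) = h i" if "i < n" for i
    using that h by (auto simp: \<tau>_def bij_betw_def intro!: f_inv_into_f)
  have le: "w (\<tau> i) \<le> w (\<tau> j) \<longleftrightarrow> real i \<le> real j" if "i < n" "j < n" for i j
    using that by (simp add: w\<tau> strict_mono_on_less_eq[OF h2])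
  have "cut_perms n a w = (\<lambda>\<rho>. \<tau> \<circ> \<rho>) ` cut_perms n a real"
  proof (intro equalityI subsetI)
    fix \<sigma> assume \<sigma>: "\<sigma> \<in> cut_perms n a w"
    define \<rho> where "\<rho> = inv \<tau> \<circ> \<sigma>"
    have \<sigma>\<rho>: "\<sigma> = \<tau> \<circ> \<rho>" using permutes_inv_o(1)[OF \<tau>] by (simp add: \<rho>_def o_assoc)
    have \<rho>: "\<rho> permutes {..<n}" unfolding \<rho>_def using \<sigma> \<tau>
      by (intro permutes_compose permutes_inv) (auto simp: cut_perms_def)
    have lt: "\<rho> i < n" if "i < n" for i using permutes_in_image[OF \<rho>, of i] that by simp
    have "\<rho> \<in> cut_perms n a real" using \<sigma> \<rho> a unfolding cut_perms_def \<sigma>\<rho> by (auto simp: le lt)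
    then show "\<sigma> \<in> (\<lambda>\<rho>. \<tau> \<circ> \<rho>) ` cut_perms n a real" using \<sigma>\<rho> by blast
  next
    fix \<sigma> assume "\<sigma> \<in> (\<lambda>\<rho>. \<tau> \<circ> \<rho>) ` cut_perms n a real"
    then obtain \<rho> where \<sigma>: "\<sigma> = \<tau> \<circ> \<rho>" and \<rho>r: "\<rho> \<in> cut_perms n a real" by auto
    then have \<rho>: "\<rho> permutes {..<n}" by (simp add: cut_perms_def)
    have lt: "\<rho> i < n" if "i < n" for i using permutes_in_image[OF \<rho>, of i] that by simp
    show "\<sigma> \<in> cut_perms n a w" using \<rho>r permutes_compose[OF \<rho> \<tau>] a
      unfolding cut_perms_def \<sigma> by (auto simp: le lt)
  qed
  moreover have "inj_on (\<lambda>\<rho>. \<tau> \<circ> \<rho>) (cut_perms n a real)"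
    using permutes_inj[OF \<tau>] by (auto simp: inj_on_def fun_eq_iff)
  ultimately show ?thesis by (simp add: card_image)
qed

lemma cut_perms_pos: "0 < card (cut_perms n a real)"
proof -
  have "finite (cut_perms n a real)"
    by (rule finite_subset[OF _ finite_permutations[of "{..<n}"]]) (auto simp: cut_perms_def)
  moreover have "id \<in> cut_perms n a real" by (auto simp: cut_perms_def permutes_id)
  ultimately show ?thesis by (auto simp: card_gt_0_iff)
qed

definition cut_set :: "'n \<Rightarrow> nat \<Rightarrow> nat \<Rightarrow> (nat \<Rightarrow> real^'n) set" where
  "cut_set k n a = {x. (\<forall>j<a. x j $ k \<le> x a $ k) \<and> (\<forall>j\<in>{a<..<n}. x a $ k \<le> x j $ k)}"

lemma borel_measurable_cut_set:
  assumes a: "a < n"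
  shows "(\<lambda>x. indicator (cut_set k n a) x :: ennreal) \<in> borel_measurable (PiM {..<n} (\<lambda>_. (unif_cube :: (real^'n) measure)))"
proof -
  let ?P = "PiM {..<n} (\<lambda>_. (unif_cube :: (real^'n) measure))"
  have m: "(\<lambda>x. x i $ k) \<in> borel_measurable ?P" if "i < n" for i
    using that by (auto intro!: borel_measurable_vec_nth measurable_component_singleton)
  have [measurable]: "Measurable.pred ?P (\<lambda>x. x \<in> cut_set k n a)"
  proof -
    have "Measurable.pred ?P (\<lambda>x. x j $ k \<le> x a $ k)" if "j < n" for j
      unfolding pred_def by (rule borel_measurable_le[OF m[OF that] m[OF a]])
    moreover have "Measurable.pred ?P (\<lambda>x. x a $ k \<le> x j $ k)" if "j < n" for j
      unfolding pred_def by (rule borel_measurable_le[OF m[OF a] m[OF that]])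
    ultimately have "Measurable.pred ?P (\<lambda>x. (\<forall>j\<in>{..<a}. x j $ k \<le> x a $ k) \<and> (\<forall>j\<in>{a<..<n}. x a $ k \<le> x j $ k))"
      using a by (intro pred_intros_logic pred_intros_finite finite_lessThan finite_greaterThanLessThan) (simp_all only: lessThan_iff greaterThanLessThan_iff)
    then show ?thesis by (simp only: cut_set_def mem_Collect_eq Ball_def lessThan_iff)
  qed
  then show "(\<lambda>x. indicator (cut_set k n a) x :: ennreal) \<in> borel_measurable ?P"
    by (intro borel_measurable_indicator') (simp add: pred_def)
qed

text \<open>Exchangeability: the integral over the cut set does not change when the sample is
  relabelled inside the indicator, so \<open>fact n\<close> copies of it can be written as a sum
  over all permutations. Almost every sample is counted by exactly
  \<open>card (cut_perms n a real)\<close> of them.\<close>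

lemma nn_integral_cut_set:
  assumes a: "a < n" and [measurable]: "H \<in> borel_measurable (PiM {..<n} (\<lambda>_. (unif_cube :: (real^'n) measure)))"
    and sym: "\<And>\<sigma> x. \<sigma> permutes {..<n} \<Longrightarrow> H (\<lambda>i\<in>{..<n}. x (\<sigma> i)) = H x"
  shows "of_nat (fact n) * (\<integral>\<^sup>+ x. H x * indicator (cut_set k n a) x \<partial>PiM {..<n} (\<lambda>_. unif_cube))
    = of_nat (card (cut_perms n a real)) * (\<integral>\<^sup>+ x. H x \<partial>PiM {..<n} (\<lambda>_. (unif_cube :: (real^'n) measure)))"
proof -
  let ?P = "PiM {..<n} (\<lambda>_. (unif_cube :: (real^'n) measure))"
  let ?S = "{\<sigma>. \<sigma> permutes {..<n}}"
  have fS: "finite ?S" by (rule finite_permutations) simp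
  note [measurable] = borel_measurable_cut_set[OF a, of k]
  have mp: "(\<lambda>x. \<lambda>i\<in>{..<n}. x (\<sigma> i)) \<in> ?P \<rightarrow>\<^sub>M ?P" "distr ?P ?P (\<lambda>x. \<lambda>i\<in>{..<n}. x (\<sigma> i)) = ?P"
    if "\<sigma> permutes {..<n}" for \<sigma>
    using that prob_space_unif_cube permutes_in_image[OF that]
    by (auto intro!: measurable_restrict measurable_component_singleton distr_PiM_reindex permutes_inj_on)
  have eq: "(\<integral>\<^sup>+ x. H x * indicator (cut_set k n a) x \<partial>?P)
     = (\<integral>\<^sup>+ x. H x * indicator (cut_set k n a) (\<lambda>i\<in>{..<n}. x (\<sigma> i)) \<partial>?P)" if \<sigma>: "\<sigma> permutes {..<n}" for \<sigma>
  proof -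
    have "(\<integral>\<^sup>+ x. H x * indicator (cut_set k n a) x \<partial>?P)
       = (\<integral>\<^sup>+ x. H x * indicator (cut_set k n a) x \<partial>distr ?P ?P (\<lambda>x. \<lambda>i\<in>{..<n}. x (\<sigma> i)))"
      by (simp add: mp(2)[OF \<sigma>])
    also have "\<dots> = (\<integral>\<^sup>+ x. H x * indicator (cut_set k n a) (\<lambda>i\<in>{..<n}. x (\<sigma> i)) \<partial>?P)"
      using mp(1)[OF \<sigma>] by (subst nn_integral_distr) (auto simp: sym[OF \<sigma>])
    finally show ?thesis .
  qed
  have [measurable]: "(\<lambda>x. indicator (cut_set k n a) (\<lambda>i\<in>{..<n}. x (\<sigma> i)) :: ennreal) \<in> borel_measurable ?P"
    if "\<sigma> permutes {..<n}" for \<sigma>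
    using mp(1)[OF that] by (rule measurable_compose) measurable
  have "of_nat (fact n) * (\<integral>\<^sup>+ x. H x * indicator (cut_set k n a) x \<partial>?P)
    = (\<Sum>\<sigma>\<in>?S. \<integral>\<^sup>+ x. H x * indicator (cut_set k n a) (\<lambda>i\<in>{..<n}. x (\<sigma> i)) \<partial>?P)"
    by (simp add: eq[symmetric] card_permutations)
  also have "\<dots> = (\<integral>\<^sup>+ x. (\<Sum>\<sigma>\<in>?S. H x * indicator (cut_set k n a) (\<lambda>i\<in>{..<n}. x (\<sigma> i))) \<partial>?P)"
    by (subst nn_integral_sum) auto
  also have "\<dots> = (\<integral>\<^sup>+ x. of_nat (card (cut_perms n a real)) * H x \<partial>?P)"
  proof (rule nn_integral_cong_AE)
    have "(\<Sum>\<sigma>\<in>?S. H x * indicator (cut_set k n a) (\<lambda>i\<in>{..<n}. x (\<sigma> i))) = of_nat (card (cut_perms n a real)) * H x"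
      if "inj_on (\<lambda>i. x i $ k) {..<n}" for x
    proof -
      have "(\<Sum>\<sigma>\<in>?S. H x * indicator (cut_set k n a) (\<lambda>i\<in>{..<n}. x (\<sigma> i)))
        = (\<Sum>\<sigma>\<in>?S. H x * indicator (cut_perms n a (\<lambda>i. x i $ k)) \<sigma>)"
        using a by (intro sum.cong refl) (auto simp: indicator_def cut_set_def cut_perms_def)
      also have "\<dots> = H x * of_nat (card (?S \<inter> cut_perms n a (\<lambda>i. x i $ k)))"
        using fS by (simp add: sum_distrib_left[symmetric] indicator_def sum.If_cases)
      also have "?S \<inter> cut_perms n a (\<lambda>i. x i $ k) = cut_perms n a (\<lambda>i. x i $ k)" by (auto simp: cut_perms_def)
      finally show ?thesis by (simp only: card_cut_perms[OF that a] mult.commute)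
    qed
    then show "AE x in ?P. (\<Sum>\<sigma>\<in>?S. H x * indicator (cut_set k n a) (\<lambda>i\<in>{..<n}. x (\<sigma> i))) = of_nat (card (cut_perms n a real)) * H x"
      using AE_unif_distinct[of "{..<n}" k] by (auto elim!: eventually_mono)
  qed
  also have "\<dots> = of_nat (card (cut_perms n a real)) * (\<integral>\<^sup>+ x. H x \<partial>?P)"
    by (intro nn_integral_cmult) measurable
  finally show ?thesis .
qed


lemma nn_integral_cube_low:
  assumes [measurable]: "f \<in> borel_measurable borel" and t: "0 < t" "t < 1"
  shows "(\<integral>\<^sup>+ x. f x * indicator {x. x $ k \<le> t} x \<partial>(unif_cube :: (real^'n) measure))
    = ennreal t * (\<integral>\<^sup>+ x. f (aff k 0 t x) \<partial>unif_cube)"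
proof -
  have "(\<integral>\<^sup>+ x. f x * indicator {x. x $ k \<le> t} x \<partial>(unif_cube :: (real^'n) measure))
    = (\<integral>\<^sup>+ x. f x * indicator {x. 0 \<le> x $ k \<and> x $ k \<le> 0 + t} x \<partial>unif_cube)"
    using AE_unif_cube by (intro nn_integral_cong_AE) (auto simp: indicator_def mem_cbox_01 elim!: eventually_mono)
  also have "\<dots> = ennreal t * (\<integral>\<^sup>+ x. f (aff k 0 t x) \<partial>unif_cube)"
    using t by (intro nn_integral_cube_slab) auto
  finally show ?thesis .
qed

lemma nn_integral_cube_up:
  assumes [measurable]: "f \<in> borel_measurable borel" and t: "0 < t" "t < 1"
  shows "(\<integral>\<^sup>+ x. f x * indicator {x. t \<le> x $ k} x \<partial>(unif_cube :: (real^'n) measure))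
    = ennreal (1 - t) * (\<integral>\<^sup>+ x. f (aff k t (1 - t) x) \<partial>unif_cube)"
proof -
  have "(\<integral>\<^sup>+ x. f x * indicator {x. t \<le> x $ k} x \<partial>(unif_cube :: (real^'n) measure))
    = (\<integral>\<^sup>+ x. f x * indicator {x. t \<le> x $ k \<and> x $ k \<le> t + (1 - t)} x \<partial>unif_cube)"
    using AE_unif_cube by (intro nn_integral_cong_AE) (auto simp: indicator_def mem_cbox_01 elim!: eventually_mono)
  also have "\<dots> = ennreal (1 - t) * (\<integral>\<^sup>+ x. f (aff k t (1 - t) x) \<partial>unif_cube)"
    using t by (intro nn_integral_cube_slab) auto
  finally show ?thesis .
qed

definition glue :: "nat \<Rightarrow> nat \<Rightarrow> 'a \<Rightarrow> (nat \<Rightarrow> 'a) \<Rightarrow> (nat \<Rightarrow> 'a) \<Rightarrow> nat \<Rightarrow> 'a" where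
  "glue n a z u v = (\<lambda>i\<in>{..<n}. if i < a then u i else if i = a then z else v i)"

text \<open>\<open>u\<close> and \<open>v\<close> consist of points of the whole cube, squeezed into
  the slabs below and above \<open>z\<close>. In these coordinates the separating point and the two
  partial samples become independent.\<close>

definition cut_pts :: "'n \<Rightarrow> nat \<Rightarrow> nat \<Rightarrow> real^'n \<Rightarrow> (nat \<Rightarrow> real^'n) \<Rightarrow> (nat \<Rightarrow> real^'n) \<Rightarrow> nat \<Rightarrow> real^'n" where
  "cut_pts k n a z u v = glue n a z (\<lambda>i\<in>{..<a}. aff k 0 (z $ k) (u i)) (\<lambda>i\<in>{a<..<n}. aff k (z $ k) (1 - z $ k) (v i))"

lemma measurable_glue [measurable]:
  assumes z: "z \<in> M \<rightarrow>\<^sub>M N" and u: "u \<in> M \<rightarrow>\<^sub>M PiM {..<a} (\<lambda>_. N)" and v: "v \<in> M \<rightarrow>\<^sub>M PiM {a<..<n} (\<lambda>_. N)"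
  shows "(\<lambda>w. glue n a (z w) (u w) (v w)) \<in> M \<rightarrow>\<^sub>M PiM {..<n} (\<lambda>_. N)"
  unfolding glue_def
proof (rule measurable_restrict)
  fix i assume "i \<in> {..<n}"
  then consider "i < a" | "i = a" | "i \<in> {a<..<n}" by fastforce
  then show "(\<lambda>w. if i < a then u w i else if i = a then z w else v w i) \<in> M \<rightarrow>\<^sub>M N"
  proof cases
    case 1
    then show ?thesis using measurable_compose[OF u measurable_component_singleton[of i "{..<a}"]] by simp
  next
    case 3
    then show ?thesis using measurable_compose[OF v measurable_component_singleton[of i "{a<..<n}"]] by simp
  qed (simp add: z)
qed

lemma measurable_unif_cube1 [simp]: "borel_measurable (unif_cube :: (real^'n) measure) = borel_measurable borel"
  by (rule measurable_cong_sets) auto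

lemma measurable_unif_cube2 [simp]: "M \<rightarrow>\<^sub>M (unif_cube :: (real^'n) measure) = M \<rightarrow>\<^sub>M borel"
  by (rule measurable_cong_sets) auto

lemma measurable_cut_pts:
  assumes z: "z \<in> M \<rightarrow>\<^sub>M unif_cube" and u: "u \<in> M \<rightarrow>\<^sub>M PiM {..<a} (\<lambda>_. unif_cube)" and v: "v \<in> M \<rightarrow>\<^sub>M PiM {a<..<n} (\<lambda>_. unif_cube)"
  shows "(\<lambda>w. cut_pts k n a (z w) (u w) (v w)) \<in> M \<rightarrow>\<^sub>M PiM {..<n} (\<lambda>_. (unif_cube :: (real^'n) measure))"
  unfolding cut_pts_def
proof (intro measurable_glue measurable_restrict)
  have [measurable]: "z \<in> borel_measurable M" using z by simp
  show "z \<in> M \<rightarrow>\<^sub>M unif_cube" by (rule z)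
  fix i
  show "(\<lambda>w. aff k 0 (z w $ k) (u w i)) \<in> M \<rightarrow>\<^sub>M unif_cube" if "i \<in> {..<a}"
    using measurable_compose[OF u measurable_component_singleton[OF that]] by simp
  show "(\<lambda>w. aff k (z w $ k) (1 - z w $ k) (v w i)) \<in> M \<rightarrow>\<^sub>M unif_cube" if "i \<in> {a<..<n}"
    using measurable_compose[OF v measurable_component_singleton[OF that]] by simp
qed

text \<open>Once \<open>z\<close> is fixed, membership in the cut set is a product of slab
  conditions on the other points. Each of the \<open>a\<close> lower points contributes a factor
  \<open>z $ k\<close> and each upper point a factor \<open>1 - z $ k\<close>; together they give
  the Beta weight.\<close>

lemma nn_integral_cut_decomp:
  assumes a: "a < n" and F: "F \<in> borel_measurable (PiM {..<n} (\<lambda>_. (unif_cube :: (real^'n) measure)))"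
    and Fi: "(\<lambda>x. F x * indicator (cut_set k n a) x) \<in> borel_measurable (PiM {..<n} (\<lambda>_. (unif_cube :: (real^'n) measure)))"
  shows "(\<integral>\<^sup>+ x. F x * indicator (cut_set k n a) x \<partial>PiM {..<n} (\<lambda>_. unif_cube))
    = (\<integral>\<^sup>+ z. ennreal ((z $ k) ^ a * (1 - z $ k) ^ (n - a - 1)) *
        (\<integral>\<^sup>+ u. \<integral>\<^sup>+ v. F (cut_pts k n a z u v) \<partial>PiM {a<..<n} (\<lambda>_. unif_cube) \<partial>PiM {..<a} (\<lambda>_. unif_cube)) \<partial>(unif_cube :: (real^'n) measure))"
proof -
  let ?U = "unif_cube :: (real^'n) measure"
  let ?A = "{..<a}" and ?B = "{a<..<n}"
  interpret U: product_sigma_finite "\<lambda>_. ?U"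
    using sigma_finite_unif_cube by (simp add: product_sigma_finite_def)
  have I: "{..<n} = insert a (?A \<union> ?B)" using a by auto
  let ?G = "\<lambda>x. F x * indicator (cut_set k n a) x"
  have "(\<integral>\<^sup>+ x. ?G x \<partial>PiM {..<n} (\<lambda>_. ?U)) = (\<integral>\<^sup>+ z. \<integral>\<^sup>+ w. ?G (w(a := z)) \<partial>PiM (?A \<union> ?B) (\<lambda>_. ?U) \<partial>?U)"
    using Fi unfolding I by (intro U.product_nn_integral_insert_rev) auto
  also have "\<dots> = (\<integral>\<^sup>+ z. ennreal ((z $ k) ^ a * (1 - z $ k) ^ (n - a - 1)) *
        (\<integral>\<^sup>+ u. \<integral>\<^sup>+ v. F (cut_pts k n a z u v) \<partial>PiM ?B (\<lambda>_. ?U) \<partial>PiM ?A (\<lambda>_. ?U)) \<partial>?U)"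
  proof (rule nn_integral_cong_AE)
    have "AE z in ?U. 0 < z $ k \<and> z $ k < 1"
      using AE_unif_cube AE_unif_cube_coord_neq[of k 0] AE_unif_cube_coord_neq[of k 1]
      by eventually_elim (auto simp: mem_cbox_01 less_le)
    then show "AE z in ?U. (\<integral>\<^sup>+ w. ?G (w(a := z)) \<partial>PiM (?A \<union> ?B) (\<lambda>_. ?U))
      = ennreal ((z $ k) ^ a * (1 - z $ k) ^ (n - a - 1)) *
        (\<integral>\<^sup>+ u. \<integral>\<^sup>+ v. F (cut_pts k n a z u v) \<partial>PiM ?B (\<lambda>_. ?U) \<partial>PiM ?A (\<lambda>_. ?U))"
    proof (rule eventually_mono)
      fix z :: "real^'n" assume "0 < z $ k \<and> z $ k < 1"
      then have t: "0 < z $ k" "z $ k < 1" by auto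
      let ?L = "indicator {x. x $ k \<le> z $ k} :: real^'n \<Rightarrow> ennreal"
      let ?R = "indicator {x. z $ k \<le> x $ k} :: real^'n \<Rightarrow> ennreal"
      have Gm: "(\<lambda>w. ?G (w(a := z))) \<in> borel_measurable (PiM (?A \<union> ?B) (\<lambda>_. ?U))"
        using Fi unfolding I
        by (intro measurable_compose[OF measurable_fun_upd[OF refl measurable_ident_sets[OF refl] measurable_const]]) auto
      have "(\<integral>\<^sup>+ w. ?G (w(a := z)) \<partial>PiM (?A \<union> ?B) (\<lambda>_. ?U))
        = (\<integral>\<^sup>+ u. \<integral>\<^sup>+ v. ?G ((merge ?A ?B (u, v))(a := z)) \<partial>PiM ?B (\<lambda>_. ?U) \<partial>PiM ?A (\<lambda>_. ?U))"
        by (rule U.product_nn_integral_fold[OF _ _ _ Gm]) auto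
      also have "\<dots> = (\<integral>\<^sup>+ u. (ennreal (1 - z $ k) ^ card ?B * (\<integral>\<^sup>+ v. F (glue n a z u (\<lambda>i\<in>?B. aff k (z $ k) (1 - z $ k) (v i))) \<partial>PiM ?B (\<lambda>_. ?U)))
          * (\<Prod>i\<in>?A. ?L (u i)) \<partial>PiM ?A (\<lambda>_. ?U))"
      proof (rule nn_integral_cong)
        fix u assume u: "u \<in> space (PiM ?A (\<lambda>_. ?U))"
        have Fm: "(\<lambda>v. F (glue n a z u v)) \<in> borel_measurable (PiM ?B (\<lambda>_. ?U))"
          using u by (intro measurable_compose[OF measurable_glue F]) auto
        have eqg: "(merge ?A ?B (u, v))(a := z) = glue n a z u v" for v
          using a by (auto simp: merge_def glue_def fun_eq_iff)
        have ind: "indicator (cut_set k n a) (glue n a z u v) = (\<Prod>i\<in>?A. ?L (u i)) * (\<Prod>i\<in>?B. ?R (v i))" for v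
        proof -
          have "(\<Prod>i\<in>?A. ?L (u i)) = (if \<forall>i\<in>?A. u i $ k \<le> z $ k then 1 else 0)"
            by (auto simp: indicator_def prod_zero_iff)
          moreover have "(\<Prod>i\<in>?B. ?R (v i)) = (if \<forall>i\<in>?B. z $ k \<le> v i $ k then 1 else 0)"
            by (auto simp: indicator_def prod_zero_iff)
          moreover have "glue n a z u v \<in> cut_set k n a \<longleftrightarrow> (\<forall>i\<in>?A. u i $ k \<le> z $ k) \<and> (\<forall>i\<in>?B. z $ k \<le> v i $ k)"
            using a by (auto simp: cut_set_def glue_def)
          ultimately show ?thesis by (simp add: indicator_def)
        qed
        have "(\<integral>\<^sup>+ v. ?G ((merge ?A ?B (u, v))(a := z)) \<partial>PiM ?B (\<lambda>_. ?U))
          = (\<integral>\<^sup>+ v. (F (glue n a z u v) * (\<Prod>i\<in>?B. ?R (v i))) * (\<Prod>i\<in>?A. ?L (u i)) \<partial>PiM ?B (\<lambda>_. ?U))"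
          unfolding eqg ind by (simp add: mult_ac)
        also have "\<dots> = (\<integral>\<^sup>+ v. F (glue n a z u v) * (\<Prod>i\<in>?B. ?R (v i)) \<partial>PiM ?B (\<lambda>_. ?U)) * (\<Prod>i\<in>?A. ?L (u i))"
        proof (rule nn_integral_multc)
          have "(\<lambda>v. ?R (v i)) \<in> borel_measurable (PiM ?B (\<lambda>_. ?U))" if "i \<in> ?B" for i
            using that by (intro measurable_compose[OF measurable_component_singleton]) auto
          then show "(\<lambda>v. F (glue n a z u v) * (\<Prod>i\<in>?B. ?R (v i))) \<in> borel_measurable (PiM ?B (\<lambda>_. ?U))"
            using Fm by (intro borel_measurable_times_ennreal borel_measurable_prod_ennreal) auto
        qed
        also have "(\<integral>\<^sup>+ v. F (glue n a z u v) * (\<Prod>i\<in>?B. ?R (v i)) \<partial>PiM ?B (\<lambda>_. ?U))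
          = ennreal (1 - z $ k) ^ card ?B * (\<integral>\<^sup>+ v. F (glue n a z u (\<lambda>i\<in>?B. aff k (z $ k) (1 - z $ k) (v i))) \<partial>PiM ?B (\<lambda>_. ?U))"
          by (rule nn_integral_PiM_prod[OF _ sigma_finite_unif_cube sigma_finite_unif_cube _ _ nn_integral_cube_up[OF _ t] Fm]) auto
        finally show "(\<integral>\<^sup>+ v. ?G ((merge ?A ?B (u, v))(a := z)) \<partial>PiM ?B (\<lambda>_. ?U))
          = (ennreal (1 - z $ k) ^ card ?B * (\<integral>\<^sup>+ v. F (glue n a z u (\<lambda>i\<in>?B. aff k (z $ k) (1 - z $ k) (v i))) \<partial>PiM ?B (\<lambda>_. ?U)))
          * (\<Prod>i\<in>?A. ?L (u i))" .
      qed
      also have "\<dots> = ennreal (z $ k) ^ card ?A * (\<integral>\<^sup>+ u. ennreal (1 - z $ k) ^ card ?B * (\<integral>\<^sup>+ v. F (cut_pts k n a z u v) \<partial>PiM ?B (\<lambda>_. ?U)) \<partial>PiM ?A (\<lambda>_. ?U))"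
        unfolding cut_pts_def
      proof (rule nn_integral_PiM_prod[OF _ sigma_finite_unif_cube sigma_finite_unif_cube _ _ nn_integral_cube_low[OF _ t]])
        show "(\<lambda>u. ennreal (1 - z $ k) ^ card ?B * (\<integral>\<^sup>+ v. F (glue n a z u (\<lambda>i\<in>?B. aff k (z $ k) (1 - z $ k) (v i))) \<partial>PiM ?B (\<lambda>_. ?U)))
          \<in> borel_measurable (PiM ?A (\<lambda>_. ?U))"
        proof (intro borel_measurable_times_ennreal borel_measurable_const
             sigma_finite_measure.borel_measurable_nn_integral[OF prob_space_imp_sigma_finite[OF prob_space_PiM]] prob_space_unif_cube)
          have "(\<lambda>w. glue n a z (fst w) (\<lambda>i\<in>?B. aff k (z $ k) (1 - z $ k) (snd w i)))
             \<in> PiM ?A (\<lambda>_. ?U) \<Otimes>\<^sub>M PiM ?B (\<lambda>_. ?U) \<rightarrow>\<^sub>M PiM {..<n} (\<lambda>_. ?U)"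
          proof (intro measurable_glue measurable_restrict measurable_fst)
            fix i assume i: "i \<in> ?B"
            have "(\<lambda>w. snd w i) \<in> PiM ?A (\<lambda>_. ?U) \<Otimes>\<^sub>M PiM ?B (\<lambda>_. ?U) \<rightarrow>\<^sub>M ?U"
              using measurable_compose[OF measurable_snd measurable_component_singleton[OF i]] .
            then show "(\<lambda>w. aff k (z $ k) (1 - z $ k) (snd w i)) \<in> PiM ?A (\<lambda>_. ?U) \<Otimes>\<^sub>M PiM ?B (\<lambda>_. ?U) \<rightarrow>\<^sub>M ?U"
              by simp
          qed simp
          from measurable_compose[OF this F]
          show "(\<lambda>(u, v). F (glue n a z u (\<lambda>i\<in>?B. aff k (z $ k) (1 - z $ k) (v i)))) \<in> borel_measurable (PiM ?A (\<lambda>_. ?U) \<Otimes>\<^sub>M PiM ?B (\<lambda>_. ?U))"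
            by (simp add: case_prod_beta')
        qed
      qed auto
      also have "\<dots> = ennreal (z $ k) ^ card ?A * (ennreal (1 - z $ k) ^ card ?B * (\<integral>\<^sup>+ u. (\<integral>\<^sup>+ v. F (cut_pts k n a z u v) \<partial>PiM ?B (\<lambda>_. ?U)) \<partial>PiM ?A (\<lambda>_. ?U)))"
      proof (subst nn_integral_cmult)
        have "(\<lambda>w. cut_pts k n a z (fst w) (snd w)) \<in> PiM ?A (\<lambda>_. ?U) \<Otimes>\<^sub>M PiM ?B (\<lambda>_. ?U) \<rightarrow>\<^sub>M PiM {..<n} (\<lambda>_. ?U)"
          by (intro measurable_cut_pts measurable_fst measurable_snd) simp
        from measurable_compose[OF this F]
        show "(\<lambda>u. \<integral>\<^sup>+ v. F (cut_pts k n a z u v) \<partial>PiM ?B (\<lambda>_. ?U)) \<in> borel_measurable (PiM ?A (\<lambda>_. ?U))"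
          by (intro sigma_finite_measure.borel_measurable_nn_integral[OF prob_space_imp_sigma_finite[OF prob_space_PiM]] prob_space_unif_cube)
            (simp add: case_prod_beta')
      qed simp
      finally show "(\<integral>\<^sup>+ w. ?G (w(a := z)) \<partial>PiM (?A \<union> ?B) (\<lambda>_. ?U))
        = ennreal ((z $ k) ^ a * (1 - z $ k) ^ (n - a - 1)) *
          (\<integral>\<^sup>+ u. \<integral>\<^sup>+ v. F (cut_pts k n a z u v) \<partial>PiM ?B (\<lambda>_. ?U) \<partial>PiM ?A (\<lambda>_. ?U))"
        using t by (simp add: ennreal_mult ennreal_power mult.assoc)
    qed
  qed
  finally show ?thesis .
qed

lemma mcost_cong_norm:
  assumes "\<And>i j. i \<in> I \<Longrightarrow> j \<in> I \<Longrightarrow> norm (x i - y j) = norm (x' i - y' j)"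
  shows "mcost p I x y = mcost p I x' y'"
proof -
  have "tcost p I P x y = tcost p I P x' y'" for P
    unfolding tcost_def using assms by (intro sum.cong refl) simp
  then show ?thesis by (simp add: mcost_def)
qed

section \<open>Uniform points of the cube through their coordinates\<close>

abbreviation unif_int :: "real measure" where
  "unif_int \<equiv> uniform_measure lborel {0..1}"

lemma prob_space_unif_int: "prob_space unif_int"
  by (intro prob_space_uniform_measure) auto

lemma nn_integral_unif_int:
  "f \<in> borel_measurable borel \<Longrightarrow> (\<integral>\<^sup>+ x. f x \<partial>unif_int) = (\<integral>\<^sup>+ x. f x * indicator {0..1} x \<partial>lborel)"
  by (subst nn_integral_uniform_measure) (auto simp: divide_ennreal_def)

lemma measurable_vec_lambda_PiM:
  assumes "\<And>i. sets (M i) = sets borel"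
  shows "(\<lambda>f. \<chi> i. f i) \<in> PiM (UNIV :: 'n set) M \<rightarrow>\<^sub>M (borel :: (real^'n) measure)"
proof (rule borel_measurable_vecI)
  fix i
  have "(\<lambda>f. f i) \<in> PiM (UNIV :: 'n set) M \<rightarrow>\<^sub>M M i" by (rule measurable_component_singleton) simp
  then show "(\<lambda>f. (\<chi> i. f i) $ i) \<in> borel_measurable (PiM (UNIV :: 'n set) M)"
    unfolding measurable_cong_sets[OF refl assms[of i]] vec_lambda_beta .
qed

lemma lborel_vec: "distr (PiM (UNIV :: 'n set) (\<lambda>_. lborel)) borel (\<lambda>f. \<chi> i. f i) = (lborel :: (real^'n) measure)"
proof (rule lborel_eqI[symmetric])
  fix l u :: "real^'n" assume le: "\<And>b. b \<in> Basis \<Longrightarrow> l \<bullet> b \<le> u \<bullet> b"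
  have le': "l $ i \<le> u $ i" for i using le[of "axis i 1"] by (simp add: cart_eq_inner_axis)
  interpret product_sigma_finite "\<lambda>_. lborel :: real measure" by standard
  have "emeasure (distr (PiM (UNIV :: 'n set) (\<lambda>_. lborel)) borel (\<lambda>f. \<chi> i. f i)) (box l u)
    = emeasure (PiM (UNIV :: 'n set) (\<lambda>_. lborel)) (PiE UNIV (\<lambda>i. {l $ i <..< u $ i}))"
    using measurable_vec_lambda_PiM[where M = "\<lambda>_::'n. lborel"]
    by (subst emeasure_distr) (auto simp: space_PiM mem_box_cart PiE_iff intro!: arg_cong2[where f = emeasure])
  also have "\<dots> = (\<Prod>i\<in>UNIV. emeasure lborel {l $ i <..< u $ i})" by (rule emeasure_PiM) auto
  also have "\<dots> = (\<Prod>i\<in>UNIV. ennreal (u $ i - l $ i))" using le' by simp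
  also have "\<dots> = (\<Prod>b\<in>Basis. (u - l) \<bullet> b)"
  proof -
    have "(\<Prod>b\<in>Basis. (u - l) \<bullet> b) = (\<Prod>i\<in>UNIV. (u - l) \<bullet> axis i 1)"
      by (rule prod.reindex_cong[of "\<lambda>i. axis i 1"]) (auto simp: Basis_vec_def inj_on_def axis_eq_axis)
    then show ?thesis using le' by (simp add: prod_ennreal cart_eq_inner_axis inner_diff_left)
  qed
  finally show "emeasure (distr (PiM (UNIV :: 'n set) (\<lambda>_. lborel)) borel (\<lambda>f. \<chi> i. f i)) (box l u) = (\<Prod>b\<in>Basis. (u - l) \<bullet> b)" .
qed simp

lemma nn_integral_unif_cube_PiM:
  assumes f[measurable]: "f \<in> borel_measurable borel"
  shows "(\<integral>\<^sup>+ x. f x \<partial>(unif_cube :: (real^'n) measure)) = (\<integral>\<^sup>+ x. f (\<chi> i. x i) \<partial>PiM UNIV (\<lambda>_. unif_int))"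
proof -
  note m = measurable_vec_lambda_PiM[where M = "\<lambda>_::'n. lborel"]
  have "(\<integral>\<^sup>+ x. f x \<partial>(unif_cube :: (real^'n) measure)) = (\<integral>\<^sup>+ x. f x * indicator (cbox 0 1) x \<partial>distr (PiM (UNIV :: 'n set) (\<lambda>_. lborel)) borel (\<lambda>f. \<chi> i. f i))"
    by (simp add: lborel_vec nn_integral_unif_cube)
  also have "\<dots> = (\<integral>\<^sup>+ x. f (\<chi> i. x i) * indicator (cbox 0 1) (\<chi> i. x i) \<partial>PiM (UNIV :: 'n set) (\<lambda>_. lborel))"
    using m by (subst nn_integral_distr) auto
  also have "\<dots> = (\<integral>\<^sup>+ x. f (\<chi> i. x i) * (\<Prod>i\<in>UNIV. indicator {0..1} (x i)) \<partial>PiM (UNIV :: 'n set) (\<lambda>_. lborel))"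
  proof (intro nn_integral_cong arg_cong2[where f = "(*)"] refl)
    fix x :: "'n \<Rightarrow> real"
    show "(indicator (cbox 0 1) (\<chi> i. x i) :: ennreal) = (\<Prod>i\<in>UNIV. indicator {0..1} (x i))"
      by (cases "\<forall>i. x i \<in> {0..1}") (auto simp: indicator_def mem_cbox_01 prod_zero_iff)
  qed
  also have "\<dots> = 1 ^ card (UNIV :: 'n set) * (\<integral>\<^sup>+ x. f (\<chi> i. (\<lambda>i\<in>UNIV. x i) i) \<partial>PiM (UNIV :: 'n set) (\<lambda>_. unif_int))"
  proof (rule nn_integral_PiM_prod)
    show "(\<lambda>x. f (\<chi> i. x i)) \<in> borel_measurable (PiM (UNIV :: 'n set) (\<lambda>_. lborel))"
      by (rule measurable_compose[OF m f]) simp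
    show "sigma_finite_measure unif_int" by (rule prob_space_imp_sigma_finite[OF prob_space_unif_int])
    show "(\<integral>\<^sup>+ x. g x * indicator {0..1} x \<partial>lborel) = 1 * (\<integral>\<^sup>+ x. g x \<partial>unif_int)" if "g \<in> borel_measurable lborel" for g
      using that by (simp add: nn_integral_unif_int)
  qed (auto intro: lborel.sigma_finite_measure_axioms)
  finally show ?thesis by simp
qed

lemma nn_integral_unif_cube_coord:
  fixes f :: "real \<Rightarrow> ennreal"
  assumes f[measurable]: "f \<in> borel_measurable borel"
  shows "(\<integral>\<^sup>+ x. f (x $ k) \<partial>(unif_cube :: (real^'n) measure)) = (\<integral>\<^sup>+ x. f x * indicator {0..1} x \<partial>lborel)"
proof -
  have "(\<integral>\<^sup>+ x. f (x $ k) \<partial>(unif_cube :: (real^'n) measure)) = (\<integral>\<^sup>+ x. f (x k) \<partial>PiM (UNIV :: 'n set) (\<lambda>_. unif_int))"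
    by (subst nn_integral_unif_cube_PiM) auto
  also have "\<dots> = (\<integral>\<^sup>+ x. f x \<partial>distr (PiM (UNIV :: 'n set) (\<lambda>_. unif_int)) unif_int (\<lambda>x. x k))"
    by (subst nn_integral_distr) auto
  also have "distr (PiM (UNIV :: 'n set) (\<lambda>_. unif_int)) unif_int (\<lambda>x. x k) = unif_int"
    by (rule distr_PiM_component) (auto simp: prob_space_unif_int)
  finally show ?thesis by (simp add: nn_integral_unif_int)
qed

section \<open>Central moments of the Beta law of the cut\<close>

text \<open>Up to normalisation this is the central moment of order \<open>2 * j\<close> of the Beta
  law with parameters \<open>a + 1\<close> and \<open>b + 1\<close>, whose mean is
  \<open>(a + 1) / (a + b + 2)\<close>.\<close>

definition beta_int :: "nat \<Rightarrow> nat \<Rightarrow> nat \<Rightarrow> real" where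
  "beta_int a b j = integral {0..1} (\<lambda>t. (t - (real a + 1) / (real a + real b + 2)) ^ (2 * j) * (t ^ a * (1 - t) ^ b))"

text \<open>Stein's identity for the Beta distribution: integrating the derivative of
  \<open>t ^ (a + 1) * (1 - t) ^ (b + 1) * (t - \<tau>) ^ (2 * j + 1)\<close> over \<open>[0, 1]\<close> gives 0.\<close>

lemma beta_int_Suc: "beta_int a b (Suc j) \<le> (2 * real j + 1) / (4 * (real a + real b + 2)) * beta_int a b j"
proof -
  define N where "N = real a + real b + 2"
  define \<tau> where "\<tau> = (real a + 1) / N"
  have N: "0 < N" by (simp add: N_def)
  define w where "w t = t ^ a * (1 - t) ^ b" for t :: real
  let ?F = "\<lambda>t. t ^ Suc a * (1 - t) ^ Suc b * (t - \<tau>) ^ Suc (2 * j)"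
  let ?f = "\<lambda>t. (2 * real j + 1) * ((t - \<tau>) ^ (2 * j) * (t * (1 - t)) * w t) - N * ((t - \<tau>) ^ (2 * Suc j) * w t)"
  have der: "(?F has_real_derivative ?f t) (at t)" for t
  proof -
    \<comment> \<open>Because \<open>\<tau>\<close> is the mean, the derivative of
      \<open>t ^ Suc a * (1 - t) ^ Suc b\<close> is \<open>w t\<close> times a multiple of
      \<open>t - \<tau>\<close>; this produces the next even moment.\<close>
    have eq: "(real a + 1) * (1 - t) - (real b + 1) * t = - (N * (t - \<tau>))"
    proof -
      have A: "N * (t - \<tau>) = N * t - (real a + 1)" using N by (simp add: \<tau>_def right_diff_distrib)
      show ?thesis unfolding A by (simp add: N_def algebra_simps)
    qed
    have "(?F has_real_derivative (((real a + 1) * t ^ a * (1 - t) ^ (b + 1) - (real b + 1) * (1 - t) ^ b * t ^ (a + 1)) * (t - \<tau>) ^ (2 * j + 1)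
        + t ^ (a + 1) * (1 - t) ^ (b + 1) * ((2 * real j + 1) * (t - \<tau>) ^ (2 * j)))) (at t)"
    proof -
      have d0: "((\<lambda>t. 1 - t) has_real_derivative - 1) (at t)" "((\<lambda>t. t - \<tau>) has_real_derivative 1) (at t)"
        by (auto intro!: derivative_eq_intros)
      note d = DERIV_power_Suc[OF DERIV_ident, of a t UNIV] DERIV_power_Suc[OF d0(1), of b] DERIV_power_Suc[OF d0(2), of "2 * j"]
      show ?thesis by (rule DERIV_cong[OF DERIV_mult[OF DERIV_mult[OF d(1) d(2)] d(3)]]) (simp add: algebra_simps)
    qed
    also have "((real a + 1) * t ^ a * (1 - t) ^ (b + 1) - (real b + 1) * (1 - t) ^ b * t ^ (a + 1))
      = w t * ((real a + 1) * (1 - t) - (real b + 1) * t)"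
      by (simp add: w_def algebra_simps)
    also have "\<dots> = w t * (- (N * (t - \<tau>)))" by (simp only: eq)
    also have "w t * (- (N * (t - \<tau>))) * (t - \<tau>) ^ (2 * j + 1) + t ^ (a + 1) * (1 - t) ^ (b + 1) * ((2 * real j + 1) * (t - \<tau>) ^ (2 * j)) = ?f t"
      by (simp add: w_def power_add power2_eq_square algebra_simps)
    finally show ?thesis .
  qed
  have "(?f has_integral (?F 1 - ?F 0)) {0..1}"
    using der by (intro fundamental_theorem_of_calculus)
      (auto simp: has_real_derivative_iff_has_vector_derivative[symmetric] intro: has_field_derivative_at_within)
  then have zero: "integral {0..1} ?f = 0" by (simp add: integral_unique)
  have cont: "(\<lambda>t. (t - \<tau>) ^ i * w t) integrable_on {0..1}" "(\<lambda>t. (t - \<tau>) ^ i * (t * (1 - t)) * w t) integrable_on {0..1}" for i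
    unfolding w_def by (intro integrable_continuous_real continuous_intros)+
  have "integral {0..1} ?f = (2 * real j + 1) * integral {0..1} (\<lambda>t. (t - \<tau>) ^ (2 * j) * (t * (1 - t)) * w t)
     - N * integral {0..1} (\<lambda>t. (t - \<tau>) ^ (2 * Suc j) * w t)"
  proof -
    have i: "(\<lambda>t. (2 * real j + 1) * ((t - \<tau>) ^ (2 * j) * (t * (1 - t)) * w t)) integrable_on {0..1}"
      "(\<lambda>t. N * ((t - \<tau>) ^ (2 * Suc j) * w t)) integrable_on {0..1}"
      unfolding w_def by (intro integrable_continuous_real continuous_intros)+
    show ?thesis by (simp only: integral_diff[OF i] integral_mult_right)
  qed
  then have "N * integral {0..1} (\<lambda>t. (t - \<tau>) ^ (2 * Suc j) * w t)
     = (2 * real j + 1) * integral {0..1} (\<lambda>t. (t - \<tau>) ^ (2 * j) * (t * (1 - t)) * w t)"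
    using zero by simp
  \<comment> \<open>Bounding \<open>t * (1 - t)\<close> by \<open>1/4\<close> leads back to a moment
    with the same weight, and explains the 4 in the statement.\<close>
  also have "integral {0..1} (\<lambda>t. (t - \<tau>) ^ (2 * j) * (t * (1 - t)) * w t) \<le> integral {0..1} (\<lambda>t. 1/4 * ((t - \<tau>) ^ (2 * j) * w t))"
  proof (rule integral_le)
    fix t :: real assume t: "t \<in> {0..1}"
    have "t * (1 - t) \<le> 1/4" using zero_le_square[of "t - 1/2"] by (simp add: algebra_simps)
    moreover have "0 \<le> (t - \<tau>) ^ (2 * j) * w t" using t by (simp add: w_def power_mult)
    ultimately have "t * (1 - t) * ((t - \<tau>) ^ (2 * j) * w t) \<le> 1/4 * ((t - \<tau>) ^ (2 * j) * w t)"
      by (rule mult_right_mono)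
    then show "(t - \<tau>) ^ (2 * j) * (t * (1 - t)) * w t \<le> 1/4 * ((t - \<tau>) ^ (2 * j) * w t)" by (simp add: mult_ac)
  qed (auto intro!: cont integrable_on_cmult_left)
  also have "\<dots> = 1/4 * integral {0..1} (\<lambda>t. (t - \<tau>) ^ (2 * j) * w t)" by (rule integral_mult_right)
  finally have "N * integral {0..1} (\<lambda>t. (t - \<tau>) ^ (2 * Suc j) * w t) \<le> (2 * real j + 1) * (1/4 * integral {0..1} (\<lambda>t. (t - \<tau>) ^ (2 * j) * w t))"
    by (simp add: mult_left_mono)
  then show ?thesis
    unfolding beta_int_def N_def[symmetric] \<tau>_def[symmetric] w_def[symmetric] using N by (simp add: field_simps)
qed

lemma beta_int_nonneg: "0 \<le> beta_int a b j"
  unfolding beta_int_def by (intro integral_nonneg integrable_continuous_real continuous_intros) (auto simp: power_mult)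

text \<open>Each use of \<open>beta_int_Suc\<close> gains a factor \<open>1 / (a + b + 2)\<close>.
  So the even central moments are of the size of those of a Gaussian with variance
  \<open>1 / (a + b + 2)\<close>, uniformly in the position of the cut.\<close>

lemma beta_int_le: "\<exists>C\<ge>0. \<forall>a b. beta_int a b j * (real a + real b + 2) ^ j \<le> C * beta_int a b 0"
proof (induction j)
  case 0
  then show ?case by (intro exI[of _ 1]) auto
next
  case (Suc j)
  then obtain C where C: "0 \<le> C" "\<And>a b. beta_int a b j * (real a + real b + 2) ^ j \<le> C * beta_int a b 0" by auto
  have "beta_int a b (Suc j) * (real a + real b + 2) ^ Suc j \<le> (2 * real j + 1) / 4 * C * beta_int a b 0" for a b
  proof -
    define N where "N = real a + real b + 2"
    have N: "0 < N" by (simp add: N_def)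
    have "beta_int a b (Suc j) * N ^ Suc j \<le> ((2 * real j + 1) / (4 * N) * beta_int a b j) * N ^ Suc j"
      using beta_int_Suc[of a b j] N unfolding N_def[symmetric] by (intro mult_right_mono) auto
    also have "\<dots> = (2 * real j + 1) / 4 * (beta_int a b j * N ^ j)" using N by (simp add: field_simps)
    also have "\<dots> \<le> (2 * real j + 1) / 4 * (C * beta_int a b 0)"
      using C(2)[of a b] unfolding N_def[symmetric] by (intro mult_left_mono) auto
    finally show ?thesis by (simp add: N_def mult.assoc)
  qed
  then show ?case using C(1) by (intro exI[of _ "(2 * real j + 1) / 4 * C"]) auto
qed

lemma nn_integral_beta:
  assumes c: "0 \<le> c"
  shows "(\<integral>\<^sup>+ z. ennreal (c * ((z $ k) ^ a * (1 - z $ k) ^ b)) * ennreal ((z $ k - (real a + 1) / (real a + real b + 2)) ^ (2 * j)) \<partial>(unif_cube :: (real^'n) measure))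
    = ennreal (c * beta_int a b j)"
proof -
  let ?\<tau> = "(real a + 1) / (real a + real b + 2)"
  have "(\<integral>\<^sup>+ z. ennreal (c * ((z $ k) ^ a * (1 - z $ k) ^ b)) * ennreal ((z $ k - ?\<tau>) ^ (2 * j)) \<partial>(unif_cube :: (real^'n) measure))
    = (\<integral>\<^sup>+ t. ennreal (c * (t ^ a * (1 - t) ^ b)) * ennreal ((t - ?\<tau>) ^ (2 * j)) * indicator {0..1} t \<partial>lborel)"
    by (rule nn_integral_unif_cube_coord[where f = "\<lambda>t. ennreal (c * (t ^ a * (1 - t) ^ b)) * ennreal ((t - ?\<tau>) ^ (2 * j))"]) measurable
  also have "\<dots> = (\<integral>\<^sup>+ t. ennreal (c * ((t - ?\<tau>) ^ (2 * j) * (t ^ a * (1 - t) ^ b))) * indicator {0..1} t \<partial>lborel)"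
    using c by (intro nn_integral_cong) (auto simp: indicator_def ennreal_mult[symmetric] power_mult mult_ac)
  also have "\<dots> = ennreal (c * beta_int a b j)"
  proof (rule nn_integral_has_integral_lebesgue')
    show "0 \<le> c * ((t - ?\<tau>) ^ (2 * j) * (t ^ a * (1 - t) ^ b))" if "t \<in> {0..1}" for t
      using c that by (auto simp: power_mult)
    show "((\<lambda>t. c * ((t - ?\<tau>) ^ (2 * j) * (t ^ a * (1 - t) ^ b))) has_integral c * beta_int a b j) {0..1}"
      unfolding beta_int_def
      by (intro has_integral_mult_right integrable_integral integrable_continuous_real continuous_intros)
  qed
  finally show ?thesis .
qed

lemma powr_le_one_add_power:
  fixes y p :: real
  assumes "0 \<le> y" "0 \<le> p" "p \<le> real j"
  shows "y powr p \<le> 1 + y ^ j"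
proof (cases "y \<le> 1")
  case True
  then have "y powr p \<le> 1" using assms by (cases "y = 0") (auto intro: powr_le1)
  then show ?thesis using assms by (simp add: add_increasing2)
next
  case False
  then have "y powr p \<le> y powr real j" using assms by (intro powr_mono) auto
  then show ?thesis using False by (simp add: powr_realpow)
qed

text \<open>The normalisation \<open>c\<close> remains a parameter, since being a probability
  measure determines it; the Beta function is never evaluated.\<close>

definition cut_dens :: "'n \<Rightarrow> nat \<Rightarrow> nat \<Rightarrow> real \<Rightarrow> (real^'n) measure" where
  "cut_dens k a b c = density unif_cube (\<lambda>z. ennreal (c * ((z $ k) ^ a * (1 - z $ k) ^ b)))"

lemma sets_cut_dens [simp, measurable_cong]: "sets (cut_dens k a b c) = sets borel"
  by (simp add: cut_dens_def)

text \<open>A moment of real order is controlled by an even one: for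
  \<open>y = N * (z $ k - \<tau>) ^ 2\<close> the power \<open>y powr (p/2)\<close> is at most
  \<open>1 + y ^ j\<close>, and the \<open>j\<close>-th moment of \<open>y\<close> is bounded
  uniformly in the parameters.\<close>

lemma cut_dens_moment:
  fixes p :: real
  assumes p: "0 \<le> p"
  shows "\<exists>C\<ge>0. \<forall>(k::'n::finite) a b c. 0 \<le> c \<longrightarrow> prob_space (cut_dens k a b c) \<longrightarrow>
    (\<integral>\<^sup>+ z. ennreal (\<bar>z $ k - (real a + 1) / (real a + real b + 2)\<bar> powr p) \<partial>cut_dens k a b c)
      \<le> ennreal (C * (real a + real b + 2) powr (-p/2))"
proof -
  obtain j :: nat where j: "p / 2 \<le> real j" using real_arch_simple by blast
  obtain C where C: "0 \<le> C" "\<And>a b. beta_int a b j * (real a + real b + 2) ^ j \<le> C * beta_int a b 0"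
    using beta_int_le[of j] by auto
  have "(\<integral>\<^sup>+ z. ennreal (\<bar>z $ k - (real a + 1) / (real a + real b + 2)\<bar> powr p) \<partial>cut_dens k a b c)
      \<le> ennreal ((1 + C) * (real a + real b + 2) powr (-p/2))"
    if c: "0 \<le> c" and pr: "prob_space (cut_dens k a b c)" for k :: "'n" and a b c
  proof -
    interpret prob_space "cut_dens k a b c" by (rule pr)
    define N where "N = real a + real b + 2"
    define \<tau> where "\<tau> = (real a + 1) / N"
    have N: "0 < N" by (simp add: N_def)
    have mom: "(\<integral>\<^sup>+ z. ennreal ((z $ k - \<tau>) ^ (2 * i)) \<partial>cut_dens k a b c) = ennreal (c * beta_int a b i)" for i
      unfolding cut_dens_def \<tau>_def N_def using nn_integral_beta[OF c, where k = k and a = a and b = b and j = i]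
      by (subst nn_integral_density) auto
    \<comment> \<open>The zeroth moment is the total mass, which fixes \<open>c\<close>.\<close>
    have c1: "c * beta_int a b 0 = 1"
      using mom[of 0] emeasure_space_1 by simp
    have "\<bar>z $ k - \<tau>\<bar> powr p \<le> N powr (-p/2) + N powr (-p/2) * N ^ j * (z $ k - \<tau>) ^ (2 * j)" for z :: "real^'n"
    proof -
      let ?y = "N * (z $ k - \<tau>) ^ 2"
      have "\<bar>z $ k - \<tau>\<bar> powr p = ((z $ k - \<tau>) ^ 2) powr (p/2)"
      proof -
        have "(z $ k - \<tau>) ^ 2 = \<bar>z $ k - \<tau>\<bar> powr 2" by simp
        then have "((z $ k - \<tau>) ^ 2) powr (p/2) = \<bar>z $ k - \<tau>\<bar> powr (2 * (p/2))" by (simp only: powr_powr)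
        then show ?thesis by simp
      qed
      also have "\<dots> = N powr (-p/2) * ?y powr (p/2)"
        using N by (simp add: powr_mult powr_add[symmetric] mult.assoc[symmetric])
      also have "\<dots> \<le> N powr (-p/2) * (1 + ?y ^ j)"
        using p j N by (intro mult_left_mono powr_le_one_add_power) auto
      also have "\<dots> = N powr (-p/2) + N powr (-p/2) * N ^ j * (z $ k - \<tau>) ^ (2 * j)"
        by (simp only: power_mult_distrib power_mult distrib_left mult_1_right mult.assoc)
      finally show ?thesis .
    qed
    then have "(\<integral>\<^sup>+ z. ennreal (\<bar>z $ k - \<tau>\<bar> powr p) \<partial>cut_dens k a b c)
      \<le> (\<integral>\<^sup>+ z. ennreal (N powr (-p/2)) + ennreal (N powr (-p/2) * N ^ j) * ennreal ((z $ k - \<tau>) ^ (2 * j)) \<partial>cut_dens k a b c)"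
      using N by (intro nn_integral_mono)
       (auto simp: ennreal_mult[symmetric] ennreal_plus[symmetric] power_mult simp del: ennreal_plus intro!: ennreal_leI)
    also have "\<dots> = ennreal (N powr (-p/2)) + ennreal (N powr (-p/2) * N ^ j) * ennreal (c * beta_int a b j)"
      by (subst nn_integral_add) (auto simp: nn_integral_cmult mom emeasure_space_1)
    also have "\<dots> = ennreal (N powr (-p/2) + N powr (-p/2) * N ^ j * (c * beta_int a b j))"
      using N c beta_int_nonneg[of a b j] by (simp add: ennreal_mult[symmetric] ennreal_plus[symmetric] del: ennreal_plus)
    also have "\<dots> \<le> ennreal ((1 + C) * N powr (-p/2))"
    proof (rule ennreal_leI)
      have "c * (beta_int a b j * N ^ j) \<le> c * (C * beta_int a b 0)"
        using C(2)[of a b] c unfolding N_def[symmetric] by (rule mult_left_mono)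
      then have "N powr (-p/2) * (c * (beta_int a b j * N ^ j)) \<le> N powr (-p/2) * C"
        using c1 by (intro mult_left_mono) (auto simp: mult.left_commute)
      then show "N powr (-p/2) + N powr (-p/2) * N ^ j * (c * beta_int a b j) \<le> (1 + C) * N powr (-p/2)"
        by (simp add: algebra_simps)
    qed
    finally show ?thesis by (simp add: \<tau>_def N_def)
  qed
  then show ?thesis using C(1) by (intro exI[of _ "1 + C"]) auto
qed

text \<open>Symmetrisation reduces the integral to the cut set (\<open>nn_integral_cut_set\<close>),
  and there the separating point can be split off (\<open>nn_integral_cut_decomp\<close>). To a
  symmetric function the sample thus looks like an independent triple: a point with a Beta
  distributed height and two uniform samples.\<close>

lemma cut_law:
  assumes a: "a < n" and b: "b = n - a - 1"
  obtains c where "0 \<le> c" "prob_space (cut_dens (k :: 'n::finite) a b c)"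
    "\<And>H. H \<in> borel_measurable (PiM {..<n} (\<lambda>_. unif_cube)) \<Longrightarrow>
      (\<And>\<sigma> x. \<sigma> permutes {..<n} \<Longrightarrow> H (\<lambda>i\<in>{..<n}. x (\<sigma> i)) = H x) \<Longrightarrow>
      (\<integral>\<^sup>+ x. H x \<partial>PiM {..<n} (\<lambda>_. unif_cube)) =
      (\<integral>\<^sup>+ w. H (cut_pts k n a (fst w) (fst (snd w)) (snd (snd w)))
        \<partial>(cut_dens k a b c \<Otimes>\<^sub>M (PiM {..<a} (\<lambda>_. unif_cube) \<Otimes>\<^sub>M PiM {a<..<n} (\<lambda>_. unif_cube))))"
proof -
  let ?U = "unif_cube :: (real^'n) measure"
  let ?P = "PiM {..<n} (\<lambda>_. ?U)" and ?A = "PiM {..<a} (\<lambda>_. ?U)" and ?B = "PiM {a<..<n} (\<lambda>_. ?U)"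
  define m where "m = real (card (cut_perms n a real))"
  have m: "0 < m" using cut_perms_pos[of n a] by (simp add: m_def)
  \<comment> \<open>Of the \<open>fact n\<close> labellings of a sample without ties,
    \<open>m\<close> are admissible; the ratio compensates for integrating over the cut set
    only.\<close>
  define c where "c = fact n / m"
  have c: "0 < c" using m by (simp add: c_def)
  interpret A: prob_space ?A by (intro prob_space_PiM prob_space_unif_cube)
  interpret B: prob_space ?B by (intro prob_space_PiM prob_space_unif_cube)
  interpret P: prob_space ?P by (intro prob_space_PiM prob_space_unif_cube)
  interpret AB: pair_prob_space ?A ?B ..
  have main: "(\<integral>\<^sup>+ x. H x \<partial>?P) = (\<integral>\<^sup>+ z. \<integral>\<^sup>+ u. \<integral>\<^sup>+ v. H (cut_pts k n a z u v) \<partial>?B \<partial>?A \<partial>cut_dens k a b c)"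
    if H: "H \<in> borel_measurable ?P" and sym: "\<And>\<sigma> x. \<sigma> permutes {..<n} \<Longrightarrow> H (\<lambda>i\<in>{..<n}. x (\<sigma> i)) = H x" for H
  proof -
    let ?J = "\<lambda>z. \<integral>\<^sup>+ u. \<integral>\<^sup>+ v. H (cut_pts k n a z u v) \<partial>?B \<partial>?A"
    have Jm: "?J \<in> borel_measurable ?U"
    proof -
      have "(\<lambda>w. cut_pts k n a (fst (fst w)) (snd (fst w)) (snd w)) \<in> (?U \<Otimes>\<^sub>M ?A) \<Otimes>\<^sub>M ?B \<rightarrow>\<^sub>M ?P"
        by (intro measurable_cut_pts measurable_compose[OF measurable_fst] measurable_fst measurable_snd)
      from measurable_compose[OF this H]
      have "(\<lambda>(zu, v). H (cut_pts k n a (fst zu) (snd zu) v)) \<in> borel_measurable ((?U \<Otimes>\<^sub>M ?A) \<Otimes>\<^sub>M ?B)"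
        by (simp add: case_prod_beta')
      then have "(\<lambda>zu. \<integral>\<^sup>+ v. H (cut_pts k n a (fst zu) (snd zu) v) \<partial>?B) \<in> borel_measurable (?U \<Otimes>\<^sub>M ?A)"
        by (rule B.borel_measurable_nn_integral)
      then have "(\<lambda>(z, u). \<integral>\<^sup>+ v. H (cut_pts k n a z u v) \<partial>?B) \<in> borel_measurable (?U \<Otimes>\<^sub>M ?A)"
        by (simp add: case_prod_beta')
      then show ?thesis by (rule A.borel_measurable_nn_integral)
    qed
    have "ennreal (fact n) * (\<integral>\<^sup>+ x. H x * indicator (cut_set k n a) x \<partial>?P) = ennreal m * (\<integral>\<^sup>+ x. H x \<partial>?P)"
      using nn_integral_cut_set[OF a H sym, of k] by (simp add: m_def ennreal_of_nat_eq_real_of_nat)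
    then have "ennreal (1 / m) * (ennreal (fact n) * (\<integral>\<^sup>+ x. H x * indicator (cut_set k n a) x \<partial>?P)) = ennreal (1 / m) * (ennreal m * (\<integral>\<^sup>+ x. H x \<partial>?P))"
      by simp
    then have "(\<integral>\<^sup>+ x. H x \<partial>?P) = ennreal c * (\<integral>\<^sup>+ x. H x * indicator (cut_set k n a) x \<partial>?P)"
      using m by (simp add: mult.assoc[symmetric] ennreal_mult[symmetric] c_def)
    also have "(\<integral>\<^sup>+ x. H x * indicator (cut_set k n a) x \<partial>?P) = (\<integral>\<^sup>+ z. ennreal ((z $ k) ^ a * (1 - z $ k) ^ b) * ?J z \<partial>?U)"
      unfolding b by (intro nn_integral_cut_decomp[OF a H] borel_measurable_times_ennreal H borel_measurable_cut_set a)
    also have "ennreal c * \<dots> = (\<integral>\<^sup>+ z. ennreal c * (ennreal ((z $ k) ^ a * (1 - z $ k) ^ b) * ?J z) \<partial>?U)"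
      using Jm by (intro nn_integral_cmult[symmetric]) auto
    also have "\<dots> = (\<integral>\<^sup>+ z. ennreal (c * ((z $ k) ^ a * (1 - z $ k) ^ b)) * ?J z \<partial>?U)"
      using c by (intro nn_integral_cong) (simp add: ennreal_mult' mult.assoc)
    also have "\<dots> = (\<integral>\<^sup>+ z. ?J z \<partial>cut_dens k a b c)"
      unfolding cut_dens_def using Jm by (subst nn_integral_density) auto
    finally show ?thesis .
  qed
  \<comment> \<open>The normalisation is read off from the formula itself, applied to the constant
    function 1.\<close>
  have pr: "prob_space (cut_dens k a b c)"
    using main[of "\<lambda>_. 1"] by (intro prob_spaceI) (simp add: A.emeasure_space_1 B.emeasure_space_1 P.emeasure_space_1)
  interpret D: prob_space "cut_dens k a b c" by (rule pr)
  interpret DAB: pair_prob_space "cut_dens k a b c" "?A \<Otimes>\<^sub>M ?B" ..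
  show ?thesis
  proof (rule that[OF less_imp_le[OF c] pr])
    fix H :: "(nat \<Rightarrow> real^'n) \<Rightarrow> ennreal" assume H: "H \<in> borel_measurable ?P" and sym: "\<And>\<sigma> x. \<sigma> permutes {..<n} \<Longrightarrow> H (\<lambda>i\<in>{..<n}. x (\<sigma> i)) = H x"
    let ?f = "\<lambda>w. H (cut_pts k n a (fst w) (fst (snd w)) (snd (snd w)))"
    have "(\<lambda>w. cut_pts k n a (fst w) (fst (snd w)) (snd (snd w))) \<in> cut_dens k a b c \<Otimes>\<^sub>M (?A \<Otimes>\<^sub>M ?B) \<rightarrow>\<^sub>M ?P"
      by (intro measurable_cut_pts measurable_compose[OF measurable_snd] measurable_fst measurable_snd)
        (simp add: cut_dens_def measurable_compose[OF measurable_fst])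
    from measurable_compose[OF this H]
    have fm: "?f \<in> borel_measurable (cut_dens k a b c \<Otimes>\<^sub>M (?A \<Otimes>\<^sub>M ?B))" .
    have "(\<integral>\<^sup>+ w. ?f w \<partial>(cut_dens k a b c \<Otimes>\<^sub>M (?A \<Otimes>\<^sub>M ?B))) = (\<integral>\<^sup>+ z. \<integral>\<^sup>+ q. ?f (z, q) \<partial>(?A \<Otimes>\<^sub>M ?B) \<partial>cut_dens k a b c)"
      using sigma_finite_measure.nn_integral_fst[OF prob_space_imp_sigma_finite[OF AB.prob_space_axioms] fm] by simp
    also have "\<dots> = (\<integral>\<^sup>+ z. \<integral>\<^sup>+ u. \<integral>\<^sup>+ v. H (cut_pts k n a z u v) \<partial>?B \<partial>?A \<partial>cut_dens k a b c)"
    proof (rule nn_integral_cong)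
      fix z assume "z \<in> space (cut_dens k a b c)"
      then have "(\<lambda>q. ?f (z, q)) \<in> borel_measurable (?A \<Otimes>\<^sub>M ?B)"
        using fm by (intro measurable_Pair2[of ?f])
      from B.nn_integral_fst[OF this]
      show "(\<integral>\<^sup>+ q. ?f (z, q) \<partial>(?A \<Otimes>\<^sub>M ?B)) = (\<integral>\<^sup>+ u. \<integral>\<^sup>+ v. H (cut_pts k n a z u v) \<partial>?B \<partial>?A)" by simp
    qed
    finally show "(\<integral>\<^sup>+ x. H x \<partial>?P) = (\<integral>\<^sup>+ w. ?f w \<partial>(cut_dens k a b c \<Otimes>\<^sub>M (?A \<Otimes>\<^sub>M ?B)))"
      using main[OF H sym] by simp
  qed
qed

section \<open>The expected cost in a box and its recursion under a cut\<close>

text \<open>Multiplication of vectors is componentwise, so \<open>s\<close> plays the role of the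
  side lengths of a box. Values in \<open>ennreal\<close> allow pointwise bounds to be integrated
  without integrability conditions.\<close>

definition Gcost :: "real \<Rightarrow> nat set \<Rightarrow> real^'n \<Rightarrow> ennreal" where
  "Gcost p I s = (\<integral>\<^sup>+ x. \<integral>\<^sup>+ y. ennreal (mcost p I (\<lambda>i. s * x i) (\<lambda>i. s * y i))
     \<partial>PiM I (\<lambda>_. unif_cube) \<partial>PiM I (\<lambda>_. (unif_cube :: (real^'n) measure)))"

lemma AE_PiM_unif_cube:
  assumes "finite I"
  shows "AE x in PiM I (\<lambda>_. (unif_cube :: (real^'n) measure)). \<forall>i\<in>I. x i \<in> cbox 0 1"
proof -
  have "AE x in PiM I (\<lambda>_. (unif_cube :: (real^'n) measure)). x i \<in> cbox 0 1" if "i \<in> I" for i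
    by (rule AE_PiM_component[OF prob_space_unif_cube that AE_unif_cube])
  then show ?thesis using assms by (intro AE_finite_allI) auto
qed

lemma borel_measurable_vec_mult [measurable]:
  assumes [measurable]: "f \<in> borel_measurable M" "g \<in> borel_measurable M"
  shows "(\<lambda>x. (f x :: real^'n) * g x) \<in> borel_measurable M"
proof (rule borel_measurable_vecI)
  show "(\<lambda>x. (f x * g x) $ i) \<in> borel_measurable M" for i by simp
qed

lemma mcost_scaled_measurable:
  assumes p: "1 \<le> p" and I: "finite I"
    and f: "f \<in> M \<rightarrow>\<^sub>M PiM I (\<lambda>_. (unif_cube :: (real^'n) measure))"
    and g: "g \<in> M \<rightarrow>\<^sub>M PiM I (\<lambda>_. (unif_cube :: (real^'n) measure))"
  shows "(\<lambda>w. mcost p (I :: nat set) (\<lambda>i. s * f w i) (\<lambda>i. s * g w i)) \<in> borel_measurable M"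
proof (rule mcost_measurable[OF I p])
  fix i assume i: "i \<in> I"
  have [measurable]: "(\<lambda>w. f w i) \<in> borel_measurable M" "(\<lambda>w. g w i) \<in> borel_measurable M"
    using measurable_compose[OF f measurable_component_singleton[OF i, of "\<lambda>_. unif_cube"]]
      measurable_compose[OF g measurable_component_singleton[OF i, of "\<lambda>_. unif_cube"]]
    unfolding measurable_unif_cube2 .
  show "(\<lambda>w. s * f w i) \<in> borel_measurable M" "(\<lambda>w. s * g w i) \<in> borel_measurable M" by measurable
qed

text \<open>The points selected by an injection are again independent and uniform, so the expected
  cost of a subsample reduces to \<open>Gcost\<close> of its index set.\<close>

lemma Gcost_marginal:
  assumes I: "finite I" and J: "finite J" and h: "inj_on h J" "h \<in> J \<rightarrow> I" and p: "1 \<le> p"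
  shows "(\<integral>\<^sup>+ x. \<integral>\<^sup>+ y. ennreal (mcost p J (\<lambda>i. s * x (h i)) (\<lambda>i. s * y (h i)))
     \<partial>PiM I (\<lambda>_. unif_cube) \<partial>PiM I (\<lambda>_. (unif_cube :: (real^'n) measure))) = Gcost p J s"
proof -
  let ?U = "unif_cube :: (real^'n) measure"
  let ?t = "\<lambda>x. \<lambda>i\<in>J. x (h i)"
  let ?P = "PiM J (\<lambda>_. ?U)" and ?Q = "PiM I (\<lambda>_. ?U)"
  have tm: "?t \<in> ?Q \<rightarrow>\<^sub>M ?P"
    using h by (intro measurable_restrict measurable_component_singleton) auto
  have d: "distr ?Q ?P ?t = ?P"
    using h prob_space_unif_cube by (intro distr_PiM_reindex)
  interpret P: prob_space ?P by (intro prob_space_PiM prob_space_unif_cube)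
  have eq: "mcost p J (\<lambda>i. s * ?t x i) (\<lambda>i. s * ?t y i) = mcost p J (\<lambda>i. s * x (h i)) (\<lambda>i. s * y (h i))" for x y
    by (rule mcost_cong) auto
  have M: "(\<lambda>y. ennreal (mcost p J (\<lambda>i. s * x i) (\<lambda>i. s * y i))) \<in> borel_measurable ?P" if "x \<in> space ?P" for x
    by (rule measurable_compose[OF mcost_scaled_measurable[OF p J measurable_const[OF that] measurable_ident_sets[OF refl]] measurable_ennreal])
  have M2: "(\<lambda>x. \<integral>\<^sup>+ y. ennreal (mcost p J (\<lambda>i. s * x i) (\<lambda>i. s * y i)) \<partial>?P) \<in> borel_measurable ?P"
  proof (rule P.borel_measurable_nn_integral)
    have "(\<lambda>w. ennreal (mcost p J (\<lambda>i. s * fst w i) (\<lambda>i. s * snd w i))) \<in> borel_measurable (?P \<Otimes>\<^sub>M ?P)"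
      by (rule measurable_compose[OF mcost_scaled_measurable[OF p J measurable_fst measurable_snd] measurable_ennreal])
    then show "(\<lambda>(x, y). ennreal (mcost p J (\<lambda>i. s * x i) (\<lambda>i. s * y i))) \<in> borel_measurable (?P \<Otimes>\<^sub>M ?P)"
      by (simp add: case_prod_beta')
  qed
  have "Gcost p J s = (\<integral>\<^sup>+ x. \<integral>\<^sup>+ y. ennreal (mcost p J (\<lambda>i. s * x i) (\<lambda>i. s * y i)) \<partial>?P \<partial>distr ?Q ?P ?t)"
    by (simp add: Gcost_def d)
  also have "\<dots> = (\<integral>\<^sup>+ x. \<integral>\<^sup>+ y. ennreal (mcost p J (\<lambda>i. s * ?t x i) (\<lambda>i. s * y i)) \<partial>?P \<partial>?Q)"
    by (rule nn_integral_distr[OF tm, unfolded measurable_distr_eq1, OF M2])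
  also have "\<dots> = (\<integral>\<^sup>+ x. \<integral>\<^sup>+ y. ennreal (mcost p J (\<lambda>i. s * ?t x i) (\<lambda>i. s * y i)) \<partial>distr ?Q ?P ?t \<partial>?Q)"
    by (simp only: d)
  also have "\<dots> = (\<integral>\<^sup>+ x. \<integral>\<^sup>+ y. ennreal (mcost p J (\<lambda>i. s * ?t x i) (\<lambda>i. s * ?t y i)) \<partial>?Q \<partial>?Q)"
  proof (rule nn_integral_cong)
    fix x assume "x \<in> space ?Q"
    then have "?t x \<in> space ?P" using tm by (rule measurable_space[rotated])
    then show "(\<integral>\<^sup>+ y. ennreal (mcost p J (\<lambda>i. s * ?t x i) (\<lambda>i. s * y i)) \<partial>distr ?Q ?P ?t)
      = (\<integral>\<^sup>+ y. ennreal (mcost p J (\<lambda>i. s * ?t x i) (\<lambda>i. s * ?t y i)) \<partial>?Q)"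
      by (rule nn_integral_distr[OF tm, unfolded measurable_distr_eq1, OF M])
  qed
  also have "\<dots> = (\<integral>\<^sup>+ x. \<integral>\<^sup>+ y. ennreal (mcost p J (\<lambda>i. s * x (h i)) (\<lambda>i. s * y (h i))) \<partial>?Q \<partial>?Q)" by (simp only: eq)
  finally show ?thesis by simp
qed

lemma Gcost_card:
  assumes I: "finite I" and p: "1 \<le> p"
  shows "Gcost p I (s :: real^'n) = Gcost p {..<card I} s"
proof -
  obtain h where h: "bij_betw h {..<card I} I" using ex_bij_betw_nat_finite[OF I] by (auto simp: atLeast0LessThan)
  have "mcost p {..<card I} (\<lambda>i. s * x (h i)) (\<lambda>i. s * y (h i)) = mcost p I (\<lambda>i. s * x i) (\<lambda>i. s * y i)" for x y
    using mcost_reindex[OF h h I, of p "\<lambda>i. s * x i" "\<lambda>i. s * y i"] .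
  moreover have "inj_on h {..<card I}" "h \<in> {..<card I} \<rightarrow> I" using h by (auto simp: bij_betw_def)
  ultimately show ?thesis using Gcost_marginal[OF I finite_lessThan _ _ p, of h "card I" s] by (simp add: Gcost_def)
qed

lemma norm_scaled_cube_diff:
  fixes s x y :: "real^'n"
  assumes "x \<in> cbox 0 1" "y \<in> cbox 0 1"
  shows "norm (s * x - s * y) \<le> norm s"
proof (rule norm_le_componentwise_cart)
  fix i
  have "0 \<le> x $ i" "x $ i \<le> 1" "0 \<le> y $ i" "y $ i \<le> 1" using assms unfolding mem_cbox_01 by blast+
  then have "\<bar>x $ i - y $ i\<bar> \<le> 1" by linarith
  then have "\<bar>s $ i\<bar> * \<bar>x $ i - y $ i\<bar> \<le> \<bar>s $ i\<bar> * 1" by (intro mult_left_mono) auto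
  then show "norm ((s * x - s * y) $ i) \<le> norm (s $ i)"
    by (simp add: right_diff_distrib[symmetric] abs_mult)
qed

lemma norm_scaled_aff_diff:
  fixes s u :: "real^'n"
  shows "norm (s * aff k a t u - s * aff k a' t' u) = \<bar>s $ k\<bar> * \<bar>(a - a') + (t - t') * u $ k\<bar>"
proof -
  have "s * aff k a t u - s * aff k a' t' u = axis k (s $ k * ((a - a') + (t - t') * u $ k))"
    by (auto simp: vec_eq_iff axis_def algebra_simps)
  then show ?thesis by (simp add: norm_eq_sqrt_inner inner_axis_axis abs_mult)
qed

text \<open>Lower points may be matched with lower ones, upper points with upper ones, and the two
  separating points with each other. The two samples are cut at different heights; stretching both
  to the common height \<open>\<tau>\<close> turns the parts into samples of the same two boxes, at
  the price of moving each point by at most \<open>norm s\<close> times the distance of its cut from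
  \<open>\<tau>\<close>.\<close>

lemma mcost_cut_pts:
  fixes s z z' :: "real^'n"
  assumes p: "1 \<le> p" and a: "a < n" and th: "0 < \<theta>" "\<theta> < 1"
    and z: "z \<in> cbox 0 1" "z' \<in> cbox 0 1"
    and u: "\<forall>i\<in>{..<a}. u i \<in> cbox 0 1" "\<forall>i\<in>{..<a}. u' i \<in> cbox 0 1"
    and v: "\<forall>i\<in>{a<..<n}. v i \<in> cbox 0 1" "\<forall>i\<in>{a<..<n}. v' i \<in> cbox 0 1"
  shows "mcost p {..<n} (\<lambda>i. s * cut_pts k n a z u v i) (\<lambda>i. s * cut_pts k n a z' u' v' i)
    \<le> (1 - \<theta>) powr (1 - p) * (mcost p {..<a} (\<lambda>i. aff k 0 \<tau> s * u i) (\<lambda>i. aff k 0 \<tau> s * u' i)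
        + mcost p {a<..<n} (\<lambda>i. aff k 0 (1 - \<tau>) s * v i) (\<lambda>i. aff k 0 (1 - \<tau>) s * v' i))
      + \<theta> powr (1 - p) * (2 powr (p - 1) * (real n * norm s powr p * (\<bar>z $ k - \<tau>\<bar> powr p + \<bar>z' $ k - \<tau>\<bar> powr p)) + norm s powr p)"
proof -
  let ?x = "\<lambda>i. s * cut_pts k n a z u v i" and ?y = "\<lambda>i. s * cut_pts k n a z' u' v' i"
  let ?A = "{..<a}" and ?B = "{a<..<n}"
  let ?c1 = "(1 - \<theta>) powr (1 - p)" and ?c2 = "\<theta> powr (1 - p)"
  define h where "h w = norm s powr p * \<bar>w $ k - \<tau>\<bar> powr p" for w :: "real^'n"
  have sk: "\<bar>s $ k\<bar> \<le> norm s" by (rule component_le_norm_cart)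
  have bd: "(\<bar>s $ k\<bar> * \<bar>w $ k - \<tau>\<bar> * r) powr p \<le> h w" if "0 \<le> r" "r \<le> 1" for w r
  proof -
    have "\<bar>s $ k\<bar> * \<bar>w $ k - \<tau>\<bar> * r \<le> norm s * \<bar>w $ k - \<tau>\<bar> * 1"
      using sk that by (intro mult_mono) auto
    then have "(\<bar>s $ k\<bar> * \<bar>w $ k - \<tau>\<bar> * r) powr p \<le> (norm s * \<bar>w $ k - \<tau>\<bar>) powr p"
      using that p by (intro powr_mono2) auto
    then show ?thesis by (simp add: h_def powr_mult)
  qed
  have lowA: "norm (s * aff k 0 (w $ k) q - s * aff k 0 \<tau> q) powr p \<le> h w" if "q \<in> cbox 0 1" for w q
    unfolding norm_scaled_aff_diff using bd[of "q $ k" w] that by (auto simp: abs_mult mem_cbox_01 mult.assoc)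
  have upB: "norm (s * aff k (w $ k) (1 - w $ k) q - s * aff k \<tau> (1 - \<tau>) q) powr p \<le> h w" if "q \<in> cbox 0 1" for w q
  proof -
    \<comment> \<open>The upper face stays fixed under the stretching, so a point moves in
      proportion to its distance \<open>1 - q $ k\<close> from that face.\<close>
    have "w $ k - \<tau> + (1 - w $ k - (1 - \<tau>)) * q $ k = (w $ k - \<tau>) * (1 - q $ k)" by (simp add: algebra_simps)
    then show ?thesis
      unfolding norm_scaled_aff_diff using bd[of "1 - q $ k" w] that by (auto simp: abs_mult mem_cbox_01 mult.assoc)
  qed
  have n: "{..<n} = (?A \<union> ?B) \<union> {a}" using a by auto
  have "mcost p {..<n} ?x ?y \<le> mcost p (?A \<union> ?B) ?x ?y + mcost p {a} ?x ?y"
    unfolding n by (rule mcost_union) auto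
  also have "mcost p (?A \<union> ?B) ?x ?y \<le> mcost p ?A ?x ?y + mcost p ?B ?x ?y"
    by (rule mcost_union) auto
  also have "mcost p {a} ?x ?y \<le> norm s powr p"
  proof -
    have "norm (s * z - s * z') \<le> norm s" by (rule norm_scaled_cube_diff[OF z])
    then have "norm (s * z - s * z') powr p \<le> norm s powr p" using p by (intro powr_mono2) auto
    moreover have "cut_pts k n a w q r a = w" for w q r using a by (simp add: cut_pts_def glue_def)
    ultimately show ?thesis using mcost_le_diag[of "{a}" p ?x ?y] by simp
  qed
  also have "mcost p ?A ?x ?y \<le> ?c1 * mcost p ?A (\<lambda>i. s * aff k 0 \<tau> (u i)) (\<lambda>i. s * aff k 0 \<tau> (u' i))
     + ?c2 * (2 powr (p - 1) * (real a * h z + real a * h z'))"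
  proof -
    have e: "cut_pts k n a w q r i = aff k 0 (w $ k) (q i)" if "i \<in> ?A" for w q r i
      using that a by (simp add: cut_pts_def glue_def)
    have "(\<Sum>i\<in>?A. norm (?x i - s * aff k 0 \<tau> (u i)) powr p) \<le> (\<Sum>i\<in>?A. h z)"
      "(\<Sum>i\<in>?A. norm (?y i - s * aff k 0 \<tau> (u' i)) powr p) \<le> (\<Sum>i\<in>?A. h z')"
      using u by (intro sum_mono; simp only: e; intro lowA; simp)+
    moreover have "(\<Sum>i\<in>?A. h w) = real a * h w" for w by simp
    ultimately have S: "(\<Sum>i\<in>?A. norm (?x i - s * aff k 0 \<tau> (u i)) powr p) \<le> real a * h z"
      "(\<Sum>i\<in>?A. norm (?y i - s * aff k 0 \<tau> (u' i)) powr p) \<le> real a * h z'"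
      by simp_all
    have "mcost p ?A ?x ?y \<le> ?c1 * mcost p ?A (\<lambda>i. s * aff k 0 \<tau> (u i)) (\<lambda>i. s * aff k 0 \<tau> (u' i))
       + ?c2 * (2 powr (p - 1) * ((\<Sum>i\<in>?A. norm (?x i - s * aff k 0 \<tau> (u i)) powr p) + (\<Sum>i\<in>?A. norm (?y i - s * aff k 0 \<tau> (u' i)) powr p)))"
      by (rule mcost_perturb[OF finite_lessThan p th])
    also have "\<dots> \<le> ?c1 * mcost p ?A (\<lambda>i. s * aff k 0 \<tau> (u i)) (\<lambda>i. s * aff k 0 \<tau> (u' i)) + ?c2 * (2 powr (p - 1) * (real a * h z + real a * h z'))"
      by (intro add_left_mono mult_left_mono add_mono S) auto
    finally show ?thesis .
  qed
  also have "mcost p ?B ?x ?y \<le> ?c1 * mcost p ?B (\<lambda>i. s * aff k \<tau> (1 - \<tau>) (v i)) (\<lambda>i. s * aff k \<tau> (1 - \<tau>) (v' i))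
     + ?c2 * (2 powr (p - 1) * (real (n - a) * h z + real (n - a) * h z'))"
  proof -
    have e: "cut_pts k n a w q r i = aff k (w $ k) (1 - w $ k) (r i)" if "i \<in> ?B" for w q r i
      using that a by (simp add: cut_pts_def glue_def)
    have "(\<Sum>i\<in>?B. h w) \<le> real (n - a) * h w" for w
      by (auto simp: h_def intro!: mult_right_mono)
    moreover have "(\<Sum>i\<in>?B. norm (?x i - s * aff k \<tau> (1 - \<tau>) (v i)) powr p) \<le> (\<Sum>i\<in>?B. h z)"
      "(\<Sum>i\<in>?B. norm (?y i - s * aff k \<tau> (1 - \<tau>) (v' i)) powr p) \<le> (\<Sum>i\<in>?B. h z')"
      using v by (intro sum_mono; simp only: e; intro upB; simp)+
    ultimately have S: "(\<Sum>i\<in>?B. norm (?x i - s * aff k \<tau> (1 - \<tau>) (v i)) powr p) \<le> real (n - a) * h z"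
      "(\<Sum>i\<in>?B. norm (?y i - s * aff k \<tau> (1 - \<tau>) (v' i)) powr p) \<le> real (n - a) * h z'"
      by (meson order_trans)+
    have "mcost p ?B ?x ?y \<le> ?c1 * mcost p ?B (\<lambda>i. s * aff k \<tau> (1 - \<tau>) (v i)) (\<lambda>i. s * aff k \<tau> (1 - \<tau>) (v' i))
       + ?c2 * (2 powr (p - 1) * ((\<Sum>i\<in>?B. norm (?x i - s * aff k \<tau> (1 - \<tau>) (v i)) powr p) + (\<Sum>i\<in>?B. norm (?y i - s * aff k \<tau> (1 - \<tau>) (v' i)) powr p)))"
      by (rule mcost_perturb[OF finite_greaterThanLessThan p th])
    also have "\<dots> \<le> ?c1 * mcost p ?B (\<lambda>i. s * aff k \<tau> (1 - \<tau>) (v i)) (\<lambda>i. s * aff k \<tau> (1 - \<tau>) (v' i)) + ?c2 * (2 powr (p - 1) * (real (n - a) * h z + real (n - a) * h z'))"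
      by (intro add_left_mono mult_left_mono add_mono S) auto
    finally show ?thesis .
  qed
  also have "mcost p ?A (\<lambda>i. s * aff k 0 \<tau> (u i)) (\<lambda>i. s * aff k 0 \<tau> (u' i)) = mcost p ?A (\<lambda>i. aff k 0 \<tau> s * u i) (\<lambda>i. aff k 0 \<tau> s * u' i)"
  proof (rule mcost_cong_norm)
    have "s * aff k 0 \<tau> q = aff k 0 \<tau> s * q" for q by (simp add: vec_eq_iff)
    then show "norm (s * aff k 0 \<tau> (u i) - s * aff k 0 \<tau> (u' j)) = norm (aff k 0 \<tau> s * u i - aff k 0 \<tau> s * u' j)" for i j by simp
  qed
  \<comment> \<open>The cost sees only differences, so the shift by \<open>\<tau>\<close> cancels
    and the upper box may be moved to the origin.\<close>
  also have "mcost p ?B (\<lambda>i. s * aff k \<tau> (1 - \<tau>) (v i)) (\<lambda>i. s * aff k \<tau> (1 - \<tau>) (v' i)) = mcost p ?B (\<lambda>i. aff k 0 (1 - \<tau>) s * v i) (\<lambda>i. aff k 0 (1 - \<tau>) s * v' i)"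
  proof (rule mcost_cong_norm)
    have "s * aff k \<tau> (1 - \<tau>) q - s * aff k \<tau> (1 - \<tau>) q' = aff k 0 (1 - \<tau>) s * q - aff k 0 (1 - \<tau>) s * q'" for q q'
      by (simp add: vec_eq_iff algebra_simps)
    then show "norm (s * aff k \<tau> (1 - \<tau>) (v i) - s * aff k \<tau> (1 - \<tau>) (v' j)) = norm (aff k 0 (1 - \<tau>) s * v i - aff k 0 (1 - \<tau>) s * v' j)" for i j by simp
  qed
  finally have "mcost p {..<n} ?x ?y \<le> ?c1 * (mcost p ?A (\<lambda>i. aff k 0 \<tau> s * u i) (\<lambda>i. aff k 0 \<tau> s * u' i)
      + mcost p ?B (\<lambda>i. aff k 0 (1 - \<tau>) s * v i) (\<lambda>i. aff k 0 (1 - \<tau>) s * v' i))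
      + ?c2 * (2 powr (p - 1) * (real n * (h z + h z'))) + norm s powr p"
    using a by (simp add: algebra_simps of_nat_diff)
  \<comment> \<open>Since \<open>\<theta> powr (1 - p)\<close> is at least 1, the cost of the
    separating pair can join the error term.\<close>
  moreover have "norm s powr p \<le> ?c2 * norm s powr p"
    using powr_mono'[of "1 - p" 0 \<theta>] th p mult_right_mono[of 1 ?c2 "norm s powr p"] by simp
  ultimately show ?thesis by (simp add: h_def algebra_simps)
qed


lemma nn_integral_pair_fst:
  assumes "prob_space N" and f: "f \<in> borel_measurable M"
  shows "(\<integral>\<^sup>+ w. f (fst w) \<partial>(M \<Otimes>\<^sub>M N)) = (\<integral>\<^sup>+ x. f x \<partial>M)"
proof -
  interpret N: prob_space N by fact
  have "(\<integral>\<^sup>+ x. f x \<partial>M) = (\<integral>\<^sup>+ x. f x \<partial>distr (M \<Otimes>\<^sub>M N) M fst)" by (simp add: N.distr_pair_fst)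
  also have "\<dots> = (\<integral>\<^sup>+ w. f (fst w) \<partial>(M \<Otimes>\<^sub>M N))"
    by (rule nn_integral_distr[OF measurable_fst, unfolded measurable_distr_eq1, OF f])
  finally show ?thesis by simp
qed

lemma nn_integral_pair_snd:
  assumes "prob_space M" and N: "prob_space N" and f: "f \<in> borel_measurable N"
  shows "(\<integral>\<^sup>+ w. f (snd w) \<partial>(M \<Otimes>\<^sub>M N)) = (\<integral>\<^sup>+ x. f x \<partial>N)"
proof -
  interpret M: prob_space M by fact
  interpret N: prob_space N by fact
  have "(\<integral>\<^sup>+ w. f (snd w) \<partial>(M \<Otimes>\<^sub>M N)) = (\<integral>\<^sup>+ x. \<integral>\<^sup>+ y. f y \<partial>N \<partial>M)"
    using N.nn_integral_fst[OF measurable_compose[OF measurable_snd f], of M] by simp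
  then show ?thesis by (simp add: M.emeasure_space_1)
qed

lemma AE_pair_fst:
  assumes "prob_space N" and "AE x in M. P x"
  shows "AE w in M \<Otimes>\<^sub>M N. P (fst w)"
proof -
  interpret N: prob_space N by fact
  show ?thesis by (rule AE_distrD[OF measurable_fst], subst N.distr_pair_fst, rule assms(2))
qed

lemma AE_pair_snd:
  assumes M: "prob_space M" and N: "prob_space N" and P: "AE x in N. P x"
  shows "AE w in M \<Otimes>\<^sub>M N. P (snd w)"
proof -
  obtain A where A: "A \<in> sets N" "emeasure N A = 0" "{x\<in>space N. \<not> P x} \<subseteq> A" using P by (auto elim: AE_E)
  have "(\<integral>\<^sup>+ w. indicator A (snd w) \<partial>(M \<Otimes>\<^sub>M N)) = 0"
    using nn_integral_pair_snd[OF M N, of "indicator A"] A by simp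
  moreover have m: "(\<lambda>w. indicator A (snd w) :: ennreal) \<in> borel_measurable (M \<Otimes>\<^sub>M N)"
    using A by (intro measurable_compose[OF measurable_snd]) auto
  ultimately have "AE w in M \<Otimes>\<^sub>M N. (indicator A (snd w) :: ennreal) = 0"
    by (simp add: nn_integral_0_iff_AE)
  with AE_space show ?thesis
  proof eventually_elim
    case (elim w)
    then show ?case using A(3) by (auto simp: indicator_def space_pair_measure split: if_splits)
  qed
qed

text \<open>\<open>mcost_cut_pts\<close> is integrated for fixed \<open>\<theta>\<close>, after
  \<open>cut_law\<close> has been applied to the first sample and then to the second; the cost is
  symmetric in each of them. In the error, \<open>real n * (real n + 1) powr (-p/2)\<close> stems
  from the displacement of up to \<open>n\<close> points and the summand 1 from the separating
  pair.\<close>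

lemma Gcost_cut:
  fixes p :: real
  assumes p: "1 \<le> p"
  shows "\<exists>C\<ge>0. \<forall>(k::'n::finite) n a (s::real^'n) \<theta>. a < n \<longrightarrow> 0 < \<theta> \<longrightarrow> \<theta> < 1 \<longrightarrow>
    Gcost p {..<n} s \<le> ennreal ((1 - \<theta>) powr (1 - p)) *
       (Gcost p {..<a} (aff k 0 ((real a + 1) / (real n + 1)) s) + Gcost p {..<n - a - 1} (aff k 0 (1 - (real a + 1) / (real n + 1)) s))
      + ennreal (\<theta> powr (1 - p) * (norm s powr p * (C * (real n * (real n + 1) powr (-p/2)) + 1)))"
proof -
  obtain C0 where C0: "0 \<le> C0" "\<And>(k::'n) a b c. 0 \<le> c \<Longrightarrow> prob_space (cut_dens k a b c) \<Longrightarrow>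
    (\<integral>\<^sup>+ z. ennreal (\<bar>z $ k - (real a + 1) / (real a + real b + 2)\<bar> powr p) \<partial>cut_dens k a b c)
      \<le> ennreal (C0 * (real a + real b + 2) powr (-p/2))"
    using cut_dens_moment[of p] p by fastforce
  \<comment> \<open>Each of the two samples contributes one moment with constant \<open>C0\<close>;
    \<open>2 powr (p - 1)\<close> is inherited from \<open>mcost_perturb\<close>.\<close>
  define C where "C = 2 powr (p - 1) * (2 * C0)"
  have "Gcost p {..<n} s \<le> ennreal ((1 - \<theta>) powr (1 - p)) *
       (Gcost p {..<a} (aff k 0 ((real a + 1) / (real n + 1)) s) + Gcost p {..<n - a - 1} (aff k 0 (1 - (real a + 1) / (real n + 1)) s))
      + ennreal (\<theta> powr (1 - p) * (norm s powr p * (C * (real n * (real n + 1) powr (-p/2)) + 1)))"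
    if a: "a < n" and th: "0 < \<theta>" "\<theta> < 1" for k :: 'n and n a and s :: "real^'n" and \<theta>
  proof -
    let ?U = "unif_cube :: (real^'n) measure"
    define b where "b = n - a - 1"
    define \<tau> where "\<tau> = (real a + 1) / (real n + 1)"
    have nb: "real a + real b + 2 = real n + 1" using a by (simp add: b_def of_nat_diff)
    let ?P = "PiM {..<n} (\<lambda>_. ?U)" and ?A = "PiM {..<a} (\<lambda>_. ?U)" and ?B = "PiM {a<..<n} (\<lambda>_. ?U)"
    obtain c where c: "0 \<le> c" "prob_space (cut_dens k a b c)"
      and law: "\<And>H. H \<in> borel_measurable ?P \<Longrightarrow> (\<And>\<sigma> x. \<sigma> permutes {..<n} \<Longrightarrow> H (\<lambda>i\<in>{..<n}. x (\<sigma> i)) = H x) \<Longrightarrow>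
        (\<integral>\<^sup>+ x. H x \<partial>?P) = (\<integral>\<^sup>+ w. H (cut_pts k n a (fst w) (fst (snd w)) (snd (snd w))) \<partial>(cut_dens k a b c \<Otimes>\<^sub>M (?A \<Otimes>\<^sub>M ?B)))"
      using cut_law[OF a b_def, of k] by blast
    let ?D = "cut_dens k a b c"
    define Q where "Q = ?D \<Otimes>\<^sub>M (?A \<Otimes>\<^sub>M ?B)"
    define V where "V w = cut_pts k n a (fst w) (fst (snd w)) (snd (snd w))" for w :: "(real^'n) \<times> (nat \<Rightarrow> real^'n) \<times> (nat \<Rightarrow> real^'n)"
    define f where "f x y = ennreal (mcost p {..<n} (\<lambda>i. s * x i) (\<lambda>i. s * y i))" for x y :: "nat \<Rightarrow> real^'n"
    interpret D: prob_space ?D by (rule c)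
    interpret A: prob_space ?A by (intro prob_space_PiM prob_space_unif_cube)
    interpret B: prob_space ?B by (intro prob_space_PiM prob_space_unif_cube)
    interpret P: prob_space ?P by (intro prob_space_PiM prob_space_unif_cube)
    interpret AB: pair_prob_space ?A ?B ..
    interpret DAB: pair_prob_space ?D "?A \<Otimes>\<^sub>M ?B" ..
    interpret Q: prob_space Q unfolding Q_def by (rule DAB.prob_space_axioms)
    have f2: "(\<lambda>w. f (fst w) (snd w)) \<in> borel_measurable (?P \<Otimes>\<^sub>M ?P)"
      unfolding f_def by (rule measurable_compose[OF mcost_scaled_measurable[OF p finite_lessThan measurable_fst measurable_snd] measurable_ennreal])
    have fx: "f x \<in> borel_measurable ?P" if "x \<in> space ?P" for x
      unfolding f_def by (rule measurable_compose[OF mcost_scaled_measurable[OF p finite_lessThan measurable_const[OF that] measurable_ident_sets[OF refl]] measurable_ennreal])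
    have id: "bij_betw id {..<n} {..<n}" by simp
    have perm1: "f (\<lambda>i\<in>{..<n}. x (\<sigma> i)) y = f x y" if "\<sigma> permutes {..<n}" for \<sigma> x y
      using mcost_reindex[OF permutes_imp_bij[OF that] id, of p "\<lambda>i. s * x i" "\<lambda>i. s * y i"]
      unfolding f_def by (subst mcost_cong[where x' = "\<lambda>i. s * x (\<sigma> i)" and y' = "\<lambda>i. s * y i"]) auto
    have perm2: "f x (\<lambda>i\<in>{..<n}. y (\<sigma> i)) = f x y" if "\<sigma> permutes {..<n}" for \<sigma> x y
      using mcost_reindex[OF id permutes_imp_bij[OF that], of p "\<lambda>i. s * x i" "\<lambda>i. s * y i"]
      unfolding f_def by (subst mcost_cong[where x' = "\<lambda>i. s * x i" and y' = "\<lambda>i. s * y (\<sigma> i)"]) auto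
    have Vm: "V \<in> Q \<rightarrow>\<^sub>M ?P"
      unfolding V_def Q_def
      by (intro measurable_cut_pts measurable_compose[OF measurable_snd] measurable_fst measurable_snd)
        (simp add: cut_dens_def measurable_compose[OF measurable_fst])
    have "Gcost p {..<n} s = (\<integral>\<^sup>+ x. \<integral>\<^sup>+ y. f x y \<partial>?P \<partial>?P)" by (simp add: Gcost_def f_def)
    also have "\<dots> = (\<integral>\<^sup>+ w. \<integral>\<^sup>+ y. f (V w) y \<partial>?P \<partial>Q)"
      unfolding V_def Q_def
    proof (rule law)
      show "(\<lambda>x. \<integral>\<^sup>+ y. f x y \<partial>?P) \<in> borel_measurable ?P"
        using f2 by (intro P.borel_measurable_nn_integral) (simp add: case_prod_beta')
    qed (simp add: perm1)
    also have "\<dots> = (\<integral>\<^sup>+ w. \<integral>\<^sup>+ w'. f (V w) (V w') \<partial>Q \<partial>Q)"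
    proof (rule nn_integral_cong)
      fix w assume w: "w \<in> space Q"
      show "(\<integral>\<^sup>+ y. f (V w) y \<partial>?P) = (\<integral>\<^sup>+ w'. f (V w) (V w') \<partial>Q)"
        using law[OF fx[OF measurable_space[OF Vm w]] perm2] unfolding V_def Q_def .
    qed
    finally have G: "Gcost p {..<n} s = (\<integral>\<^sup>+ w. \<integral>\<^sup>+ w'. f (V w) (V w') \<partial>Q \<partial>Q)" .
    let ?s1 = "aff k 0 \<tau> s" and ?s2 = "aff k 0 (1 - \<tau>) s"
    define mA where "mA x y = ennreal (mcost p {..<a} (\<lambda>i. ?s1 * x i) (\<lambda>i. ?s1 * y i))" for x y :: "nat \<Rightarrow> real^'n"
    define mB where "mB x y = ennreal (mcost p {a<..<n} (\<lambda>i. ?s2 * x i) (\<lambda>i. ?s2 * y i))" for x y :: "nat \<Rightarrow> real^'n"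
    define h where "h z = ennreal (\<bar>z $ k - \<tau>\<bar> powr p)" for z :: "real^'n"
    define c1 where "c1 = ennreal ((1 - \<theta>) powr (1 - p))"
    define c2 where "c2 = ennreal (\<theta> powr (1 - p) * (2 powr (p - 1) * (real n * norm s powr p)))"
    define c3 where "c3 = ennreal (\<theta> powr (1 - p) * norm s powr p)"
    have mA2: "(\<lambda>w. mA (fst w) (snd w)) \<in> borel_measurable (?A \<Otimes>\<^sub>M ?A)"
      unfolding mA_def by (rule measurable_compose[OF mcost_scaled_measurable[OF p finite_lessThan measurable_fst measurable_snd] measurable_ennreal])
    have mB2: "(\<lambda>w. mB (fst w) (snd w)) \<in> borel_measurable (?B \<Otimes>\<^sub>M ?B)"
      unfolding mB_def by (rule measurable_compose[OF mcost_scaled_measurable[OF p finite_greaterThanLessThan measurable_fst measurable_snd] measurable_ennreal])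
    have mAx: "mA x \<in> borel_measurable ?A" if "x \<in> space ?A" for x
      unfolding mA_def by (rule measurable_compose[OF mcost_scaled_measurable[OF p finite_lessThan measurable_const[OF that] measurable_ident_sets[OF refl]] measurable_ennreal])
    have mBx: "mB x \<in> borel_measurable ?B" if "x \<in> space ?B" for x
      unfolding mB_def by (rule measurable_compose[OF mcost_scaled_measurable[OF p finite_greaterThanLessThan measurable_const[OF that] measurable_ident_sets[OF refl]] measurable_ennreal])
    have hm: "h \<in> borel_measurable ?D" unfolding h_def by measurable
    have good: "AE w in Q. fst w \<in> cbox 0 1 \<and> (\<forall>i\<in>{..<a}. fst (snd w) i \<in> cbox 0 1) \<and> (\<forall>i\<in>{a<..<n}. snd (snd w) i \<in> cbox 0 1)"
    proof -
      have "AE z in ?D. z \<in> cbox 0 1"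
        unfolding cut_dens_def using AE_unif_cube by (subst AE_density) (auto elim!: eventually_mono)
      then have "AE w in Q. fst w \<in> cbox 0 1" unfolding Q_def by (intro AE_pair_fst AB.prob_space_axioms)
      moreover have "AE w in Q. \<forall>i\<in>{..<a}. fst (snd w) i \<in> cbox 0 1"
        unfolding Q_def by (intro AE_pair_snd AB.prob_space_axioms D.prob_space_axioms AE_pair_fst B.prob_space_axioms AE_PiM_unif_cube) auto
      moreover have "AE w in Q. \<forall>i\<in>{a<..<n}. snd (snd w) i \<in> cbox 0 1"
        unfolding Q_def by (intro AE_pair_snd A.prob_space_axioms AB.prob_space_axioms D.prob_space_axioms B.prob_space_axioms AE_PiM_unif_cube) auto
      ultimately show ?thesis by eventually_elim auto
    qed
    have marg: "(\<integral>\<^sup>+ w. g (fst w) \<partial>Q) = (\<integral>\<^sup>+ z. g z \<partial>?D)" if "g \<in> borel_measurable ?D" for g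
      unfolding Q_def by (rule nn_integral_pair_fst[OF AB.prob_space_axioms that])
    have margA: "(\<integral>\<^sup>+ w. g (fst (snd w)) \<partial>Q) = (\<integral>\<^sup>+ z. g z \<partial>?A)" if "g \<in> borel_measurable ?A" for g
      unfolding Q_def using nn_integral_pair_snd[OF D.prob_space_axioms AB.prob_space_axioms measurable_compose[OF measurable_fst that]]
        nn_integral_pair_fst[OF B.prob_space_axioms that] by (rule trans)
    have margB: "(\<integral>\<^sup>+ w. g (snd (snd w)) \<partial>Q) = (\<integral>\<^sup>+ z. g z \<partial>?B)" if "g \<in> borel_measurable ?B" for g
      unfolding Q_def using nn_integral_pair_snd[OF D.prob_space_axioms AB.prob_space_axioms measurable_compose[OF measurable_snd that]]
        nn_integral_pair_snd[OF A.prob_space_axioms B.prob_space_axioms that] by (rule trans)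
    have pj: "(\<lambda>w. fst w) \<in> Q \<rightarrow>\<^sub>M ?D" "(\<lambda>w. fst (snd w)) \<in> Q \<rightarrow>\<^sub>M ?A" "(\<lambda>w. snd (snd w)) \<in> Q \<rightarrow>\<^sub>M ?B"
      unfolding Q_def by (auto intro: measurable_compose[OF measurable_snd])
    define Eh where "Eh = (\<integral>\<^sup>+ z. h z \<partial>?D)"
    have inner: "(\<integral>\<^sup>+ w'. f (V w) (V w') \<partial>Q) \<le>
        c1 * ((\<integral>\<^sup>+ u. mA (fst (snd w)) u \<partial>?A) + (\<integral>\<^sup>+ v. mB (snd (snd w)) v \<partial>?B)) + (c2 * h (fst w) + (c2 * Eh + c3))"
      if w: "w \<in> space Q" and gw: "fst w \<in> cbox 0 1 \<and> (\<forall>i\<in>{..<a}. fst (snd w) i \<in> cbox 0 1) \<and> (\<forall>i\<in>{a<..<n}. snd (snd w) i \<in> cbox 0 1)" for w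
    proof -
      have wA: "fst (snd w) \<in> space ?A" and wB: "snd (snd w) \<in> space ?B"
        using measurable_space[OF pj(2) w] measurable_space[OF pj(3) w] by auto
      have "(\<integral>\<^sup>+ w'. f (V w) (V w') \<partial>Q) \<le> (\<integral>\<^sup>+ w'. c1 * (mA (fst (snd w)) (fst (snd w')) + mB (snd (snd w)) (snd (snd w'))) + (c2 * h (fst w) + (c2 * h (fst w') + c3)) \<partial>Q)"
      proof (rule nn_integral_mono_AE)
        show "AE w' in Q. f (V w) (V w') \<le> c1 * (mA (fst (snd w)) (fst (snd w')) + mB (snd (snd w)) (snd (snd w'))) + (c2 * h (fst w) + (c2 * h (fst w') + c3))"
          using good
        proof eventually_elim
          case (elim w')
          let ?mA = "mcost p {..<a} (\<lambda>i. ?s1 * fst (snd w) i) (\<lambda>i. ?s1 * fst (snd w') i)"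
          let ?mB = "mcost p {a<..<n} (\<lambda>i. ?s2 * snd (snd w) i) (\<lambda>i. ?s2 * snd (snd w') i)"
          have nn: "0 \<le> ?mA" "0 \<le> ?mB" by (auto intro: mcost_nonneg)
          have "f (V w) (V w') \<le> ennreal ((1 - \<theta>) powr (1 - p) * (?mA + ?mB) + \<theta> powr (1 - p) * (2 powr (p - 1) * (real n * norm s powr p * (\<bar>fst w $ k - \<tau>\<bar> powr p + \<bar>fst w' $ k - \<tau>\<bar> powr p)) + norm s powr p))"
            unfolding f_def V_def using gw elim by (intro ennreal_leI mcost_cut_pts[OF p a th]) auto
          also have "(1 - \<theta>) powr (1 - p) * (?mA + ?mB) + \<theta> powr (1 - p) * (2 powr (p - 1) * (real n * norm s powr p * (\<bar>fst w $ k - \<tau>\<bar> powr p + \<bar>fst w' $ k - \<tau>\<bar> powr p)) + norm s powr p)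
            = (1 - \<theta>) powr (1 - p) * (?mA + ?mB) + (\<theta> powr (1 - p) * (2 powr (p - 1) * (real n * norm s powr p)) * \<bar>fst w $ k - \<tau>\<bar> powr p
              + (\<theta> powr (1 - p) * (2 powr (p - 1) * (real n * norm s powr p)) * \<bar>fst w' $ k - \<tau>\<bar> powr p + \<theta> powr (1 - p) * norm s powr p))"
            by (simp add: algebra_simps)
          also have "ennreal \<dots> = c1 * (mA (fst (snd w)) (fst (snd w')) + mB (snd (snd w)) (snd (snd w'))) + (c2 * h (fst w) + (c2 * h (fst w') + c3))"
            unfolding c1_def c2_def c3_def mA_def mB_def h_def using nn by (simp add: ennreal_mult)
          finally show ?case .
        qed
      qed
      also have "\<dots> = c1 * ((\<integral>\<^sup>+ w'. mA (fst (snd w)) (fst (snd w')) \<partial>Q) + (\<integral>\<^sup>+ w'. mB (snd (snd w)) (snd (snd w')) \<partial>Q)) + (c2 * h (fst w) + (c2 * (\<integral>\<^sup>+ w'. h (fst w') \<partial>Q) + c3))"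
      proof -
        have [measurable]: "(\<lambda>w'. mA (fst (snd w)) (fst (snd w'))) \<in> borel_measurable Q" "(\<lambda>w'. mB (snd (snd w)) (snd (snd w'))) \<in> borel_measurable Q"
          "(\<lambda>w'. h (fst w')) \<in> borel_measurable Q"
          using measurable_compose[OF pj(2) mAx[OF wA]] measurable_compose[OF pj(3) mBx[OF wB]] measurable_compose[OF pj(1) hm] by auto
        show ?thesis by (simp add: nn_integral_add nn_integral_cmult Q.emeasure_space_1)
      qed
      finally show ?thesis by (simp only: margA[OF mAx[OF wA]] margB[OF mBx[OF wB]] marg[OF hm] Eh_def)
    qed
    have mAI: "(\<lambda>u. \<integral>\<^sup>+ u'. mA u u' \<partial>?A) \<in> borel_measurable ?A"
      using mA2 by (intro A.borel_measurable_nn_integral) (simp add: case_prod_beta')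
    have mBI: "(\<lambda>u. \<integral>\<^sup>+ u'. mB u u' \<partial>?B) \<in> borel_measurable ?B"
      using mB2 by (intro B.borel_measurable_nn_integral) (simp add: case_prod_beta')
    have "Gcost p {..<n} s \<le> (\<integral>\<^sup>+ w. c1 * ((\<integral>\<^sup>+ u. mA (fst (snd w)) u \<partial>?A) + (\<integral>\<^sup>+ v. mB (snd (snd w)) v \<partial>?B)) + (c2 * h (fst w) + (c2 * Eh + c3)) \<partial>Q)"
      unfolding G
    proof (rule nn_integral_mono_AE)
      show "AE w in Q. (\<integral>\<^sup>+ w'. f (V w) (V w') \<partial>Q) \<le>
        c1 * ((\<integral>\<^sup>+ u. mA (fst (snd w)) u \<partial>?A) + (\<integral>\<^sup>+ v. mB (snd (snd w)) v \<partial>?B)) + (c2 * h (fst w) + (c2 * Eh + c3))"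
        using AE_space good
      proof eventually_elim
        case (elim w)
        then show ?case by (rule inner)
      qed
    qed
    also have "\<dots> = c1 * ((\<integral>\<^sup>+ w. (\<integral>\<^sup>+ u. mA (fst (snd w)) u \<partial>?A) \<partial>Q) + (\<integral>\<^sup>+ w. (\<integral>\<^sup>+ v. mB (snd (snd w)) v \<partial>?B) \<partial>Q)) + (c2 * (\<integral>\<^sup>+ w. h (fst w) \<partial>Q) + (c2 * Eh + c3))"
    proof -
      have [measurable]: "(\<lambda>w. \<integral>\<^sup>+ u. mA (fst (snd w)) u \<partial>?A) \<in> borel_measurable Q" "(\<lambda>w. \<integral>\<^sup>+ v. mB (snd (snd w)) v \<partial>?B) \<in> borel_measurable Q"
        "(\<lambda>w'. h (fst w')) \<in> borel_measurable Q"
        using measurable_compose[OF pj(2) mAI] measurable_compose[OF pj(3) mBI] measurable_compose[OF pj(1) hm] by auto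
      show ?thesis by (simp add: nn_integral_add nn_integral_cmult Q.emeasure_space_1)
    qed
    also have "\<dots> = c1 * (Gcost p {..<a} ?s1 + Gcost p {a<..<n} ?s2) + (c2 * Eh + (c2 * Eh + c3))"
      by (simp only: margA[OF mAI] margB[OF mBI] marg[OF hm] Eh_def[symmetric]) (simp add: Gcost_def mA_def mB_def)
    also have "Gcost p {a<..<n} ?s2 = Gcost p {..<b} ?s2"
      using Gcost_card[OF finite_greaterThanLessThan p, of a n ?s2] by (simp add: b_def)
    also have "c1 * (Gcost p {..<a} ?s1 + Gcost p {..<b} ?s2) + (c2 * Eh + (c2 * Eh + c3))
      \<le> c1 * (Gcost p {..<a} ?s1 + Gcost p {..<b} ?s2) + ennreal (\<theta> powr (1 - p) * (norm s powr p * (C * (real n * (real n + 1) powr (-p/2)) + 1)))"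
    proof (intro add_left_mono)
      have "Eh \<le> ennreal (C0 * (real n + 1) powr (-p/2))"
        using C0(2)[OF c, unfolded nb] unfolding Eh_def h_def \<tau>_def .
      then have "c2 * Eh + (c2 * Eh + c3) \<le> c2 * ennreal (C0 * (real n + 1) powr (-p/2)) + (c2 * ennreal (C0 * (real n + 1) powr (-p/2)) + c3)"
        by (intro add_mono mult_left_mono) auto
      also have "\<dots> = ennreal (\<theta> powr (1 - p) * (norm s powr p * (C * (real n * (real n + 1) powr (-p/2)) + 1)))"
        unfolding c2_def c3_def C_def using C0(1)
        by (simp add: ennreal_mult[symmetric] ennreal_plus[symmetric] del: ennreal_plus) (simp add: algebra_simps)
      finally show "c2 * Eh + (c2 * Eh + c3) \<le> \<dots>" .
    qed
    finally show ?thesis unfolding c1_def b_def \<tau>_def .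
  qed
  then show ?thesis using C0(1) by (intro exI[of _ C]) (auto simp: C_def)
qed

section \<open>Limits of almost scale-invariant subadditive sequences\<close>

lemma powr_root_add_le:
  fixes x y p :: real
  assumes "0 \<le> x" "0 \<le> y" "1 \<le> p"
  shows "(x + y) powr (1/p) \<le> x powr (1/p) + y powr (1/p)"
proof (rule minkowski_from_convex)
  fix \<theta> :: real assume "0 < \<theta>" "\<theta> < 1"
  then have "1 \<le> (1 - \<theta>) powr (1 - p)" "1 \<le> \<theta> powr (1 - p)"
    using powr_mono'[of "1 - p" 0 \<theta>] powr_mono'[of "1 - p" 0 "1 - \<theta>"] assms by auto
  then show "x + y \<le> (1 - \<theta>) powr (1 - p) * x + \<theta> powr (1 - p) * y"
    using assms by (intro add_mono) (simp_all add: mult_le_cancel_right1)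
qed (use assms in auto)

text \<open>Every late value bounds all much later ones from above, up to \<open>e\<close>. Along a
  subsequence with limit \<open>l\<close> this gives \<open>l\<close> as an asymptotic upper bound;
  and as the subsequence enters every tail, each late value is in turn at least \<open>l\<close> up
  to \<open>e\<close>.\<close>

lemma convergent_of_asymptotic_decrease:
  fixes a :: "nat \<Rightarrow> real"
  assumes bd: "\<And>n. \<bar>a n\<bar> \<le> B"
    and dec: "\<And>e. 0 < e \<Longrightarrow> \<exists>M. \<forall>N\<ge>M. \<exists>N1. \<forall>N'\<ge>N1. a N' \<le> a N + e"
  shows "convergent a"
proof -
  have "bounded (range a)" using bd by (auto simp: bounded_iff)
  then obtain l r where r: "strict_mono (r :: nat \<Rightarrow> nat)" and l: "(a \<circ> r) \<longlonglongrightarrow> l"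
    using bounded_imp_convergent_subsequence by blast
  have "a \<longlonglongrightarrow> l"
  proof (rule LIMSEQ_I)
    fix e :: real assume e: "0 < e"
    obtain M where M: "\<And>N. N \<ge> M \<Longrightarrow> \<exists>N1. \<forall>N'\<ge>N1. a N' \<le> a N + e / 4" using dec[of "e / 4"] e by auto
    obtain j0 where j0: "\<And>j. j \<ge> j0 \<Longrightarrow> \<bar>a (r j) - l\<bar> < e / 4"
      using LIMSEQ_D[OF l, of "e / 4"] e by auto
    have rj: "j \<le> r j" for j using seq_suble[OF r] .
    let ?N = "r (max j0 M)"
    have "?N \<ge> M" using rj[of "max j0 M"] by simp
    then obtain N1 where N1: "\<And>N'. N' \<ge> N1 \<Longrightarrow> a N' \<le> a ?N + e / 4" using M by blast
    have up: "a N' \<le> l + e / 2" if "N' \<ge> N1" for N'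
      using N1[OF that] j0[of "max j0 M", OF max.cobounded1] by linarith
    have low: "l \<le> a N + e / 2" if N: "N \<ge> M" for N
    proof -
      obtain N2 where N2: "\<And>N'. N' \<ge> N2 \<Longrightarrow> a N' \<le> a N + e / 4" using M[OF N] by blast
      have "a (r (max j0 N2)) \<le> a N + e / 4" using N2 rj[of "max j0 N2"] by simp
      then show ?thesis using j0[of "max j0 N2", OF max.cobounded1] by linarith
    qed
    show "\<exists>no. \<forall>n\<ge>no. norm (a n - l) < e"
    proof (intro exI allI impI)
      fix n assume "max M N1 \<le> n"
      then have "a n \<le> l + e / 2" "l \<le> a n + e / 2" using up[of n] low[of n] by auto
      then show "norm (a n - l) < e" using e unfolding real_norm_def by linarith
    qed
  qed
  then show ?thesis by (rule convergentI)
qed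

context
  fixes g :: "nat \<Rightarrow> real" and d :: nat and p \<beta> :: real
  assumes nonneg: "\<And>n. 0 \<le> g n" and g0: "g 0 = 0"
    and sub: "\<And>a b. g (a + b) \<le> g a + g b"
    and d: "0 < d" and p: "1 \<le> p" "p < real d" and \<beta>: "0 \<le> \<beta>" "\<beta> < 1/p - 1/real d"
    and rec: "\<And>K. 1 \<le> K \<Longrightarrow> \<exists>C\<ge>0. \<forall>N\<ge>1. g (K ^ d * N - 1) powr (1/p) \<le>
      real K powr (real d / p - 1) * g (N - 1) powr (1/p) + C * real (K ^ d * N) powr \<beta>"
begin

text \<open>\<open>\<kappa>\<close> is the growth exponent of the root of the cost and
  \<open>\<gamma>\<close> that of the cost; \<open>\<delta>\<close> is the margin left by the error
  exponent \<open>\<beta>\<close>. As in \<open>rec\<close>, the argument of \<open>\<phi>\<close>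
  is the number of points plus one.\<close>

private definition "\<gamma> = 1 - p / real d"
private definition "\<kappa> = 1/p - 1/real d"
private definition "\<delta> = \<kappa> - \<beta>"
private definition "\<phi> (N::nat) = g (N - 1) powr (1/p) / real N powr \<kappa>"

private lemma exponent_facts: "0 < \<gamma>" "0 < \<kappa>" "0 < \<delta>" "\<gamma> = p * \<kappa>" "\<gamma> / p = \<kappa>"
  using p d \<beta> by (auto simp: \<gamma>_def \<kappa>_def \<delta>_def field_simps)

private lemma phi_nonneg: "0 \<le> \<phi> N" by (simp add: \<phi>_def)

private lemma pow_kappa: "1 \<le> K \<Longrightarrow> real (K ^ d * N) powr \<kappa> = real K powr (real d / p - 1) * real N powr \<kappa>"
proof -
  assume K: "1 \<le> K"
  have "real (K ^ d * N) powr \<kappa> = (real K powr real d) powr \<kappa> * real N powr \<kappa>"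
    using K by (simp add: powr_mult powr_realpow)
  also have "(real K powr real d) powr \<kappa> = real K powr (real d / p - 1)"
    using d p by (simp add: powr_powr \<kappa>_def right_diff_distrib)
  finally show ?thesis .
qed

text \<open>\<open>K powr (d / p - 1)\<close> equals \<open>(K ^ d) powr \<kappa>\<close>, so
  dividing \<open>rec\<close> by \<open>(K ^ d * N) powr \<kappa>\<close> leaves
  \<open>\<phi> N\<close> with coefficient exactly 1, and an error that decays since
  \<open>0 < \<delta>\<close>.\<close>

private lemma phi_rec:
  assumes "1 \<le> K"
  shows "\<exists>C\<ge>0. \<forall>N\<ge>1. \<phi> (K ^ d * N) \<le> \<phi> N + C * real (K ^ d * N) powr (-\<delta>)"
proof -
  obtain C where C: "0 \<le> C" "\<And>N. 1 \<le> N \<Longrightarrow> g (K ^ d * N - 1) powr (1/p) \<le>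
      real K powr (real d / p - 1) * g (N - 1) powr (1/p) + C * real (K ^ d * N) powr \<beta>"
    using rec[OF assms] by auto
  have "\<phi> (K ^ d * N) \<le> \<phi> N + C * real (K ^ d * N) powr (-\<delta>)" if N: "1 \<le> N" for N
  proof -
    let ?M = "real (K ^ d * N)"
    have M: "0 < ?M powr \<kappa>" using N assms by simp
    have "\<phi> (K ^ d * N) \<le> (real K powr (real d / p - 1) * g (N - 1) powr (1/p) + C * ?M powr \<beta>) / ?M powr \<kappa>"
      unfolding \<phi>_def using C(2)[OF N] M by (intro divide_right_mono) auto
    also have "\<dots> = real K powr (real d / p - 1) * g (N - 1) powr (1/p) / ?M powr \<kappa> + C * (?M powr \<beta> / ?M powr \<kappa>)"
      by (simp add: add_divide_distrib)
    also have "real K powr (real d / p - 1) * g (N - 1) powr (1/p) / ?M powr \<kappa> = \<phi> N"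
      using assms unfolding pow_kappa[OF assms] \<phi>_def by simp
    also have "?M powr \<beta> / ?M powr \<kappa> = ?M powr (-\<delta>)"
      by (simp add: powr_diff[symmetric] \<delta>_def)
    finally show ?thesis .
  qed
  then show ?thesis using C(1) by blast
qed

text \<open>Iterating the case \<open>K = 2\<close> multiplies the index by \<open>2 ^ d\<close>
  each time, so the errors form a geometric series and their sum is bounded independently of the
  number \<open>k\<close> of steps.\<close>

private lemma phi_dyadic:
  "\<exists>C\<ge>0. \<forall>k. \<forall>N\<ge>1. \<phi> (2 ^ (d * k) * N) \<le> \<phi> N + C * real N powr (-\<delta>)"
proof -
  obtain C where C: "0 \<le> C" "\<And>N. 1 \<le> N \<Longrightarrow> \<phi> (2 ^ d * N) \<le> \<phi> N + C * real (2 ^ d * N) powr (-\<delta>)"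
    using phi_rec[of 2] by auto
  define q where "q = (2::real) powr (- real d * \<delta>)"
  have q: "0 < q" "q < 1" using d exponent_facts powr_less_one[of 2 "- real d * \<delta>"] by (auto simp: q_def)
  have qi: "real (2 ^ (d * i) * N) powr (-\<delta>) = q ^ i * real N powr (-\<delta>)" for i N
  proof -
    have "real (2 ^ (d * i) * N) powr (-\<delta>) = ((2::real) powr (real d * real i)) powr (-\<delta>) * real N powr (-\<delta>)"
      by (simp add: powr_mult powr_realpow[symmetric])
    also have "((2::real) powr (real d * real i)) powr (-\<delta>) = q powr real i"
      by (simp add: powr_powr q_def mult_ac)
    finally show ?thesis using q by (simp add: powr_realpow)
  qed
  have "\<phi> (2 ^ (d * k) * N) \<le> \<phi> N + C * real N powr (-\<delta>) * (\<Sum>i<k. q ^ Suc i)" if N: "1 \<le> N" for k N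
  proof (induction k)
    case (Suc k)
    have "\<phi> (2 ^ (d * Suc k) * N) = \<phi> (2 ^ d * (2 ^ (d * k) * N))" by (simp add: power_add mult_ac)
    also have "\<dots> \<le> \<phi> (2 ^ (d * k) * N) + C * real (2 ^ d * (2 ^ (d * k) * N)) powr (-\<delta>)"
      using N by (intro C(2)) simp
    also have "2 ^ d * (2 ^ (d * k) * N) = 2 ^ (d * Suc k) * N" by (simp add: power_add mult_ac)
    also have "real (2 ^ (d * Suc k) * N) powr (-\<delta>) = q ^ Suc k * real N powr (-\<delta>)" by (rule qi)
    finally show ?case using Suc.IH by (simp add: algebra_simps)
  qed simp
  moreover have "(\<Sum>i<k. q ^ Suc i) \<le> 1 / (1 - q)" for k
  proof -
    have "(\<Sum>i<k. q ^ Suc i) \<le> (\<Sum>i<k. q ^ i)" using q by (intro sum_mono) (simp add: mult_le_cancel_right2)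
    also have "\<dots> \<le> (\<Sum>i. q ^ i)" using q by (intro sum_le_suminf summable_geometric) auto
    also have "\<dots> = 1 / (1 - q)" using q by (intro suminf_geometric) auto
    finally show ?thesis .
  qed
  ultimately have "\<phi> (2 ^ (d * k) * N) \<le> \<phi> N + C / (1 - q) * real N powr (-\<delta>)" if "1 \<le> N" for k N
  proof -
    have "C * real N powr (-\<delta>) * (\<Sum>i<k. q ^ Suc i) \<le> C * real N powr (-\<delta>) * (1 / (1 - q))"
      using C(1) \<open>\<And>k. (\<Sum>i<k. q ^ Suc i) \<le> 1 / (1 - q)\<close> by (intro mult_left_mono) auto
    then show ?thesis using \<open>\<And>k N. 1 \<le> N \<Longrightarrow> \<phi> (2 ^ (d * k) * N) \<le> \<phi> N + C * real N powr (-\<delta>) * (\<Sum>i<k. q ^ Suc i)\<close>[OF that, of k]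
      by (simp add: mult_ac)
  qed
  then show ?thesis using C(1) q by (intro exI[of _ "C / (1 - q)"]) auto
qed

private lemma g_eq: "1 \<le> N \<Longrightarrow> g (N - 1) = (\<phi> N * real N powr \<kappa>) powr p"
  using p nonneg[of "N - 1"] by (simp add: \<phi>_def powr_powr)

text \<open>Subadditivity along the expansion of \<open>r\<close> in base \<open>2 ^ d\<close>: at
  every scale fewer than \<open>2 ^ d\<close> blocks occur, each controlled by the bound on
  \<open>\<phi>\<close> at powers of \<open>2 ^ d\<close>. As \<open>0 < \<gamma>\<close>, the
  contributions grow geometrically with the scale and the largest one dominates.\<close>

private lemma g_dyadic_bound: "\<exists>D\<ge>0. \<forall>k r. r < 2 ^ (d * k) \<longrightarrow> g r \<le> D * real (2 ^ (d * k)) powr \<gamma>"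
proof -
  obtain C where C: "0 \<le> C" "\<And>k N. 1 \<le> N \<Longrightarrow> \<phi> (2 ^ (d * k) * N) \<le> \<phi> N + C * real N powr (-\<delta>)"
    using phi_dyadic by auto
  define B where "B = \<phi> 1 + C"
  have B: "\<phi> (2 ^ (d * k)) \<le> B" for k using C(2)[of 1 k] by (simp add: B_def)
  have B0: "0 \<le> B" using C(1) phi_nonneg by (simp add: B_def)
  have gd: "g (2 ^ (d * k) - 1) \<le> B powr p * real (2 ^ (d * k)) powr \<gamma>" for k
  proof -
    have "g (2 ^ (d * k) - 1) = (\<phi> (2 ^ (d * k)) * real (2 ^ (d * k)) powr \<kappa>) powr p" by (rule g_eq) simp
    also have "\<dots> \<le> (B * real (2 ^ (d * k)) powr \<kappa>) powr p"
      using B phi_nonneg p by (intro powr_mono2 mult_right_mono) auto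
    also have "\<dots> = B powr p * real (2 ^ (d * k)) powr \<gamma>"
      using B0 exponent_facts by (simp add: powr_mult powr_powr mult.commute)
    finally show ?thesis .
  qed
  have mul: "g (q * n) \<le> real q * g n" for q n
  proof (induction q)
    case (Suc q)
    then show ?case using sub[of n "q * n"] by (simp add: algebra_simps)
  qed (simp add: g0)
  define X where "X = (2::real) powr (real d * \<gamma>)"
  have X: "1 < X" using d exponent_facts by (simp add: X_def)
  \<comment> \<open>\<open>D\<close> solves \<open>2 ^ d * (B powr p + g 1) + D = D * X\<close>,
    which closes the induction over the scales.\<close>
  define D where "D = 2 ^ d * (B powr p + g 1) / (X - 1)"
  have D0: "0 \<le> D" using X nonneg by (auto simp: D_def)
  have D1: "2 ^ d * (B powr p + g 1) + D = D * X" using X by (simp add: D_def field_simps)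
  have "g r \<le> D * real (2 ^ (d * k)) powr \<gamma>" if "r < 2 ^ (d * k)" for k r
    using that
  proof (induction k arbitrary: r)
    case 0
    then show ?case using D0 by (simp add: g0)
  next
    case (Suc k)
    define n where "n = (2::nat) ^ (d * k)"
    have n: "1 \<le> n" by (simp add: n_def)
    define q where "q = r div n"
    have "r < 2 ^ d * n" using Suc.prems by (simp add: n_def power_add)
    then have q: "q < 2 ^ d" using n by (simp add: q_def less_mult_imp_div_less)
    \<comment> \<open>The bound \<open>gd\<close> concerns \<open>n - 1\<close> points instead of
      \<open>n\<close>; the \<open>q\<close> missing points are added singly, at cost
      \<open>g 1\<close> each.\<close>
    have "q * (n - 1) + q = q * n" using n by (cases n) auto
    then have r: "r = q * (n - 1) + (q * 1 + r mod n)" unfolding q_def by (metis add.assoc div_mult_mod_eq mult.right_neutral)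
    have rm: "r mod n < n" using n by simp
    have "g r = g (q * (n - 1) + (q * 1 + r mod n))" using r by (rule arg_cong)
    then have "g r \<le> g (q * (n - 1)) + (g (q * 1) + g (r mod n))"
      using sub[of "q * (n - 1)" "q * 1 + r mod n"] sub[of "q * 1" "r mod n"] by linarith
    also have "g (q * (n - 1)) \<le> real q * (B powr p * real n powr \<gamma>)"
      using mul[of q "n - 1"] gd[of k] unfolding n_def[symmetric] by (meson mult_left_mono of_nat_0_le_iff order_trans)
    also have "g (q * 1) \<le> real q * (g 1 * real n powr \<gamma>)"
    proof -
      have "1 \<le> real n powr \<gamma>" using n exponent_facts by (intro ge_one_powr_ge_zero) auto
      then have "g 1 * 1 \<le> g 1 * real n powr \<gamma>" using nonneg by (intro mult_left_mono) auto
      then have "real q * g 1 \<le> real q * (g 1 * real n powr \<gamma>)" by (intro mult_left_mono) auto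
      then show ?thesis using mul[of q 1] by linarith
    qed
    also have "g (r mod n) \<le> D * real n powr \<gamma>" using Suc.IH[of "r mod n"] rm by (simp add: n_def)
    also have "real q * (B powr p * real n powr \<gamma>) + (real q * (g 1 * real n powr \<gamma>) + D * real n powr \<gamma>)
      = (real q * (B powr p + g 1) + D) * real n powr \<gamma>" by (simp add: algebra_simps)
    also have "\<dots> \<le> (2 ^ d * (B powr p + g 1) + D) * real n powr \<gamma>"
    proof (intro mult_right_mono add_right_mono)
      have "real q < 2 ^ d" using q by (metis of_nat_less_iff of_nat_numeral of_nat_power)
      then show "real q \<le> 2 ^ d" by simp
    qed (use nonneg in auto)
    also have "\<dots> = D * (X * real n powr \<gamma>)" by (simp only: D1 mult.assoc)
    also have "X * real n powr \<gamma> = real (2 ^ (d * Suc k)) powr \<gamma>"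
      by (simp add: X_def n_def power_add powr_mult powr_powr[symmetric] powr_realpow)
    finally show ?case by simp
  qed
  then show ?thesis using D0 by blast
qed

text \<open>Rounding \<open>r\<close> up to a power of \<open>2 ^ d\<close> changes the bound at
  most by the factor \<open>X\<close>.\<close>

private lemma g_bound: "\<exists>D\<ge>0. \<forall>r. g r \<le> D * real r powr \<gamma>"
proof -
  obtain D where D: "0 \<le> D" "\<And>k r. r < 2 ^ (d * k) \<Longrightarrow> g r \<le> D * real (2 ^ (d * k)) powr \<gamma>"
    using g_dyadic_bound by auto
  define X where "X = (2::real) powr (real d * \<gamma>)"
  have "g r \<le> (D * X) * real r powr \<gamma>" for r
  proof (cases "r = 0")
    case False
    define P where "P k \<longleftrightarrow> r < 2 ^ (d * k)" for k
    have "P r"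
    proof -
      have "r < 2 ^ r" by (rule less_exp)
      also have "\<dots> \<le> 2 ^ (d * r)" using d by (intro power_increasing) auto
      finally show ?thesis by (simp add: P_def)
    qed
    define k where "k = (LEAST k. P k)"
    have Pk: "P k" unfolding k_def using \<open>P r\<close> by (rule LeastI)
    have "k \<noteq> 0" by (rule notI) (use Pk False in \<open>simp add: P_def\<close>)
    then obtain j where j: "k = Suc j" using not0_implies_Suc by blast
    have "\<not> P j" using not_less_Least[of j P] j k_def by auto
    then have rj: "2 ^ (d * j) \<le> r" by (simp add: P_def)
    have "g r \<le> D * real (2 ^ (d * k)) powr \<gamma>" using D(2) Pk by (simp add: P_def)
    also have "real (2 ^ (d * k)) powr \<gamma> = X * real (2 ^ (d * j)) powr \<gamma>"
      by (simp add: j X_def power_add powr_mult powr_powr[symmetric] powr_realpow)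
    also have "D * (X * real (2 ^ (d * j)) powr \<gamma>) \<le> D * (X * real r powr \<gamma>)"
    proof (intro mult_left_mono powr_mono2)
      show "real (2 ^ (d * j)) \<le> real r" using rj by (simp only: of_nat_le_iff)
    qed (use D(1) exponent_facts in \<open>auto simp: X_def\<close>)
    finally show ?thesis by simp
  qed (simp add: g0)
  then show ?thesis using D(1) by (intro exI[of _ "D * X"]) (auto simp: X_def)
qed

private lemma phi_bounded: "\<exists>B. \<forall>N. \<bar>\<phi> N\<bar> \<le> B"
proof -
  obtain D where D: "0 \<le> D" "\<And>r. g r \<le> D * real r powr \<gamma>" using g_bound by auto
  have "\<bar>\<phi> N\<bar> \<le> D powr (1/p)" for N
  proof (cases "N = 0")
    case False
    have "g (N - 1) \<le> D * real N powr \<gamma>"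
      by (rule order_trans[OF D(2)]) (use D(1) exponent_facts in \<open>auto intro!: mult_left_mono powr_mono2\<close>)
    then have "g (N - 1) powr (1/p) \<le> (D * real N powr \<gamma>) powr (1/p)" using nonneg p by (intro powr_mono2) auto
    also have "\<dots> = D powr (1/p) * real N powr \<kappa>" using D(1) exponent_facts by (simp add: powr_mult powr_powr)
    finally show ?thesis using False by (simp add: \<phi>_def divide_le_eq)
  qed (simp add: \<phi>_def)
  then show ?thesis by blast
qed

text \<open>The indices \<open>2 ^ (d * k) * N\<close> alone leave gaps by a factor
  \<open>2 ^ d\<close>. So \<open>N'\<close> is approximated from below by
  \<open>K ^ d * 2 ^ (d * k) * N\<close> with \<open>K0 \<le> K \<le> 2 * K0\<close>: the relative
  gap is small when \<open>K0\<close> is large, and only finitely many error constants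
  \<open>CK K\<close> occur. The points in the gap are charged by subadditivity. Each of the three
  errors, from the dyadic steps, the factor \<open>K\<close> and the gap, is at most
  \<open>e / 3\<close>.\<close>

private lemma phi_decrease:
  assumes e: "0 < e"
  shows "\<exists>M. \<forall>N\<ge>M. \<exists>N1. \<forall>N'\<ge>N1. \<phi> N' \<le> \<phi> N + e"
proof -
  have powr_tendsto: "(\<lambda>n. C * real n powr (-\<delta>)) \<longlonglongrightarrow> 0" for C :: real
    using tendsto_mult_right_zero[OF tendsto_neg_powr[of "-\<delta>" real sequentially]] exponent_facts filterlim_real_sequentially by auto
  obtain C where C: "0 \<le> C" "\<And>k N. 1 \<le> N \<Longrightarrow> \<phi> (2 ^ (d * k) * N) \<le> \<phi> N + C * real N powr (-\<delta>)"
    using phi_dyadic by auto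
  obtain D where D: "0 \<le> D" "\<And>r. g r \<le> D * real r powr \<gamma>" using g_bound by auto
  obtain M where M: "\<And>N. N \<ge> M \<Longrightarrow> \<bar>C * real N powr (-\<delta>)\<bar> < e / 3"
    using LIMSEQ_D[OF powr_tendsto[of C], of "e/3"] e by auto
  have "(\<lambda>K. (D * ((1 + 1 / real K) ^ d - 1) powr \<gamma>) powr (1/p)) \<longlonglongrightarrow> (D * ((1 + 0) ^ d - 1) powr \<gamma>) powr (1/p)"
    using exponent_facts p D(1)
    by (intro tendsto_powr' tendsto_intros lim_1_over_n) (auto intro!: always_eventually)
  then have "(\<lambda>K. (D * ((1 + 1 / real K) ^ d - 1) powr \<gamma>) powr (1/p)) \<longlonglongrightarrow> 0" by simp
  then obtain K1 where K1: "\<And>K. K \<ge> K1 \<Longrightarrow> \<bar>(D * ((1 + 1 / real K) ^ d - 1) powr \<gamma>) powr (1/p)\<bar> < e / 3"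
    using LIMSEQ_D[of _ 0 "e/3"] e by fastforce
  \<comment> \<open>For \<open>K \<ge> K0\<close> the relative gap between \<open>K ^ d\<close> and
    \<open>(K + 1) ^ d\<close> is at most \<open>\<eta>\<close>, and \<open>K0\<close> is large
    enough for the points in such a gap to contribute at most \<open>e / 3\<close>.\<close>
  define K0 where "K0 = max 1 K1"
  define \<eta> where "\<eta> = (1 + 1 / real K0) ^ d - 1"
  have K0: "1 \<le> K0" "(D * \<eta> powr \<gamma>) powr (1/p) \<le> e / 3" using K1[of K0] by (auto simp: K0_def \<eta>_def)
  have \<eta>0: "0 \<le> \<eta>" by (simp add: \<eta>_def)
  obtain CK where CK: "\<And>K. 1 \<le> K \<Longrightarrow> 0 \<le> CK K"
    "\<And>K N. 1 \<le> K \<Longrightarrow> 1 \<le> N \<Longrightarrow> \<phi> (K ^ d * N) \<le> \<phi> N + CK K * real (K ^ d * N) powr (-\<delta>)"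
    using phi_rec by metis
  \<comment> \<open>A common bound for the error constants of the finitely many factors that will be
    used; it is available before \<open>N'\<close> is chosen.\<close>
  define Cs where "Cs = (\<Sum>K\<in>{K0..2*K0}. CK K)"
  have Cs: "CK K \<le> Cs" if "K0 \<le> K" "K \<le> 2 * K0" for K
    unfolding Cs_def using that CK(1) K0(1) by (intro member_le_sum) auto
  obtain M2 where M2: "\<And>N. N \<ge> M2 \<Longrightarrow> \<bar>Cs * real N powr (-\<delta>)\<bar> < e / 3"
    using LIMSEQ_D[OF powr_tendsto[of Cs], of "e/3"] e by auto
  have "\<exists>N1. \<forall>N'\<ge>N1. \<phi> N' \<le> \<phi> N + e" if N: "N \<ge> max 1 M" for N
  proof (intro exI allI impI)
    \<comment> \<open>The threshold forces \<open>M2 \<le> k\<close> below, so that the intermediate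
      index \<open>m\<close> exceeds \<open>M2\<close>, where the error of the step by
      \<open>K\<close> is small.\<close>
    fix N' assume N': "K0 ^ d * 2 ^ (d * M2) * N \<le> N'"
    define P where "P k \<longleftrightarrow> N' < K0 ^ d * 2 ^ (d * k) * N" for k
    have "P N'"
    proof -
      have "N' < 2 ^ N'" by (rule less_exp)
      also have "\<dots> \<le> 2 ^ (d * N')" using d by (intro power_increasing) auto
      also have "\<dots> \<le> K0 ^ d * 2 ^ (d * N') * N" using K0 N by simp
      finally show ?thesis by (simp add: P_def)
    qed
    define k' where "k' = (LEAST k. P k)"
    have Pk: "P k'" unfolding k'_def using \<open>P N'\<close> by (rule LeastI)
    have "\<not> P k" if "k \<le> M2" for k
    proof -
      have "K0 ^ d * 2 ^ (d * k) * N \<le> K0 ^ d * 2 ^ (d * M2) * N"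
        using that d by (intro mult_right_mono mult_left_mono power_increasing) auto
      then have "K0 ^ d * 2 ^ (d * k) * N \<le> N'" using N' by (rule le_trans)
      then show ?thesis by (simp only: P_def not_less)
    qed
    then have "M2 < k'" using Pk not_le by blast
    then obtain k where k: "k' = Suc k" "M2 \<le> k" by (cases k') auto
    have "\<not> P k" using not_less_Least[of k P] k k'_def by auto
    define m where "m = 2 ^ (d * k) * N"
    have m1: "1 \<le> m" using N by (simp add: m_def)
    have mM: "M2 \<le> m"
    proof -
      have "M2 \<le> k" by (rule k)
      also have "k \<le> 2 ^ k" using less_exp[of k] by simp
      also have "\<dots> \<le> 2 ^ (d * k)" using d by (intro power_increasing) auto
      also have "\<dots> \<le> m" using N by (simp add: m_def)
      finally show ?thesis .
    qed
    have lo: "K0 ^ d * m \<le> N'" using \<open>\<not> P k\<close> by (simp add: P_def m_def mult.assoc)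
    have hi: "N' < (2 * K0) ^ d * m"
      using Pk by (simp add: P_def m_def k power_add power_mult_distrib mult_ac)
    define R where "R K \<longleftrightarrow> N' < K ^ d * m" for K
    define K' where "K' = (LEAST K. R K)"
    have RK: "R K'" unfolding K'_def using hi by (intro LeastI[of R "2 * K0"]) (simp add: R_def)
    have K'le: "K' \<le> 2 * K0" unfolding K'_def using hi by (intro Least_le) (simp add: R_def)
    have "\<not> R K" if "K \<le> K0" for K
    proof -
      have "K ^ d * m \<le> K0 ^ d * m" using that by (intro mult_right_mono power_mono) auto
      then have "K ^ d * m \<le> N'" using lo by (rule le_trans)
      then show ?thesis by (simp only: R_def not_less)
    qed
    then have "K0 < K'" using RK not_le by blast
    then obtain K where K: "K' = Suc K" "K0 \<le> K" by (cases K') auto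
    have "\<not> R K" using not_less_Least[of K R] K K'_def by auto
    define N2 where "N2 = K ^ d * m"
    have N2: "N2 \<le> N'" "N' < (K + 1) ^ d * m" "1 \<le> N2"
      using \<open>\<not> R K\<close> RK K K0 m1 by (auto simp: R_def N2_def)
    have diff: "real (N' - N2) \<le> real N' * \<eta>"
    proof -
      have "real N' \<le> (real K + 1) ^ d * real m" using N2(2) by (metis less_imp_le of_nat_1 of_nat_add of_nat_le_iff of_nat_mult of_nat_power)
      also have "(real K + 1) ^ d = real K ^ d * (1 + 1 / real K) ^ d"
        using K K0 by (simp add: power_mult_distrib[symmetric] field_simps)
      also have "\<dots> * real m = real N2 * (1 + 1 / real K) ^ d" by (simp add: N2_def)
      also have "\<dots> \<le> real N2 * (1 + 1 / real K0) ^ d"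
        using K K0 by (intro mult_left_mono power_mono add_left_mono divide_left_mono) auto
      finally have "real N' - real N2 \<le> real N2 * \<eta>" by (simp add: \<eta>_def algebra_simps)
      also have "\<dots> \<le> real N' * \<eta>" using N2(1) \<eta>0 by (intro mult_right_mono) auto
      finally show ?thesis using N2(1) by (simp add: of_nat_diff)
    qed
    \<comment> \<open>The \<open>N' - N2\<close> points in the gap form at most a fraction
      \<open>\<eta>\<close> of all; \<open>g_bound\<close> gives them a cost of the right order
      \<open>N' powr \<gamma>\<close>, with a small factor.\<close>
    have "g (N' - 1) \<le> g (N2 - 1) + g (N' - N2)" using sub[of "N2 - 1" "N' - N2"] N2 by simp
    also have "g (N' - N2) \<le> D * (real N' * \<eta>) powr \<gamma>"
      by (rule order_trans[OF D(2)]) (use D(1) exponent_facts diff in \<open>auto intro!: mult_left_mono powr_mono2\<close>)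
    finally have "g (N' - 1) powr (1/p) \<le> (g (N2 - 1) + D * (real N' * \<eta>) powr \<gamma>) powr (1/p)"
      using nonneg p by (intro powr_mono2) auto
    also have "\<dots> \<le> g (N2 - 1) powr (1/p) + (D * (real N' * \<eta>) powr \<gamma>) powr (1/p)"
      using nonneg p D(1) by (intro powr_root_add_le) auto
    also have "(D * (real N' * \<eta>) powr \<gamma>) powr (1/p) = (D * \<eta> powr \<gamma>) powr (1/p) * real N' powr \<kappa>"
      using D(1) \<eta>0 exponent_facts by (simp add: powr_mult powr_powr)
    finally have "\<phi> N' \<le> (g (N2 - 1) powr (1/p) + (D * \<eta> powr \<gamma>) powr (1/p) * real N' powr \<kappa>) / real N' powr \<kappa>"
      unfolding \<phi>_def by (intro divide_right_mono) auto
    also have "\<dots> = g (N2 - 1) powr (1/p) / real N' powr \<kappa> + (D * \<eta> powr \<gamma>) powr (1/p)"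
      using N2 by (simp add: add_divide_distrib)
    also have "g (N2 - 1) powr (1/p) / real N' powr \<kappa> \<le> \<phi> N2"
      unfolding \<phi>_def using N2 exponent_facts by (intro divide_left_mono powr_mono2 mult_pos_pos) auto
    also have "\<phi> N2 \<le> \<phi> m + CK K * real (K ^ d * m) powr (-\<delta>)"
      unfolding N2_def using K K0 m1 by (intro CK(2)) auto
    also have "CK K * real (K ^ d * m) powr (-\<delta>) \<le> Cs * real m powr (-\<delta>)"
    proof (intro mult_mono Cs)
      show "real (K ^ d * m) powr (-\<delta>) \<le> real m powr (-\<delta>)"
        using exponent_facts m1 K K0 by (intro powr_mono2') (auto simp: mult_le_cancel_right1)
      show "K \<le> 2 * K0" using K K'le by simp
      show "0 \<le> Cs" unfolding Cs_def using CK(1) K0(1) by (intro sum_nonneg) auto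
    qed (use K in auto)
    also have "Cs * real m powr (-\<delta>) \<le> e / 3" using M2[OF mM] by simp
    also have "\<phi> m \<le> \<phi> N + C * real N powr (-\<delta>)" unfolding m_def using N by (intro C(2)) auto
    also have "C * real N powr (-\<delta>) \<le> e / 3" using M[of N] N by simp
    finally show "\<phi> N' \<le> \<phi> N + e" using K0(2) by simp
  qed
  then show ?thesis by blast
qed

lemma convergent_subadditive_cost: "convergent (\<lambda>n. g n / real n powr (1 - p / real d))"
proof -
  obtain B where "\<And>N. \<bar>\<phi> N\<bar> \<le> B" using phi_bounded by auto
  then have "convergent \<phi>" using phi_decrease by (rule convergent_of_asymptotic_decrease)
  then obtain l where "\<phi> \<longlonglongrightarrow> l" by (auto simp: convergent_def)
  then have l: "(\<lambda>n. \<phi> (Suc n)) \<longlonglongrightarrow> l" by (rule LIMSEQ_Suc)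
  \<comment> \<open>Passing from the index \<open>Suc n\<close> back to \<open>n\<close> points
    changes the normalisation by this factor only.\<close>
  have "(\<lambda>n. (1 + 1 / real n) powr \<gamma>) \<longlonglongrightarrow> (1 + 0) powr \<gamma>"
    by (intro tendsto_intros lim_1_over_n) auto
  then have "(\<lambda>n. \<phi> (Suc n) powr p * (1 + 1 / real n) powr \<gamma>) \<longlonglongrightarrow> l powr p * 1"
    using p phi_nonneg by (intro tendsto_mult tendsto_powr' l) auto
  moreover have "\<forall>\<^sub>F n in sequentially. \<phi> (Suc n) powr p * (1 + 1 / real n) powr \<gamma> = g n / real n powr (1 - p / real d)"
    using eventually_gt_at_top[of 0]
  proof eventually_elim
    case (elim n)
    have "g n = (\<phi> (Suc n) * real (Suc n) powr \<kappa>) powr p" using g_eq[of "Suc n"] by simp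
    also have "\<dots> = \<phi> (Suc n) powr p * real (Suc n) powr \<gamma>"
      using phi_nonneg exponent_facts by (simp add: powr_mult powr_powr mult.commute)
    finally have "g n / real n powr \<gamma> = \<phi> (Suc n) powr p * (real (Suc n) powr \<gamma> / real n powr \<gamma>)" by simp
    also have "real (Suc n) powr \<gamma> / real n powr \<gamma> = (1 + 1 / real n) powr \<gamma>"
      using elim by (simp add: powr_divide[symmetric] field_simps)
    finally show ?case by (simp add: \<gamma>_def)
  qed
  ultimately show ?thesis by (auto simp: convergent_def intro: Lim_transform_eventually)
qed

end

section \<open>Convergence of the rescaled expected cost\<close>

lemma mcost_scaled_le:
  fixes s :: "real^'n"
  assumes "finite I" "1 \<le> p" "\<forall>i\<in>I. x i \<in> cbox 0 1" "\<forall>i\<in>I. y i \<in> cbox 0 1"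
  shows "mcost p I (\<lambda>i. s * x i) (\<lambda>i. s * y i) \<le> real (card I) * norm s powr p"
  using assms by (intro mcost_le_card norm_scaled_cube_diff) auto

lemma Gcost_le:
  assumes I: "finite I" and p: "1 \<le> p"
  shows "Gcost p I (s :: real^'n) \<le> ennreal (real (card I) * norm s powr p)"
proof -
  let ?P = "PiM I (\<lambda>_. (unif_cube :: (real^'n) measure))"
  interpret P: prob_space ?P by (intro prob_space_PiM prob_space_unif_cube)
  note AE = AE_PiM_unif_cube[OF I]
  have "Gcost p I s \<le> (\<integral>\<^sup>+ x. \<integral>\<^sup>+ y. ennreal (real (card I) * norm s powr p) \<partial>?P \<partial>?P)"
    unfolding Gcost_def
  proof (rule nn_integral_mono_AE, use AE in eventually_elim)
    case x: (elim x)
    show ?case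
    proof (rule nn_integral_mono_AE, use AE in eventually_elim)
      case (elim y)
      show ?case by (intro ennreal_leI mcost_scaled_le I p x elim)
    qed
  qed
  then show ?thesis by (simp add: P.emeasure_space_1)
qed

definition gcost :: "real \<Rightarrow> nat \<Rightarrow> real^'n \<Rightarrow> real" where
  "gcost p n s = enn2real (Gcost p {..<n} s)"

lemma Gcost_eq: "1 \<le> p \<Longrightarrow> Gcost p {..<n} (s :: real^'n) = ennreal (gcost p n s)"
  unfolding gcost_def using Gcost_le[of "{..<n}" p s]
  by (simp add: order_le_less_trans[OF _ ennreal_less_top])

lemma gcost_nonneg: "0 \<le> gcost p n s" by (simp add: gcost_def)

lemma gcost_zero: "1 \<le> p \<Longrightarrow> gcost p 0 (s :: real^'n) = 0"
  using Gcost_le[of "{..<0}" p s] by (simp add: gcost_def)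

lemma gcost_subadd:
  assumes p: "1 \<le> p"
  shows "gcost p (a + b) (s :: real^'n) \<le> gcost p a s + gcost p b s"
proof -
  let ?U = "unif_cube :: (real^'n) measure"
  let ?I = "{..<a + b}" and ?J = "{..<a}" and ?K = "{a..<a + b}"
  let ?P = "PiM ?I (\<lambda>_. ?U)"
  interpret P: prob_space ?P by (intro prob_space_PiM prob_space_unif_cube)
  have cm: "(\<lambda>w. ennreal (mcost p L (\<lambda>i. s * fst w i) (\<lambda>i. s * snd w i))) \<in> borel_measurable (?P \<Otimes>\<^sub>M ?P)"
    if L: "L \<subseteq> ?I" for L
  proof -
    have fL: "finite L" using L by (rule finite_subset) simp
    have "(\<lambda>w. mcost p L (\<lambda>i. s * fst w i) (\<lambda>i. s * snd w i)) \<in> borel_measurable (?P \<Otimes>\<^sub>M ?P)"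
    proof (rule mcost_measurable[OF fL p])
      fix i assume "i \<in> L"
      then have i: "i \<in> ?I" using L by blast
      have [measurable]: "(\<lambda>w. fst w i) \<in> borel_measurable (?P \<Otimes>\<^sub>M ?P)" "(\<lambda>w. snd w i) \<in> borel_measurable (?P \<Otimes>\<^sub>M ?P)"
        using measurable_compose[OF measurable_fst measurable_component_singleton[OF i, of "\<lambda>_. ?U"]]
          measurable_compose[OF measurable_snd measurable_component_singleton[OF i, of "\<lambda>_. ?U"]]
        unfolding measurable_unif_cube2 .
      show "(\<lambda>w. s * fst w i) \<in> borel_measurable (?P \<Otimes>\<^sub>M ?P)" "(\<lambda>w. s * snd w i) \<in> borel_measurable (?P \<Otimes>\<^sub>M ?P)" by measurable
    qed
    then show ?thesis by (rule measurable_compose[OF _ measurable_ennreal])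
  qed
  have dbl: "(\<integral>\<^sup>+ x. \<integral>\<^sup>+ y. ennreal (mcost p L (\<lambda>i. s * x i) (\<lambda>i. s * y i)) \<partial>?P \<partial>?P)
    = (\<integral>\<^sup>+ w. ennreal (mcost p L (\<lambda>i. s * fst w i) (\<lambda>i. s * snd w i)) \<partial>(?P \<Otimes>\<^sub>M ?P))" if "L \<subseteq> ?I" for L
    using P.nn_integral_fst[OF cm[OF that]] by simp
  have "Gcost p ?I s \<le> (\<integral>\<^sup>+ w. ennreal (mcost p ?J (\<lambda>i. s * fst w i) (\<lambda>i. s * snd w i)) + ennreal (mcost p ?K (\<lambda>i. s * fst w i) (\<lambda>i. s * snd w i)) \<partial>(?P \<Otimes>\<^sub>M ?P))"
    unfolding Gcost_def dbl[OF order_refl]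
  proof (rule nn_integral_mono)
    fix w
    have I: "?I = ?J \<union> ?K" by auto
    have "mcost p ?I (\<lambda>i. s * fst w i) (\<lambda>i. s * snd w i) \<le> mcost p ?J (\<lambda>i. s * fst w i) (\<lambda>i. s * snd w i) + mcost p ?K (\<lambda>i. s * fst w i) (\<lambda>i. s * snd w i)"
      unfolding I by (rule mcost_union) auto
    then show "ennreal (mcost p ?I (\<lambda>i. s * fst w i) (\<lambda>i. s * snd w i))
      \<le> ennreal (mcost p ?J (\<lambda>i. s * fst w i) (\<lambda>i. s * snd w i)) + ennreal (mcost p ?K (\<lambda>i. s * fst w i) (\<lambda>i. s * snd w i))"
      by (subst ennreal_plus[symmetric]) (auto intro: mcost_nonneg ennreal_leI)
  qed
  also have "\<dots> = (\<integral>\<^sup>+ x. \<integral>\<^sup>+ y. ennreal (mcost p ?J (\<lambda>i. s * x i) (\<lambda>i. s * y i)) \<partial>?P \<partial>?P)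
      + (\<integral>\<^sup>+ x. \<integral>\<^sup>+ y. ennreal (mcost p ?K (\<lambda>i. s * x i) (\<lambda>i. s * y i)) \<partial>?P \<partial>?P)"
  proof -
    have s: "?J \<subseteq> ?I" "?K \<subseteq> ?I" by auto
    show ?thesis unfolding dbl[OF s(1)] dbl[OF s(2)] by (rule nn_integral_add[OF cm[OF s(1)] cm[OF s(2)]])
  qed
  also have "\<dots> = Gcost p ?J s + Gcost p ?K s"
    using Gcost_marginal[of ?I ?J "\<lambda>i. i" p s] Gcost_marginal[of ?I ?K "\<lambda>i. i" p s] p by (simp add: Pi_def)
  also have "Gcost p ?K s = Gcost p {..<b} s" using Gcost_card[of ?K p s] p by simp
  finally have "ennreal (gcost p (a + b) s) \<le> ennreal (gcost p a s + gcost p b s)"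
    using p by (simp add: Gcost_eq gcost_nonneg)
  then show ?thesis by (subst (asm) ennreal_le_iff) (auto simp: gcost_nonneg)
qed

lemma gcost_scale:
  assumes p: "1 \<le> p" and r: "0 \<le> r"
  shows "gcost p n (r *\<^sub>R (s :: real^'n)) = r powr p * gcost p n s"
proof -
  let ?P = "PiM {..<n} (\<lambda>_. (unif_cube :: (real^'n) measure))"
  interpret P: prob_space ?P by (intro prob_space_PiM prob_space_unif_cube)
  have eq: "mcost p {..<n} (\<lambda>i. (r *\<^sub>R s) * x i) (\<lambda>i. (r *\<^sub>R s) * y i) = r powr p * mcost p {..<n} (\<lambda>i. s * x i) (\<lambda>i. s * y i)" for x y :: "nat \<Rightarrow> real^'n"
  proof -
    have "norm ((r *\<^sub>R s) * u - (r *\<^sub>R s) * v) powr p = r powr p * norm (s * u - s * v) powr p" for u v :: "real^'n"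
    proof -
      have "(r *\<^sub>R s) * u - (r *\<^sub>R s) * v = r *\<^sub>R (s * u - s * v)" by (simp add: vec_eq_iff algebra_simps)
      then show ?thesis using r by (simp add: powr_mult)
    qed
    then have t: "tcost p {..<n} P (\<lambda>i. (r *\<^sub>R s) * x i) (\<lambda>i. (r *\<^sub>R s) * y i) = r powr p * tcost p {..<n} P (\<lambda>i. s * x i) (\<lambda>i. s * y i)" for P
      unfolding tcost_def sum_distrib_left by (intro sum.cong refl) (simp only: mult.left_commute)
    show ?thesis
    proof (rule antisym)
      show "r powr p * mcost p {..<n} (\<lambda>i. s * x i) (\<lambda>i. s * y i) \<le> mcost p {..<n} (\<lambda>i. (r *\<^sub>R s) * x i) (\<lambda>i. (r *\<^sub>R s) * y i)"
        by (rule mcost_greatest, simp, unfold t) (intro mult_left_mono mcost_le, auto)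
      show "mcost p {..<n} (\<lambda>i. (r *\<^sub>R s) * x i) (\<lambda>i. (r *\<^sub>R s) * y i) \<le> r powr p * mcost p {..<n} (\<lambda>i. s * x i) (\<lambda>i. s * y i)"
      proof (cases "r = 0")
        case True
        have "mcost p {..<n} (\<lambda>i. (r *\<^sub>R s) * x i) (\<lambda>i. (r *\<^sub>R s) * y i) \<le> tcost p {..<n} (\<lambda>i j. if i = j then 1 else 0) (\<lambda>i. (r *\<^sub>R s) * x i) (\<lambda>i. (r *\<^sub>R s) * y i)"
          by (intro mcost_le dstoch_id) simp
        then have "mcost p {..<n} (\<lambda>i. (r *\<^sub>R s) * x i) (\<lambda>i. (r *\<^sub>R s) * y i) \<le> r powr p * tcost p {..<n} (\<lambda>i j. if i = j then 1 else 0) (\<lambda>i. s * x i) (\<lambda>i. s * y i)"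
          by (simp only: t)
        then show ?thesis using True p by simp
      next
        case False
        then have r: "0 < r powr p" using r by simp
        have "mcost p {..<n} (\<lambda>i. (r *\<^sub>R s) * x i) (\<lambda>i. (r *\<^sub>R s) * y i) / r powr p \<le> mcost p {..<n} (\<lambda>i. s * x i) (\<lambda>i. s * y i)"
        proof (rule mcost_greatest)
          fix P :: "nat \<Rightarrow> nat \<Rightarrow> real" assume "P \<in> dstoch {..<n}"
          from mcost_le[OF this, of p "\<lambda>i. (r *\<^sub>R s) * x i" "\<lambda>i. (r *\<^sub>R s) * y i"]
          show "mcost p {..<n} (\<lambda>i. (r *\<^sub>R s) * x i) (\<lambda>i. (r *\<^sub>R s) * y i) / r powr p \<le> tcost p {..<n} P (\<lambda>i. s * x i) (\<lambda>i. s * y i)"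
            unfolding t using r by (metis pos_divide_le_eq mult.commute)
        qed simp
        then show ?thesis using r by (simp only: pos_divide_le_eq mult.commute)
      qed
    qed
  qed
  have "Gcost p {..<n} (r *\<^sub>R s) = (\<integral>\<^sup>+ x. \<integral>\<^sup>+ y. ennreal (r powr p) * ennreal (mcost p {..<n} (\<lambda>i. s * x i) (\<lambda>i. s * y i)) \<partial>?P \<partial>?P)"
    unfolding Gcost_def eq by (simp add: ennreal_mult mcost_nonneg)
  also have "\<dots> = (\<integral>\<^sup>+ x. ennreal (r powr p) * (\<integral>\<^sup>+ y. ennreal (mcost p {..<n} (\<lambda>i. s * x i) (\<lambda>i. s * y i)) \<partial>?P) \<partial>?P)"
    by (intro nn_integral_cong nn_integral_cmult
        measurable_compose[OF mcost_scaled_measurable[OF p finite_lessThan measurable_const measurable_ident_sets[OF refl]] measurable_ennreal])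
  also have "\<dots> = ennreal (r powr p) * Gcost p {..<n} s"
    unfolding Gcost_def
  proof (rule nn_integral_cmult, rule P.borel_measurable_nn_integral)
    have "(\<lambda>w. ennreal (mcost p {..<n} (\<lambda>i. s * fst w i) (\<lambda>i. s * snd w i))) \<in> borel_measurable (?P \<Otimes>\<^sub>M ?P)"
      by (rule measurable_compose[OF mcost_scaled_measurable[OF p finite_lessThan measurable_fst measurable_snd] measurable_ennreal])
    then show "(\<lambda>(x, y). ennreal (mcost p {..<n} (\<lambda>i. s * x i) (\<lambda>i. s * y i))) \<in> borel_measurable (?P \<Otimes>\<^sub>M ?P)"
      by (simp add: case_prod_beta')
  qed
  finally show ?thesis by (simp add: gcost_def enn2real_mult)
qed

section \<open>Iterated cuts into slabs and boxes\<close>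

text \<open>Minkowski's inequality in the plane for \<open>(a, b + e) = (a, b) + (0, e)\<close>. It
  lets an error in one part pass to the whole without being amplified.\<close>

lemma root_sum_add_le:
  fixes a b e p :: real
  assumes "0 \<le> a" "0 \<le> b" "0 \<le> e" "1 \<le> p"
  shows "(a powr p + (b + e) powr p) powr (1/p) \<le> (a powr p + b powr p) powr (1/p) + e"
proof -
  have "(a powr p + (b + e) powr p) powr (1/p) \<le> (a powr p + b powr p) powr (1/p) + (e powr p) powr (1/p)"
  proof (rule minkowski_from_convex)
    fix \<theta> :: real assume th: "0 < \<theta>" "\<theta> < 1"
    then have "1 \<le> (1 - \<theta>) powr (1 - p)" using powr_mono'[of "1 - p" 0 "1 - \<theta>"] assms by auto
    then have "1 * a powr p \<le> (1 - \<theta>) powr (1 - p) * a powr p" by (intro mult_right_mono) auto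
    moreover have "(b + e) powr p \<le> (1 - \<theta>) powr (1 - p) * b powr p + \<theta> powr (1 - p) * e powr p"
      using assms th by (intro powr_add_convex)
    ultimately show "a powr p + (b + e) powr p \<le> (1 - \<theta>) powr (1 - p) * (a powr p + b powr p) + \<theta> powr (1 - p) * e powr p"
      by (simp add: algebra_simps)
  qed (use assms in auto)
  then show ?thesis using assms by (simp add: powr_powr)
qed

text \<open>The index is the number of points plus one: a cut uses up the separating point, so that
  \<open>A + B - 1\<close> points are split into \<open>A - 1\<close> and \<open>B - 1\<close>.\<close>

definition Gam :: "real \<Rightarrow> nat \<Rightarrow> real^'n \<Rightarrow> real" where
  "Gam p N s = gcost p (N - 1) s powr (1/p)"

lemma Gam_nonneg: "0 \<le> Gam p N s" by (simp add: Gam_def)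

text \<open>Here \<open>\<theta>\<close> is eliminated by \<open>minkowski_from_convex\<close>. Up
  to constants and the factor \<open>norm s\<close>, the root of the error is the larger of
  \<open>N powr (1/p - 1/2)\<close>, from the displacement, and 1, from the separating points, with
  \<open>N = A + B\<close>; hence the exponent \<open>\<beta>\<close>.\<close>

lemma Gam_cut:
  assumes p: "1 \<le> p"
  defines "\<beta> \<equiv> max 0 (1/p - 1/2)"
  shows "\<exists>C\<ge>0. \<forall>(k::'n::finite) A B (s::real^'n). 1 \<le> A \<longrightarrow> 1 \<le> B \<longrightarrow>
    Gam p (A + B) s \<le> (Gam p A (aff k 0 (real A / real (A + B)) s) powr p + Gam p B (aff k 0 (real B / real (A + B)) s) powr p) powr (1/p)
      + norm s * (C * real (A + B) powr \<beta>)"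
proof -
  obtain C where C: "0 \<le> C" "\<And>(k::'n) n a (s::real^'n) \<theta>. a < n \<Longrightarrow> 0 < \<theta> \<Longrightarrow> \<theta> < 1 \<Longrightarrow>
    Gcost p {..<n} s \<le> ennreal ((1 - \<theta>) powr (1 - p)) *
       (Gcost p {..<a} (aff k 0 ((real a + 1) / (real n + 1)) s) + Gcost p {..<n - a - 1} (aff k 0 (1 - (real a + 1) / (real n + 1)) s))
      + ennreal (\<theta> powr (1 - p) * (norm s powr p * (C * (real n * (real n + 1) powr (-p/2)) + 1)))"
    using Gcost_cut[OF p] by (smt (verit))
  have "Gam p (A + B) s \<le> (Gam p A (aff k 0 (real A / real (A + B)) s) powr p + Gam p B (aff k 0 (real B / real (A + B)) s) powr p) powr (1/p)
      + norm s * ((C + 1) powr (1/p) * real (A + B) powr \<beta>)" if A: "1 \<le> A" and B: "1 \<le> B" for k :: 'n and A B and s :: "real^'n"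
  proof -
    define n where "n = A + B - 1"
    define a where "a = A - 1"
    have an: "a < n" "n - a - 1 = B - 1" "real n + 1 = real (A + B)" "real a + 1 = real A"
      using A B by (auto simp: n_def a_def of_nat_diff)
    let ?s1 = "aff k 0 (real A / real (A + B)) s" and ?s2 = "aff k 0 (real B / real (A + B)) s"
    have tau: "1 - real A / real (A + B) = real B / real (A + B)" using A by (simp add: field_simps)
    define E where "E = norm s powr p * (C * (real n * (real n + 1) powr (-p/2)) + 1)"
    have E0: "0 \<le> E" using C(1) by (simp add: E_def)
    have "gcost p n s powr (1/p) \<le> (gcost p a ?s1 + gcost p (B - 1) ?s2) powr (1/p) + E powr (1/p)"
    proof (rule minkowski_from_convex[OF _ E0 p])
      fix \<theta> :: real assume th: "0 < \<theta>" "\<theta> < 1"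
      have "ennreal (gcost p n s) \<le> ennreal ((1 - \<theta>) powr (1 - p)) * (ennreal (gcost p a ?s1) + ennreal (gcost p (B - 1) ?s2)) + ennreal (\<theta> powr (1 - p) * E)"
        using C(2)[OF an(1) th, of s k] unfolding an tau E_def Gcost_eq[OF p] .
      also have "\<dots> = ennreal ((1 - \<theta>) powr (1 - p) * (gcost p a ?s1 + gcost p (B - 1) ?s2) + \<theta> powr (1 - p) * E)"
        using E0 by (simp add: gcost_nonneg ennreal_mult)
      finally show "gcost p n s \<le> (1 - \<theta>) powr (1 - p) * (gcost p a ?s1 + gcost p (B - 1) ?s2) + \<theta> powr (1 - p) * E"
        using E0 by (subst (asm) ennreal_le_iff) (auto simp: gcost_nonneg)
    qed (auto simp: gcost_nonneg)
    moreover have "E powr (1/p) \<le> norm s * ((C + 1) powr (1/p) * real (A + B) powr \<beta>)"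
    proof -
      define N where "N = real (A + B)"
      have N: "1 \<le> N" using A by (simp add: N_def)
      have "real n * (real n + 1) powr (-p/2) \<le> N powr 1 * N powr (-p/2)"
        unfolding an N_def[symmetric] using an(3) N by (intro mult_right_mono) (auto simp: N_def)
      also have "\<dots> = N powr (p * (1/p - 1/2))"
      proof -
        have "p * (1/p - 1/2) = 1 + -p/2" using p by (simp add: right_diff_distrib)
        then show ?thesis by (simp only: powr_add)
      qed
      also have "\<dots> \<le> N powr (p * \<beta>)" using N p by (intro powr_mono mult_left_mono) (auto simp: \<beta>_def)
      finally have "C * (real n * (real n + 1) powr (-p/2)) \<le> C * N powr (p * \<beta>)" using C(1) by (intro mult_left_mono)
      moreover have "1 \<le> N powr (p * \<beta>)" using N p by (intro ge_one_powr_ge_zero) (auto simp: \<beta>_def)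
      ultimately have "C * (real n * (real n + 1) powr (-p/2)) + 1 \<le> (C + 1) * N powr (p * \<beta>)" by (simp add: algebra_simps)
      then have "E \<le> norm s powr p * ((C + 1) * N powr (p * \<beta>))" unfolding E_def by (intro mult_left_mono) auto
      then have "E powr (1/p) \<le> (norm s powr p * ((C + 1) * N powr (p * \<beta>))) powr (1/p)"
        using E0 p by (intro powr_mono2) auto
      also have "\<dots> = norm s * ((C + 1) powr (1/p) * N powr \<beta>)"
        using C(1) p N by (simp add: powr_mult powr_powr)
      finally show ?thesis by (simp add: N_def)
    qed
    moreover have "Gam p A ?s1 powr p = gcost p a ?s1" "Gam p B ?s2 powr p = gcost p (B - 1) ?s2" "Gam p (A + B) s = gcost p n s powr (1/p)"
      using p by (simp_all add: Gam_def a_def n_def powr_powr gcost_nonneg)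
    ultimately show ?thesis by simp
  qed
  then show ?thesis using C(1) by (intro exI[of _ "(C + 1) powr (1/p)"]) auto
qed

lemma norm_aff_le:
  fixes s :: "real^'n"
  assumes "0 \<le> r" "r \<le> 1"
  shows "norm (aff k 0 r s) \<le> norm s"
  using assms by (intro norm_le_componentwise_cart) (auto simp: abs_mult mult_left_le_one_le)

text \<open>Slabs are cut off one at a time. The proportions are exact because the shifted indices,
  unlike the numbers of points, add up: a fraction \<open>K / (K + 1)\<close> of the box remains,
  and its \<open>K\<close>-th part is \<open>1 / (K + 1)\<close> of the whole. By
  \<open>root_sum_add_le\<close> earlier errors are not amplified, so they only add up.\<close>

lemma Gam_slab:
  assumes p: "1 \<le> p"
  defines "\<beta> \<equiv> max 0 (1/p - 1/2)"
  shows "\<exists>C\<ge>0. \<forall>(k::'n::finite) K N (s::real^'n). 1 \<le> K \<longrightarrow> 1 \<le> N \<longrightarrow>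
    Gam p (K * N) s \<le> real K powr (1/p) * Gam p N (aff k 0 (1 / real K) s) + norm s * (real K * C * real (K * N) powr \<beta>)"
proof -
  obtain C where C: "0 \<le> C" "\<And>(k::'n) A B (s::real^'n). 1 \<le> A \<Longrightarrow> 1 \<le> B \<Longrightarrow>
    Gam p (A + B) s \<le> (Gam p A (aff k 0 (real A / real (A + B)) s) powr p + Gam p B (aff k 0 (real B / real (A + B)) s) powr p) powr (1/p)
      + norm s * (C * real (A + B) powr \<beta>)"
    using Gam_cut[OF p] unfolding \<beta>_def by (smt (verit))
  have \<beta>0: "0 \<le> \<beta>" by (simp add: \<beta>_def)
  have "Gam p (K * N) s \<le> real K powr (1/p) * Gam p N (aff k 0 (1 / real K) s) + norm s * (real K * C * real (K * N) powr \<beta>)"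
    if K: "1 \<le> K" and N: "1 \<le> N" for k :: 'n and K N and s :: "real^'n"
    using K
  proof (induction K arbitrary: s rule: nat_induct_at_least)
    case base
    have "aff k 0 1 s = s" by (simp add: vec_eq_iff)
    then show ?case using C(1) by simp
  next
    case (Suc K)
    let ?s1 = "aff k 0 (1 / real (Suc K)) s" and ?s2 = "aff k 0 (real K / real (Suc K)) s"
    define e where "e = norm s * (real K * C * real (Suc K * N) powr \<beta>)"
    have e0: "0 \<le> e" using C(1) by (simp add: e_def)
    have NK: "Suc K * N = N + K * N" by simp
    have fr: "real N / real (N + K * N) = 1 / real (Suc K)" "real (K * N) / real (N + K * N) = real K / real (Suc K)"
    proof -
      have "real (N + K * N) = real (Suc K) * real N" by (simp add: algebra_simps)
      then show "real N / real (N + K * N) = 1 / real (Suc K)" "real (K * N) / real (N + K * N) = real K / real (Suc K)"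
        using N by simp_all
    qed
    have s21: "aff k 0 (1 / real K) ?s2 = ?s1" using Suc.hyps by (simp add: vec_eq_iff)
    have "Gam p (K * N) ?s2 \<le> real K powr (1/p) * Gam p N ?s1 + norm ?s2 * (real K * C * real (K * N) powr \<beta>)"
      using Suc.IH[of ?s2] unfolding s21 .
    also have "norm ?s2 * (real K * C * real (K * N) powr \<beta>) \<le> e"
      unfolding e_def using C(1) \<beta>0 by (intro mult_mono norm_aff_le powr_mono2) auto
    finally have IH: "Gam p (K * N) ?s2 \<le> real K powr (1/p) * Gam p N ?s1 + e" by simp
    have "Gam p (Suc K * N) s \<le> (Gam p N ?s1 powr p + Gam p (K * N) ?s2 powr p) powr (1/p) + norm s * (C * real (Suc K * N) powr \<beta>)"
      using C(2)[of N "K * N" s k] N Suc.hyps unfolding NK fr by simp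
    also have "(Gam p N ?s1 powr p + Gam p (K * N) ?s2 powr p) powr (1/p)
      \<le> (Gam p N ?s1 powr p + (real K powr (1/p) * Gam p N ?s1 + e) powr p) powr (1/p)"
      using IH p by (intro powr_mono2 add_left_mono) (auto simp: Gam_nonneg)
    also have "\<dots> \<le> (Gam p N ?s1 powr p + (real K powr (1/p) * Gam p N ?s1) powr p) powr (1/p) + e"
      using p e0 by (intro root_sum_add_le) (auto simp: Gam_nonneg)
    also have "Gam p N ?s1 powr p + (real K powr (1/p) * Gam p N ?s1) powr p = real (Suc K) * Gam p N ?s1 powr p"
      using p by (simp add: powr_mult powr_powr Gam_nonneg algebra_simps)
    also have "\<dots> powr (1/p) = real (Suc K) powr (1/p) * Gam p N ?s1"
      using p by (simp add: powr_mult powr_powr Gam_nonneg)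
    finally show ?case by (simp add: e_def algebra_simps)
  qed
  then show ?thesis using C(1) by blast
qed

definition scale_on :: "'n set \<Rightarrow> real \<Rightarrow> real^'n \<Rightarrow> real^'n" where
  "scale_on S r s = (\<chi> i. if i \<in> S then r * s $ i else s $ i)"

text \<open>The slabs of one direction are subdivided in the next. The constant depends on
  \<open>K\<close>, which is harmless since \<open>K\<close> stays fixed while \<open>N\<close>
  grows.\<close>

lemma Gam_box:
  fixes S :: "'n::finite set"
  assumes p: "1 \<le> p" and K: "1 \<le> K"
  defines "\<beta> \<equiv> max 0 (1/p - 1/2)"
  shows "\<exists>C\<ge>0. \<forall>N (s::real^'n). 1 \<le> N \<longrightarrow>
    Gam p (K ^ card S * N) s \<le> real (K ^ card S) powr (1/p) * Gam p N (scale_on S (1 / real K) s) + norm s * (C * real (K ^ card S * N) powr \<beta>)"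
proof -
  obtain C where C: "0 \<le> C" "\<And>(k::'n) K N (s::real^'n). 1 \<le> K \<Longrightarrow> 1 \<le> N \<Longrightarrow>
    Gam p (K * N) s \<le> real K powr (1/p) * Gam p N (aff k 0 (1 / real K) s) + norm s * (real K * C * real (K * N) powr \<beta>)"
    using Gam_slab[OF p] unfolding \<beta>_def by (smt (verit))
  have \<beta>0: "0 \<le> \<beta>" by (simp add: \<beta>_def)
  have "finite S" by simp
  then show ?thesis
  proof (induction S rule: finite_induct)
    case empty
    show ?case by (intro exI[of _ 0]) (simp add: scale_on_def vec_lambda_eta)
  next
    case (insert k S)
    then obtain D where D: "0 \<le> D" "\<And>N (s::real^'n). 1 \<le> N \<Longrightarrow>
      Gam p (K ^ card S * N) s \<le> real (K ^ card S) powr (1/p) * Gam p N (scale_on S (1 / real K) s) + norm s * (D * real (K ^ card S * N) powr \<beta>)"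
      by auto
    have "Gam p (K ^ card (insert k S) * N) s \<le> real (K ^ card (insert k S)) powr (1/p) * Gam p N (scale_on (insert k S) (1 / real K) s)
       + norm s * ((real K powr (1/p) * D + real K * C) * real (K ^ card (insert k S) * N) powr \<beta>)"
      if N: "1 \<le> N" for N and s :: "real^'n"
    proof -
      let ?M = "K ^ card S * N"
      have M: "1 \<le> ?M" using K N by simp
      have KM: "K ^ card (insert k S) * N = K * ?M" using insert.hyps by simp
      let ?s' = "aff k 0 (1 / real K) s"
      have sc: "scale_on S (1 / real K) ?s' = scale_on (insert k S) (1 / real K) s"
        using insert.hyps by (auto simp: scale_on_def vec_eq_iff)
      have "Gam p (K * ?M) s \<le> real K powr (1/p) * Gam p ?M ?s' + norm s * (real K * C * real (K * ?M) powr \<beta>)"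
        by (rule C(2)[OF K M])
      also have "Gam p ?M ?s' \<le> real (K ^ card S) powr (1/p) * Gam p N (scale_on (insert k S) (1 / real K) s) + norm s * (D * real (K * ?M) powr \<beta>)"
      proof -
        have "?M \<le> K * ?M" using K by simp
        then have "real ?M \<le> real (K * ?M)" by (simp only: of_nat_le_iff)
        then have "real ?M powr \<beta> \<le> real (K * ?M) powr \<beta>" using \<beta>0 by (intro powr_mono2) auto
        then have "norm ?s' * (D * real ?M powr \<beta>) \<le> norm s * (D * real (K * ?M) powr \<beta>)"
          using K D(1) by (intro mult_mono norm_aff_le) auto
        then show ?thesis using D(2)[OF N, of ?s'] unfolding sc by linarith
      qed
      also have "real K powr (1/p) * (real (K ^ card S) powr (1/p) * Gam p N (scale_on (insert k S) (1 / real K) s) + norm s * (D * real (K * ?M) powr \<beta>))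
          + norm s * (real K * C * real (K * ?M) powr \<beta>)
        = (real K powr (1/p) * real (K ^ card S) powr (1/p)) * Gam p N (scale_on (insert k S) (1 / real K) s)
          + norm s * ((real K powr (1/p) * D + real K * C) * real (K * ?M) powr \<beta>)"
        by (simp add: algebra_simps)
      also have "real K powr (1/p) * real (K ^ card S) powr (1/p) = real (K ^ card (insert k S)) powr (1/p)"
        using insert.hyps by (simp add: powr_mult)
      finally show ?thesis unfolding KM by (simp add: mult_left_mono)
    qed
    then show ?case using C(1) D(1) by (intro exI[of _ "real K powr (1/p) * D + real K * C"]) auto
  qed
qed

text \<open>After all directions have been treated, the box is a cube of side \<open>1 / K\<close>,
  and homogeneity leads back to the unit cube. The \<open>K ^ d\<close> cubes and the side length
  together produce the factor \<open>K powr (d / p - 1)\<close>.\<close>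

lemma convergent_gcost:
  assumes d: "3 \<le> CARD('n::finite)" and p: "1 \<le> p" "p < real CARD('n)"
  shows "convergent (\<lambda>n. gcost p n (1 :: real^'n) / real n powr (1 - p / real CARD('n)))"
proof (rule convergent_subadditive_cost[where \<beta> = "max 0 (1/p - 1/2)"])
  \<comment> \<open>For the first argument of \<open>max\<close> the inequality is
    \<open>p < d\<close>, for the second it is \<open>2 < d\<close>.\<close>
  show "max 0 (1/p - 1/2) < 1/p - 1 / real CARD('n)"
    using d p by (auto simp: max_def field_simps)
  show "gcost p (a + b) (1 :: real^'n) \<le> gcost p a (1 :: real^'n) + gcost p b (1 :: real^'n)" for a b by (rule gcost_subadd[OF p(1)])
  fix K :: nat assume K: "1 \<le> K"
  obtain C where C: "0 \<le> C" "\<And>N (s::real^'n). 1 \<le> N \<Longrightarrow>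
    Gam p (K ^ CARD('n) * N) s \<le> real (K ^ CARD('n)) powr (1/p) * Gam p N (scale_on UNIV (1 / real K) s) + norm s * (C * real (K ^ CARD('n) * N) powr max 0 (1/p - 1/2))"
    using Gam_box[OF p(1) K, of "UNIV :: 'n set"] by auto
  show "\<exists>C\<ge>0. \<forall>N\<ge>1. gcost p (K ^ CARD('n) * N - 1) (1 :: real^'n) powr (1/p) \<le>
      real K powr (real CARD('n) / p - 1) * gcost p (N - 1) (1 :: real^'n) powr (1/p) + C * real (K ^ CARD('n) * N) powr max 0 (1/p - 1/2)"
  proof (intro exI[of _ "norm (1 :: real^'n) * C"] conjI allI impI)
    fix N :: nat assume N: "1 \<le> N"
    have sc: "scale_on UNIV (1 / real K) (1 :: real^'n) = (1 / real K) *\<^sub>R 1" by (simp add: scale_on_def vec_eq_iff)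
    have "Gam p N ((1 / real K) *\<^sub>R (1 :: real^'n)) = (1 / real K) * Gam p N (1 :: real^'n)"
      using p by (simp add: Gam_def gcost_scale powr_mult powr_powr gcost_nonneg)
    moreover have "real (K ^ CARD('n)) powr (1/p) = real K powr (real CARD('n) / p)"
      using K by (simp add: powr_realpow[symmetric] powr_powr)
    ultimately have "real (K ^ CARD('n)) powr (1/p) * Gam p N (scale_on UNIV (1 / real K) (1 :: real^'n)) = real K powr (real CARD('n) / p - 1) * Gam p N (1 :: real^'n)"
      using K unfolding sc by (simp add: powr_diff)
    then show "gcost p (K ^ CARD('n) * N - 1) (1 :: real^'n) powr (1/p) \<le>
      real K powr (real CARD('n) / p - 1) * gcost p (N - 1) (1 :: real^'n) powr (1/p) + norm (1 :: real^'n) * C * real (K ^ CARD('n) * N) powr max 0 (1/p - 1/2)"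
      using C(2)[OF N, of 1] by (simp add: Gam_def mult.assoc)
  qed (use C(1) in auto)
qed (use p in \<open>auto simp: gcost_nonneg gcost_zero\<close>)

section \<open>Concentration of measure on the cube\<close>

text \<open>Let \<open>a\<close> be near the supremum of \<open>A\<close> and \<open>b\<close> near
  the infimum of \<open>B\<close>. The copies of \<open>A\<close> and \<open>B\<close> with ratio
  \<open>1/2\<close> towards \<open>b\<close> and \<open>a\<close>, respectively, lie in
  \<open>C\<close>. The copy of \<open>A\<close> ends before the right end of \<open>?J\<close> and
  that of \<open>B\<close> starts after its left end, so they overlap only in the short interval
  \<open>?J\<close>.\<close>

lemma midpoint_brunn_minkowski:
  fixes A B C :: "real set"
  assumes [measurable]: "A \<in> sets borel" "B \<in> sets borel" "C \<in> sets borel"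
    and ne: "A \<noteq> {}" "B \<noteq> {}" and bd: "bounded A" "bounded B"
    and C: "\<And>a b. a \<in> A \<Longrightarrow> b \<in> B \<Longrightarrow> (a + b) / 2 \<in> C"
  shows "emeasure lborel A + emeasure lborel B \<le> 2 * emeasure lborel C"
proof (rule ennreal_le_epsilon)
  fix e :: real assume e: "0 < e"
  have bA: "bdd_above A" and bB: "bdd_below B" using bd by (auto intro: bounded_imp_bdd_above bounded_imp_bdd_below)
  obtain a where a: "a \<in> A" "Sup A - e / 2 < a" using less_cSupE[OF _ ne(1), of "Sup A - e / 2"] e by auto
  obtain b where b: "b \<in> B" "b < Inf B + e / 2" using cInf_lessD[OF ne(2), of "Inf B + e / 2"] e by auto
  let ?J = "{(a + Inf B) / 2 .. (Sup A + b) / 2}"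
  have ord: "(a + Inf B) / 2 \<le> (Sup A + b) / 2"
    using cSup_upper[OF a(1) bA] cInf_lower[OF b(1) bB] by simp
  have pt: "indicator A (-b + 2 * y) + indicator B (-a + 2 * y) \<le> (indicator C y + indicator ?J y :: ennreal)" for y
  proof -
    have 1: "y \<in> C" "y \<le> (Sup A + b) / 2" if "-b + 2 * y \<in> A"
      using C[OF that b(1)] cSup_upper[OF that bA] by auto
    have 2: "y \<in> C" "(a + Inf B) / 2 \<le> y" if "-a + 2 * y \<in> B"
      using C[OF a(1) that] cInf_lower[OF that bB] by auto
    show ?thesis using 1 2 by (auto simp: indicator_def)
  qed
  have "emeasure lborel A + emeasure lborel B = (\<integral>\<^sup>+ y. indicator A y \<partial>lborel) + (\<integral>\<^sup>+ y. indicator B y \<partial>lborel)" by simp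
  also have "(\<integral>\<^sup>+ y. indicator A y \<partial>lborel) = 2 * (\<integral>\<^sup>+ y. indicator A (-b + 2 * y) \<partial>lborel)"
    by (subst nn_integral_real_affine[where c = 2 and t = "-b"]) auto
  also have "(\<integral>\<^sup>+ y. indicator B y \<partial>lborel) = 2 * (\<integral>\<^sup>+ y. indicator B (-a + 2 * y) \<partial>lborel)"
    by (subst nn_integral_real_affine[where c = 2 and t = "-a"]) auto
  also have "2 * (\<integral>\<^sup>+ y. indicator A (-b + 2 * y) \<partial>lborel) + 2 * (\<integral>\<^sup>+ y. indicator B (-a + 2 * y) \<partial>lborel)
    = 2 * (\<integral>\<^sup>+ y. indicator A (-b + 2 * y) + indicator B (-a + 2 * y) \<partial>lborel)"
    by (subst nn_integral_add) (auto simp: distrib_left)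
  also have "\<dots> \<le> 2 * (\<integral>\<^sup>+ y. indicator C y + indicator ?J y \<partial>lborel)"
    using pt by (intro mult_left_mono nn_integral_mono) auto
  also have "\<dots> = 2 * emeasure lborel C + 2 * emeasure lborel ?J"
    by (subst nn_integral_add) (auto simp: distrib_left)
  also have "2 * emeasure lborel ?J = ennreal (Sup A + b - (a + Inf B))"
  proof -
    have "2 * emeasure lborel ?J = ennreal (2 * ((Sup A + b) / 2 - (a + Inf B) / 2))"
      using ord by (subst ennreal_mult) auto
    also have "2 * ((Sup A + b) / 2 - (a + Inf B) / 2) = Sup A + b - (a + Inf B)" by (simp add: field_simps)
    finally show ?thesis .
  qed
  also have "\<dots> \<le> ennreal e" using a b by (intro ennreal_leI) simp
  finally show "emeasure lborel A + emeasure lborel B \<le> 2 * emeasure lborel C + ennreal e" by simp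
qed

text \<open>Levels are multiples \<open>\<alpha> * s\<close> with \<open>s\<close> in the unit
  interval, so that functions with different suprema can be compared level by level. For a function
  bounded by \<open>\<alpha>\<close> no level is missed; otherwise the levels above
  \<open>\<alpha>\<close> are dropped, which leaves an inequality.\<close>

lemma layer_cake_bounded:
  fixes f :: "real \<Rightarrow> real"
  assumes [measurable]: "f \<in> borel_measurable borel" and \<alpha>: "0 < \<alpha>"
  shows "(\<And>x. 0 \<le> f x) \<Longrightarrow> (\<And>x. f x \<le> \<alpha>) \<Longrightarrow>
      (\<integral>\<^sup>+ x. ennreal (f x / \<alpha>) \<partial>lborel) = (\<integral>\<^sup>+ s. indicator {0<..<1} s * emeasure lborel {x. \<alpha> * s < f x} \<partial>lborel)"
    and "(\<And>x. 0 \<le> f x) \<Longrightarrow>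
      (\<integral>\<^sup>+ s. indicator {0<..<1} s * emeasure lborel {x. \<alpha> * s < f x} \<partial>lborel) \<le> (\<integral>\<^sup>+ x. ennreal (f x / \<alpha>) \<partial>lborel)"
proof -
  have "(\<integral>\<^sup>+ s. indicator {0<..<1} s * emeasure lborel {x. \<alpha> * s < f x} \<partial>lborel)
    = (\<integral>\<^sup>+ s. \<integral>\<^sup>+ x. indicator {0<..<1::real} s * indicator {x. \<alpha> * s < f x} x \<partial>lborel \<partial>lborel)"
  proof (rule nn_integral_cong)
    fix s :: real
    have "(\<integral>\<^sup>+ x. indicator {0<..<1::real} s * indicator {x. \<alpha> * s < f x} x \<partial>lborel) = indicator {0<..<1} s * (\<integral>\<^sup>+ x. indicator {x. \<alpha> * s < f x} x \<partial>lborel)"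
      by (rule nn_integral_cmult) measurable
    also have "(\<integral>\<^sup>+ x. indicator {x. \<alpha> * s < f x} x \<partial>lborel) = emeasure lborel {x. \<alpha> * s < f x}"
      by (rule nn_integral_indicator) measurable
    finally show "indicator {0<..<1} s * emeasure lborel {x. \<alpha> * s < f x} = (\<integral>\<^sup>+ x. indicator {0<..<1::real} s * indicator {x. \<alpha> * s < f x} x \<partial>lborel)" by simp
  qed
  also have "\<dots> = (\<integral>\<^sup>+ x. \<integral>\<^sup>+ s. indicator {0<..<1::real} s * indicator {x. \<alpha> * s < f x} x \<partial>lborel \<partial>lborel)"
    by (rule lborel_pair.Fubini') measurable
  finally have eq: "(\<integral>\<^sup>+ s. indicator {0<..<1} s * emeasure lborel {x. \<alpha> * s < f x} \<partial>lborel)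
    = (\<integral>\<^sup>+ x. \<integral>\<^sup>+ s. indicator {0<..<1::real} s * indicator {x. \<alpha> * s < f x} x \<partial>lborel \<partial>lborel)" .
  have len: "(\<integral>\<^sup>+ s. indicator {0<..<t} s \<partial>lborel) = ennreal t" if "0 \<le> t" for t :: real
    using that by simp
  show "(\<integral>\<^sup>+ x. ennreal (f x / \<alpha>) \<partial>lborel) = (\<integral>\<^sup>+ s. indicator {0<..<1} s * emeasure lborel {x. \<alpha> * s < f x} \<partial>lborel)"
    if nn: "\<And>x. 0 \<le> f x" and le: "\<And>x. f x \<le> \<alpha>"
    unfolding eq
  proof (rule nn_integral_cong)
    fix x
    have "(\<integral>\<^sup>+ s. indicator {0<..<1::real} s * indicator {x. \<alpha> * s < f x} x \<partial>lborel) = (\<integral>\<^sup>+ s. indicator {0<..<f x / \<alpha>} s \<partial>lborel)"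
    proof (rule nn_integral_cong)
      fix s
      have "0 < s \<and> s < 1 \<and> \<alpha> * s < f x \<longleftrightarrow> 0 < s \<and> s < f x / \<alpha>"
        using \<alpha> le[of x] by (auto simp: pos_less_divide_eq mult.commute) (metis mult_less_cancel_left_pos mult.right_neutral order_less_le_trans mult.commute)
      then show "(indicator {0<..<1::real} s * indicator {x. \<alpha> * s < f x} x :: ennreal) = indicator {0<..<f x / \<alpha>} s"
        by (auto simp: indicator_def)
    qed
    then show "ennreal (f x / \<alpha>) = (\<integral>\<^sup>+ s. indicator {0<..<1::real} s * indicator {x. \<alpha> * s < f x} x \<partial>lborel)"
      using len[of "f x / \<alpha>"] nn \<alpha> by simp
  qed
  show "(\<integral>\<^sup>+ s. indicator {0<..<1} s * emeasure lborel {x. \<alpha> * s < f x} \<partial>lborel) \<le> (\<integral>\<^sup>+ x. ennreal (f x / \<alpha>) \<partial>lborel)"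
    if nn: "\<And>x. 0 \<le> f x"
    unfolding eq
  proof (rule nn_integral_mono)
    fix x
    have "(\<integral>\<^sup>+ s. indicator {0<..<1::real} s * indicator {x. \<alpha> * s < f x} x \<partial>lborel) \<le> (\<integral>\<^sup>+ s. indicator {0<..<f x / \<alpha>} s \<partial>lborel)"
      using \<alpha> by (intro nn_integral_mono) (auto simp: indicator_def pos_less_divide_eq mult.commute)
    then show "(\<integral>\<^sup>+ s. indicator {0<..<1::real} s * indicator {x. \<alpha> * s < f x} x \<partial>lborel) \<le> ennreal (f x / \<alpha>)"
      using len[of "f x / \<alpha>"] nn \<alpha> by simp
  qed
qed

text \<open>Scaling the levels by the suprema makes the level sets of \<open>f\<close> and
  \<open>g\<close> nonempty for every \<open>s < 1\<close>, as
  \<open>midpoint_brunn_minkowski\<close> requires; their midpoints lie in the level set of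
  \<open>h\<close> at \<open>sqrt (\<alpha> * \<beta>) * s\<close>. Integration over
  \<open>s\<close> bounds the sum of the two rescaled integrals, and the inequality between
  arithmetic and geometric means turns the sum into the product.\<close>

lemma prekopa_leindler_1d:
  fixes f g h :: "real \<Rightarrow> real"
  assumes m [measurable]: "f \<in> borel_measurable borel" "g \<in> borel_measurable borel" "h \<in> borel_measurable borel"
    and nn: "\<And>x. 0 \<le> f x" "\<And>x. 0 \<le> g x" "\<And>x. 0 \<le> h x"
    and bd: "\<And>x. f x \<le> K" "\<And>x. g x \<le> K"
    and supp: "\<And>x. M < \<bar>x\<bar> \<Longrightarrow> f x = 0" "\<And>x. M < \<bar>x\<bar> \<Longrightarrow> g x = 0"
    and le: "\<And>x y. f x * g y \<le> (h ((x + y) / 2))\<^sup>2"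
    and h1: "(\<integral>\<^sup>+ x. h x \<partial>lborel) = 1"
  shows "(\<integral>\<^sup>+ x. f x \<partial>lborel) * (\<integral>\<^sup>+ x. g x \<partial>lborel) \<le> 1"
proof -
  define \<alpha> where "\<alpha> = (SUP x. f x)"
  define \<beta> where "\<beta> = (SUP x. g x)"
  have ba: "bdd_above (range f)" "bdd_above (range g)" using bd by (auto intro!: bdd_aboveI2)
  have f\<alpha>: "f x \<le> \<alpha>" and g\<beta>: "g x \<le> \<beta>" for x unfolding \<alpha>_def \<beta>_def using ba by (auto intro: cSUP_upper)
  show ?thesis
  proof (cases "\<alpha> \<le> 0 \<or> \<beta> \<le> 0")
    case True
    then have "(\<forall>x. f x = 0) \<or> (\<forall>x. g x = 0)" using f\<alpha> g\<beta> nn by (meson antisym order_trans)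
    then show ?thesis by auto
  next
    case False
    then have \<alpha>: "0 < \<alpha>" and \<beta>: "0 < \<beta>" by auto
    define c where "c = sqrt (\<alpha> * \<beta>)"
    have c: "0 < c" using \<alpha> \<beta> by (simp add: c_def)
    have lev: "emeasure lborel {x. \<alpha> * s < f x} + emeasure lborel {x. \<beta> * s < g x} \<le> 2 * emeasure lborel {x. c * s < h x}"
      if s: "0 < s" "s < 1" for s
    proof (rule midpoint_brunn_minkowski)
      have "\<alpha> * s < \<alpha>" "\<beta> * s < \<beta>" using \<alpha> \<beta> s by auto
      then show "{x. \<alpha> * s < f x} \<noteq> {}" "{x. \<beta> * s < g x} \<noteq> {}"
        unfolding \<alpha>_def \<beta>_def using less_cSUP_iff[OF _ ba(1)] less_cSUP_iff[OF _ ba(2)] by auto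
      have pos: "0 < \<alpha> * s" "0 < \<beta> * s" using \<alpha> \<beta> s by auto
      have "x \<in> {-M..M}" if "\<alpha> * s < f x \<or> \<beta> * s < g x" for x
        using supp[of x] pos that by (cases "M < \<bar>x\<bar>") auto
      then have "{x. \<alpha> * s < f x} \<subseteq> {-M..M}" "{x. \<beta> * s < g x} \<subseteq> {-M..M}" by blast+
      then show "bounded {x. \<alpha> * s < f x}" "bounded {x. \<beta> * s < g x}"
        by (blast intro: bounded_subset[OF bounded_closed_interval])+
      fix a b assume "a \<in> {x. \<alpha> * s < f x}" "b \<in> {x. \<beta> * s < g x}"
      then have "(\<alpha> * s) * (\<beta> * s) < f a * g b" using \<alpha> \<beta> s by (intro mult_strict_mono) (auto intro: order_less_trans[rotated] mult_pos_pos nn)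
      also have "\<dots> \<le> (h ((a + b) / 2))\<^sup>2" by (rule le)
      finally have "(c * s)\<^sup>2 < (h ((a + b) / 2))\<^sup>2" using \<alpha> \<beta> by (simp add: c_def power_mult_distrib power2_eq_square mult_ac)
      then show "(a + b) / 2 \<in> {x. c * s < h x}" using nn(3) by (auto intro: power_less_imp_less_base)
    qed auto
    have "(\<integral>\<^sup>+ x. ennreal (f x / \<alpha>) \<partial>lborel) + (\<integral>\<^sup>+ x. ennreal (g x / \<beta>) \<partial>lborel)
      = (\<integral>\<^sup>+ s. indicator {0<..<1} s * emeasure lborel {x. \<alpha> * s < f x} \<partial>lborel) + (\<integral>\<^sup>+ s. indicator {0<..<1} s * emeasure lborel {x. \<beta> * s < g x} \<partial>lborel)"
      using layer_cake_bounded(1)[OF m(1) \<alpha> nn(1) f\<alpha>] layer_cake_bounded(1)[OF m(2) \<beta> nn(2) g\<beta>] by simp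
    also have "\<dots> = (\<integral>\<^sup>+ s. indicator {0<..<1} s * emeasure lborel {x. \<alpha> * s < f x} + indicator {0<..<1} s * emeasure lborel {x. \<beta> * s < g x} \<partial>lborel)"
      by (rule nn_integral_add[symmetric]) measurable
    also have "\<dots> \<le> (\<integral>\<^sup>+ s. 2 * (indicator {0<..<1} s * emeasure lborel {x. c * s < h x}) \<partial>lborel)"
      using lev by (intro nn_integral_mono) (auto simp: indicator_def)
    also have "\<dots> = 2 * (\<integral>\<^sup>+ s. indicator {0<..<1} s * emeasure lborel {x. c * s < h x} \<partial>lborel)"
      by (rule nn_integral_cmult) measurable
    also have "\<dots> \<le> 2 * (\<integral>\<^sup>+ x. ennreal (h x / c) \<partial>lborel)"
      by (intro mult_left_mono layer_cake_bounded(2) c m nn) auto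
    also have "(\<integral>\<^sup>+ x. ennreal (h x / c) \<partial>lborel) = (\<integral>\<^sup>+ x. ennreal (h x) * ennreal (1 / c) \<partial>lborel)"
      using c nn by (intro nn_integral_cong) (simp add: ennreal_mult[symmetric])
    also have "\<dots> = ennreal (1 / c)" by (subst nn_integral_multc) (auto simp: h1)
    finally have main: "(\<integral>\<^sup>+ x. ennreal (f x / \<alpha>) \<partial>lborel) + (\<integral>\<^sup>+ x. ennreal (g x / \<beta>) \<partial>lborel) \<le> 2 * ennreal (1 / c)" .
    have sc: "(\<integral>\<^sup>+ x. ennreal (q x) \<partial>lborel) = ennreal t * (\<integral>\<^sup>+ x. ennreal (q x / t) \<partial>lborel)"
      if "0 < t" "q \<in> borel_measurable borel" "\<And>x. 0 \<le> q x" for t :: real and q :: "real \<Rightarrow> real"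
    proof -
      have "ennreal t * (\<integral>\<^sup>+ x. ennreal (q x / t) \<partial>lborel) = (\<integral>\<^sup>+ x. ennreal t * ennreal (q x / t) \<partial>lborel)"
        using that by (intro nn_integral_cmult[symmetric]) auto
      also have "\<dots> = (\<integral>\<^sup>+ x. ennreal (q x) \<partial>lborel)"
        using that by (intro nn_integral_cong) (simp add: ennreal_mult[symmetric])
      finally show ?thesis by simp
    qed
    define F where "F = (\<integral>\<^sup>+ x. ennreal (f x / \<alpha>) \<partial>lborel)"
    define G where "G = (\<integral>\<^sup>+ x. ennreal (g x / \<beta>) \<partial>lborel)"
    have FG: "F + G \<le> 2 * ennreal (1 / c)" using main by (simp add: F_def G_def)
    also have "\<dots> < \<top>" by (simp add: ennreal_mult_less_top)
    finally have fin: "F < \<top>" "G < \<top>" by (auto simp: less_top[symmetric])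
    then obtain F' G' where F': "F = ennreal F'" "0 \<le> F'" and G': "G = ennreal G'" "0 \<le> G'"
      by (metis ennreal_cases less_irrefl infinity_ennreal_def)
    have "2 * ennreal (1 / c) = ennreal (2 * (1 / c))" using c by (subst ennreal_mult) auto
    then have "ennreal (F' + G') \<le> ennreal (2 * (1 / c))"
      using FG unfolding F'(1) G'(1) using F'(2) G'(2) by simp
    then have "F' + G' \<le> 2 / c" using c by (subst (asm) ennreal_le_iff) auto
    then have "(F' + G')\<^sup>2 \<le> (2 / c)\<^sup>2" using F' G' by (intro power_mono) auto
    then have "4 * (F' * G') \<le> 4 / (\<alpha> * \<beta>)"
      using zero_le_power2[of "F' - G'"] \<alpha> \<beta> by (simp add: c_def power_divide power2_eq_square algebra_simps)
    then have "\<alpha> * \<beta> * (F' * G') \<le> 1" using \<alpha> \<beta> by (simp add: field_simps)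
    then have "ennreal (\<alpha> * \<beta> * (F' * G')) \<le> ennreal 1" by (rule ennreal_leI)
    moreover have "(\<integral>\<^sup>+ x. f x \<partial>lborel) * (\<integral>\<^sup>+ x. g x \<partial>lborel) = ennreal (\<alpha> * \<beta> * (F' * G'))"
      using sc[OF \<alpha> m(1) nn(1)] sc[OF \<beta> m(2) nn(2)] F' G' \<alpha> \<beta> unfolding F_def[symmetric] G_def[symmetric]
      by (simp add: ennreal_mult[symmetric] mult_ac)
    ultimately show ?thesis by simp
  qed
qed

text \<open>Maurey's property (\<tau>), with the infimal convolution eliminated.\<close>

definition tau_property :: "'a measure \<Rightarrow> ('a \<Rightarrow> 'a \<Rightarrow> real) \<Rightarrow> bool" where
  "tau_property M w \<longleftrightarrow> (\<forall>(u::'a \<Rightarrow> real) v B. u \<in> borel_measurable M \<longrightarrow> v \<in> borel_measurable M \<longrightarrow>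
     (\<forall>x\<in>space M. 0 \<le> u x \<and> u x \<le> B \<and> 0 \<le> v x \<and> v x \<le> B) \<longrightarrow>
     (\<forall>x\<in>space M. \<forall>y\<in>space M. u x * v y \<le> exp (w x y)) \<longrightarrow>
     (\<integral>\<^sup>+ x. u x \<partial>M) * (\<integral>\<^sup>+ x. v x \<partial>M) \<le> 1)"

lemma tau_propertyD:
  assumes "tau_property M w" "u \<in> borel_measurable M" "v \<in> borel_measurable M"
    "\<And>x. x \<in> space M \<Longrightarrow> 0 \<le> u x" "\<And>x. x \<in> space M \<Longrightarrow> u x \<le> (B::real)"
    "\<And>x. x \<in> space M \<Longrightarrow> 0 \<le> v x" "\<And>x. x \<in> space M \<Longrightarrow> v x \<le> B"
    "\<And>x y. x \<in> space M \<Longrightarrow> y \<in> space M \<Longrightarrow> u x * v y \<le> exp (w x y)"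
  shows "(\<integral>\<^sup>+ x. ennreal (u x) \<partial>M) * (\<integral>\<^sup>+ x. ennreal (v x) \<partial>M) \<le> 1"
  using assms unfolding tau_property_def by (metis (no_types, lifting))

lemma tau_property_distr:
  assumes tau: "tau_property M w" and T: "T \<in> M \<rightarrow>\<^sub>M N"
    and w: "\<And>x y. x \<in> space M \<Longrightarrow> y \<in> space M \<Longrightarrow> w' (T x) (T y) \<le> w x y"
  shows "tau_property (distr M N T) w'"
  unfolding tau_property_def
proof (intro allI impI)
  fix u v :: "_ \<Rightarrow> real" and B
  assume m: "u \<in> borel_measurable (distr M N T)" "v \<in> borel_measurable (distr M N T)"
    and b: "\<forall>x\<in>space (distr M N T). 0 \<le> u x \<and> u x \<le> B \<and> 0 \<le> v x \<and> v x \<le> B"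
    and uv: "\<forall>x\<in>space (distr M N T). \<forall>y\<in>space (distr M N T). u x * v y \<le> exp (w' x y)"
  have mN: "u \<in> borel_measurable N" "v \<in> borel_measurable N" using m by simp_all
  have sp: "T x \<in> space N" if "x \<in> space M" for x using measurable_space[OF T that] .
  have "(\<integral>\<^sup>+ x. ennreal (u (T x)) \<partial>M) * (\<integral>\<^sup>+ x. ennreal (v (T x)) \<partial>M) \<le> 1"
  proof (rule tau_propertyD[OF tau measurable_compose[OF T mN(1)] measurable_compose[OF T mN(2)], where B = B])
    fix x y assume xy: "x \<in> space M" "y \<in> space M"
    have "u (T x) * v (T y) \<le> exp (w' (T x) (T y))" using uv sp xy by simp
    also have "\<dots> \<le> exp (w x y)" using w xy by simp
    finally show "u (T x) * v (T y) \<le> exp (w x y)" .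
  qed (use b sp in auto)
  then show "(\<integral>\<^sup>+ x. ennreal (u x) \<partial>distr M N T) * (\<integral>\<^sup>+ x. ennreal (v x) \<partial>distr M N T) \<le> 1"
    using T mN by (simp add: nn_integral_distr)
qed

text \<open>Tensorisation: for frozen first coordinates \<open>x\<close> and \<open>x'\<close> the
  property of \<open>N\<close> is applied to the sections, with the constant
  \<open>exp (- wM x x')\<close> absorbed into the first function. The outcome is the hypothesis of
  the property of \<open>M\<close> for the partial integrals \<open>U\<close> and
  \<open>V\<close>.\<close>

lemma tau_property_pair:
  assumes M: "prob_space M" and N: "prob_space N" and tM: "tau_property M wM" and tN: "tau_property N wN"
  shows "tau_property (M \<Otimes>\<^sub>M N) (\<lambda>p q. wM (fst p) (fst q) + wN (snd p) (snd q))"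
  unfolding tau_property_def
proof (intro allI impI)
  fix u v :: "_ \<Rightarrow> real" and B
  assume m [measurable]: "u \<in> borel_measurable (M \<Otimes>\<^sub>M N)" "v \<in> borel_measurable (M \<Otimes>\<^sub>M N)"
    and b: "\<forall>x\<in>space (M \<Otimes>\<^sub>M N). 0 \<le> u x \<and> u x \<le> B \<and> 0 \<le> v x \<and> v x \<le> B"
    and uv: "\<forall>x\<in>space (M \<Otimes>\<^sub>M N). \<forall>y\<in>space (M \<Otimes>\<^sub>M N). u x * v y \<le> exp (wM (fst x) (fst y) + wN (snd x) (snd y))"
  interpret M: prob_space M by fact
  interpret N: prob_space N by fact
  have sp: "(x, y) \<in> space (M \<Otimes>\<^sub>M N)" if "x \<in> space M" "y \<in> space N" for x y
    using that by (simp add: space_pair_measure)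
  define U where "U x = enn2real (\<integral>\<^sup>+ y. u (x, y) \<partial>N)" for x
  define V where "V x = enn2real (\<integral>\<^sup>+ y. v (x, y) \<partial>N)" for x
  have le: "(\<integral>\<^sup>+ y. u (x, y) \<partial>N) \<le> ennreal B" "(\<integral>\<^sup>+ y. v (x, y) \<partial>N) \<le> ennreal B" if "x \<in> space M" for x
  proof -
    have "(\<integral>\<^sup>+ y. u (x, y) \<partial>N) \<le> (\<integral>\<^sup>+ y. ennreal B \<partial>N)" "(\<integral>\<^sup>+ y. v (x, y) \<partial>N) \<le> (\<integral>\<^sup>+ y. ennreal B \<partial>N)"
      by (intro nn_integral_mono ennreal_leI; use b sp[OF that] in simp)+
    then show "(\<integral>\<^sup>+ y. u (x, y) \<partial>N) \<le> ennreal B" "(\<integral>\<^sup>+ y. v (x, y) \<partial>N) \<le> ennreal B" by (simp_all add: N.emeasure_space_1)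
  qed
  have B0: "0 \<le> B"
  proof -
    obtain x y where "x \<in> space M" "y \<in> space N" using M.not_empty N.not_empty by auto
    then show ?thesis using b sp[of x y] by (meson order_trans)
  qed
  have UV: "ennreal (U x) = (\<integral>\<^sup>+ y. u (x, y) \<partial>N)" "ennreal (V x) = (\<integral>\<^sup>+ y. v (x, y) \<partial>N)" if "x \<in> space M" for x
    unfolding U_def V_def using le[OF that] by (auto intro!: ennreal_enn2real order_le_less_trans[OF _ ennreal_less_top])
  have Um: "U \<in> borel_measurable M" "V \<in> borel_measurable M" unfolding U_def V_def
    by (auto intro!: borel_measurable_enn2real N.borel_measurable_nn_integral simp: case_prod_beta')
  have "(\<integral>\<^sup>+ x. ennreal (U x) \<partial>M) * (\<integral>\<^sup>+ x. ennreal (V x) \<partial>M) \<le> 1"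
  proof (rule tau_propertyD[OF tM Um, where B = B])
    fix x assume x: "x \<in> space M"
    show "0 \<le> U x" "0 \<le> V x" by (auto simp: U_def V_def)
    show "U x \<le> B" "V x \<le> B" using le[OF x] B0 by (auto simp: U_def V_def intro!: enn2real_leI)
  next
    fix x x' assume x: "x \<in> space M" "x' \<in> space M"
    let ?W = "wM x x'"
    have [measurable]: "(\<lambda>y. u (x, y)) \<in> borel_measurable N" "(\<lambda>y. v (x', y)) \<in> borel_measurable N"
      using x by (auto intro!: measurable_compose[OF measurable_Pair1' m(1)] measurable_compose[OF measurable_Pair1' m(2)])
    have "(\<integral>\<^sup>+ y. ennreal (exp (-?W) * u (x, y)) \<partial>N) * (\<integral>\<^sup>+ y. ennreal (v (x', y)) \<partial>N) \<le> 1"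
    \<comment> \<open>\<open>wM\<close> may be negative, so the absorbed factor may exceed 1 and the
      common bound has to cover both functions.\<close>
    proof (rule tau_propertyD[OF tN, where B = "max B (exp (-?W) * B)"])
      fix y assume y: "y \<in> space N"
      show "0 \<le> exp (-?W) * u (x, y)" "0 \<le> v (x', y)" using b sp x y by auto
      have "exp (-?W) * u (x, y) \<le> exp (-?W) * B" using b sp x y by (intro mult_left_mono) auto
      then show "exp (-?W) * u (x, y) \<le> max B (exp (-?W) * B)" by (rule max.coboundedI2)
      have "v (x', y) \<le> B" using b sp x y by auto
      then show "v (x', y) \<le> max B (exp (-?W) * B)" by simp
      fix y' assume y': "y' \<in> space N"
      have "u (x, y) * v (x', y') \<le> exp (?W + wN y y')" using uv sp[OF x(1) y] sp[OF x(2) y'] by fastforce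
      then have "exp (-?W) * (u (x, y) * v (x', y')) \<le> exp (-?W) * exp (?W + wN y y')" by (intro mult_left_mono) auto
      then show "exp (-?W) * u (x, y) * v (x', y') \<le> exp (wN y y')" by (simp add: exp_add[symmetric] mult.assoc)
    qed measurable
    also have "(\<integral>\<^sup>+ y. ennreal (exp (-?W) * u (x, y)) \<partial>N) = (\<integral>\<^sup>+ y. ennreal (exp (-?W)) * ennreal (u (x, y)) \<partial>N)"
      using b sp x by (intro nn_integral_cong ennreal_mult) auto
    also have "\<dots> = ennreal (exp (-?W)) * ennreal (U x)" unfolding UV(1)[OF x(1)] by (rule nn_integral_cmult) measurable
    also have "ennreal (exp (-?W)) * ennreal (U x) * (\<integral>\<^sup>+ y. ennreal (v (x', y)) \<partial>N) = ennreal (exp (-?W) * U x * V x')"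
    proof -
      have "0 \<le> U x" "0 \<le> V x'" by (simp_all add: U_def V_def)
      then show ?thesis unfolding UV(2)[OF x(2), symmetric] by (simp add: ennreal_mult)
    qed
    finally have "exp (-?W) * U x * V x' \<le> 1" by simp
    then show "U x * V x' \<le> exp ?W" by (simp add: exp_minus field_simps)
  qed
  also have "(\<integral>\<^sup>+ x. ennreal (U x) \<partial>M) = (\<integral>\<^sup>+ p. ennreal (u p) \<partial>(M \<Otimes>\<^sub>M N))"
    by (subst N.nn_integral_fst[symmetric]) (auto simp: UV intro!: nn_integral_cong)
  also have "(\<integral>\<^sup>+ x. ennreal (V x) \<partial>M) = (\<integral>\<^sup>+ p. ennreal (v p) \<partial>(M \<Otimes>\<^sub>M N))"
    by (subst N.nn_integral_fst[symmetric]) (auto simp: UV intro!: nn_integral_cong)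
  finally show "(\<integral>\<^sup>+ p. ennreal (u p) \<partial>(M \<Otimes>\<^sub>M N)) * (\<integral>\<^sup>+ p. ennreal (v p) \<partial>(M \<Otimes>\<^sub>M N)) \<le> 1" .
qed

lemma tau_property_PiM:
  assumes "finite I" and M: "prob_space M" and tM: "tau_property M w"
  shows "tau_property (PiM I (\<lambda>_. M)) (\<lambda>x y. \<Sum>i\<in>I. w (x i) (y i))"
  using assms(1)
proof (induction I)
  case empty
  have "tau_property (PiM {} (\<lambda>_. M)) (\<lambda>x y. 0)"
    unfolding tau_property_def
    by (auto simp: PiM_empty nn_integral_count_space_finite ennreal_mult[symmetric])
  then show ?case by simp
next
  case (insert i I)
  have "tau_property (distr (M \<Otimes>\<^sub>M PiM I (\<lambda>_. M)) (PiM (insert i I) (\<lambda>_. M)) (\<lambda>(x, X). X(i := x))) (\<lambda>x y. \<Sum>i\<in>insert i I. w (x i) (y i))"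
  proof (rule tau_property_distr[OF tau_property_pair[OF M prob_space_PiM tM insert.IH]])
    show "(\<lambda>(x, X). X(i := x)) \<in> M \<Otimes>\<^sub>M PiM I (\<lambda>_. M) \<rightarrow>\<^sub>M PiM (insert i I) (\<lambda>_. M)"
      by (simp add: case_prod_beta')
    fix x y
    have "(\<Sum>j\<in>I. w (((snd x)(i := fst x)) j) (((snd y)(i := fst y)) j)) = (\<Sum>j\<in>I. w (snd x j) (snd y j))"
      using insert.hyps by (intro sum.cong) auto
    then show "(\<Sum>j\<in>insert i I. w ((case x of (x, X) \<Rightarrow> X(i := x)) j) ((case y of (x, X) \<Rightarrow> X(i := x)) j))
      \<le> w (fst x) (fst y) + (\<Sum>j\<in>I. w (snd x j) (snd y j))"
      using insert.hyps by (simp add: case_prod_beta)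
  qed (rule M)
  then show ?case using M insert.hyps by (subst (asm) distr_pair_PiM_eq_PiM) auto
qed

text \<open>With \<open>X\<close> and \<open>Y\<close> as in the proof, the product of the cosines
  is \<open>X - Y\<close> and the squared distance is \<open>X * Y\<close>. The log-concavity of the
  cosine gains a factor \<open>exp (- (Y / X))\<close>, which outweighs the loss
  \<open>exp (X * Y)\<close> because \<open>X \<le> 1\<close>.\<close>

lemma cos_prod_le:
  fixes s r :: real
  defines "m \<equiv> (s + r) / 2" and "e \<equiv> (s - r) / 2"
  shows "exp ((sin s / 2 - sin r / 2)\<^sup>2) * (cos s * cos r) \<le> (cos m)\<^sup>2"
proof -
  have sr: "s = m + e" "r = m - e" by (auto simp: m_def e_def field_simps)
  define X where "X = (cos m)\<^sup>2"
  define Y where "Y = (sin e)\<^sup>2"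
  have X: "0 \<le> X" "X \<le> 1" by (auto simp: X_def abs_square_le_1)
  have Y: "0 \<le> Y" by (simp add: Y_def)
  have d: "(sin s / 2 - sin r / 2)\<^sup>2 = X * Y"
  proof -
    have "sin s / 2 - sin r / 2 = cos m * sin e" unfolding sr by (simp add: sin_add sin_diff field_simps)
    then show ?thesis by (simp add: X_def Y_def power_mult_distrib)
  qed
  have c: "cos s * cos r = X - Y"
  proof -
    have "cos s * cos r = (cos m * cos e)\<^sup>2 - (sin m * sin e)\<^sup>2"
      unfolding sr by (simp add: cos_add cos_diff power2_eq_square algebra_simps)
    also have "\<dots> = X * (1 - Y) - (1 - X) * Y"
      unfolding X_def Y_def power_mult_distrib by (simp add: cos_squared_eq)
    finally show ?thesis by (simp add: algebra_simps)
  qed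
  show ?thesis
  proof (cases "X = 0")
    case True
    then show ?thesis unfolding d c using Y X_def by simp
  next
    case False
    then have X0: "0 < X" using X by simp
    have "X * Y \<le> Y / X"
    proof -
      have "X * X \<le> 1" using X by (simp add: mult_le_one)
      then have "Y * (X * X) \<le> Y * 1" using Y by (intro mult_left_mono)
      then show ?thesis using X0 by (simp add: pos_le_divide_eq mult_ac)
    qed
    have "X - Y = X * (1 + (- (Y / X)))" using X0 by (simp add: field_simps)
    also have "\<dots> \<le> X * exp (- (Y / X))" using X by (intro mult_left_mono exp_ge_add_one_self) auto
    also have "\<dots> \<le> X * exp (- (X * Y))" using X \<open>X * Y \<le> Y / X\<close> by (intro mult_left_mono) auto
    finally have "exp (X * Y) * (X - Y) \<le> exp (X * Y) * (X * exp (- (X * Y)))" by (intro mult_left_mono) auto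
    then show ?thesis unfolding d c by (simp add: X_def exp_minus field_simps)
  qed
qed

text \<open>The substitution \<open>x = (1 + sin s) / 2\<close> turns the uniform law into the density \<open>cos s / 2\<close>,
  which is concave enough for the Prekopa-Leindler inequality to apply.\<close>

lemma tau_property_unif_int: "tau_property unif_int (\<lambda>x y. (x - y)\<^sup>2)"
  unfolding tau_property_def
proof (intro allI impI)
  fix u v :: "real \<Rightarrow> real" and B
  assume "u \<in> borel_measurable unif_int" "v \<in> borel_measurable unif_int"
  then have m [measurable]: "u \<in> borel_measurable borel" "v \<in> borel_measurable borel" by simp_all
  assume "\<forall>x\<in>space unif_int. 0 \<le> u x \<and> u x \<le> B \<and> 0 \<le> v x \<and> v x \<le> B"
  then have b: "0 \<le> u x" "u x \<le> B" "0 \<le> v x" "v x \<le> B" for x by auto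
  have B0: "0 \<le> B" using b[of 0] by simp
  assume "\<forall>x\<in>space unif_int. \<forall>y\<in>space unif_int. u x * v y \<le> exp ((x - y)\<^sup>2)"
  then have uv: "u x * v y \<le> exp ((x - y)\<^sup>2)" for x y by simp
  let ?I = "{- (pi/2)..pi/2}"
  define T where "T s = (1 + sin s) / 2" for s :: real
  define k where "k s = indicator ?I s * (cos s / 2)" for s :: real
  have k: "0 \<le> k s" "k s \<le> 1" for s using cos_ge_zero[of s] by (auto simp: k_def indicator_def intro: order_trans[OF cos_le_one])
  have [measurable]: "T \<in> borel_measurable borel" "k \<in> borel_measurable borel"
    unfolding T_def[abs_def] k_def[abs_def] by (auto intro!: borel_measurable_continuous_onI continuous_intros borel_measurable_times borel_measurable_divide)
  have subst: "(\<integral>\<^sup>+ x. ennreal (q x) \<partial>unif_int) = (\<integral>\<^sup>+ s. ennreal (q (T s) * k s) \<partial>lborel)"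
    if [measurable]: "q \<in> borel_measurable borel" and q: "\<And>x. 0 \<le> q x" for q
  proof -
    have "(\<integral>\<^sup>+ x. ennreal (q x) \<partial>unif_int) = (\<integral>\<^sup>+ x. ennreal (q x) * indicator {T (- (pi/2))..T (pi/2)} x \<partial>lborel)"
      by (subst nn_integral_unif_int) (auto simp: T_def)
    also have "\<dots> = (\<integral>\<^sup>+ s. ennreal (q (T s)) * ennreal (cos s / 2) * indicator ?I s \<partial>lborel)"
    proof (rule nn_integral_substitution_aux)
      show "(T has_real_derivative cos x / 2) (at x)" for x
        unfolding T_def[abs_def] by (auto intro!: derivative_eq_intros)
      show "continuous_on ?I (\<lambda>s. cos s / 2)" by (intro continuous_intros) auto
    qed (auto intro: cos_ge_zero)
    also have "\<dots> = (\<integral>\<^sup>+ s. ennreal (q (T s) * k s) \<partial>lborel)"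
      by (intro nn_integral_cong) (auto simp: k_def indicator_def ennreal_mult[symmetric] q cos_ge_zero)
    finally show ?thesis .
  qed
  have "(\<integral>\<^sup>+ s. ennreal (u (T s) * k s) \<partial>lborel) * (\<integral>\<^sup>+ s. ennreal (v (T s) * k s) \<partial>lborel) \<le> 1"
  proof (rule prekopa_leindler_1d[where h = k and K = B and M = "pi/2"])
    show "(\<integral>\<^sup>+ x. ennreal (k x) \<partial>lborel) = 1"
      using subst[of "\<lambda>_. 1"] prob_space.emeasure_space_1[OF prob_space_unif_int] by simp
    show "u (T x) * k x \<le> B" "v (T x) * k x \<le> B" for x
      using b[of "T x"] k[of x] B0 mult_mono[of "u (T x)" B "k x" 1] mult_mono[of "v (T x)" B "k x" 1] by auto
    show "u (T x) * k x = 0" "v (T x) * k x = 0" if "pi / 2 < \<bar>x\<bar>" for x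
      using that by (auto simp: k_def indicator_def)
    show "u (T s) * k s * (v (T r) * k r) \<le> (k ((s + r) / 2))\<^sup>2" for s r
    proof (cases "s \<in> ?I \<and> r \<in> ?I")
      case True
      then have mi: "(s + r) / 2 \<in> ?I" by auto
      have "0 \<le> cos s * cos r" using True by (auto intro!: mult_nonneg_nonneg cos_ge_zero)
      then have "u (T s) * v (T r) * (cos s * cos r) \<le> exp ((T s - T r)\<^sup>2) * (cos s * cos r)"
        by (intro mult_right_mono uv)
      also have "T s - T r = sin s / 2 - sin r / 2" by (simp add: T_def field_simps)
      also have "exp ((sin s / 2 - sin r / 2)\<^sup>2) * (cos s * cos r) \<le> (cos ((s + r) / 2))\<^sup>2" by (rule cos_prod_le)
      finally show ?thesis using True mi by (simp add: k_def power2_eq_square mult_ac)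
    next
      case False
      then show ?thesis by (auto simp: k_def indicator_def)
    qed
  qed (use b k in auto)
  then show "(\<integral>\<^sup>+ x. ennreal (u x) \<partial>unif_int) * (\<integral>\<^sup>+ x. ennreal (v x) \<partial>unif_int) \<le> 1"
    using subst[OF m(1) b(1)] subst[OF m(2) b(3)] by simp
qed

lemma tau_property_unif_cube: "tau_property (unif_cube :: (real^'n) measure) (\<lambda>x y. (norm (x - y))\<^sup>2)"
proof -
  let ?P = "PiM (UNIV :: 'n set) (\<lambda>_. unif_int)"
  have m: "(\<lambda>f. \<chi> i. f i) \<in> ?P \<rightarrow>\<^sub>M (borel :: (real^'n) measure)" by (rule measurable_vec_lambda_PiM) simp
  have "tau_property (distr ?P borel (\<lambda>f. \<chi> i. f i)) (\<lambda>x y :: real^'n. (norm (x - y))\<^sup>2)"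
    by (rule tau_property_distr[OF tau_property_PiM[OF finite prob_space_unif_int tau_property_unif_int] m])
      (simp add: norm_vec_def L2_set_def sum_nonneg)
  also have "distr ?P borel (\<lambda>f. \<chi> i. f i) = (unif_cube :: (real^'n) measure)"
  proof (rule measure_eqI)
    fix A :: "(real^'n) set" assume "A \<in> sets (distr ?P borel (\<lambda>f. \<chi> i. f i))"
    then have [measurable]: "A \<in> sets borel" by simp
    have "emeasure (distr ?P borel (\<lambda>f. \<chi> i. f i)) A = (\<integral>\<^sup>+ x. indicator A x \<partial>distr ?P borel (\<lambda>f. \<chi> i. f i))" by simp
    also have "\<dots> = (\<integral>\<^sup>+ x. indicator A (\<chi> i. x i) \<partial>?P)" by (rule nn_integral_distr[OF m]) simp
    also have "\<dots> = (\<integral>\<^sup>+ x. indicator A x \<partial>(unif_cube :: (real^'n) measure))" by (rule nn_integral_unif_cube_PiM[symmetric]) simp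
    finally show "emeasure (distr ?P borel (\<lambda>f. \<chi> i. f i)) A = emeasure (unif_cube :: (real^'n) measure) A" by simp
  qed simp
  finally show ?thesis .
qed

text \<open>The property is applied to the exponentials of \<open>l * F\<close> and
  \<open>- l * F\<close>; completing the square gives
  \<open>l * L * sqrt w \<le> w + l^2 * L^2 / 4\<close>, which supplies its hypothesis. Jensen
  bounds the second integral from below, and what remains is a bound for an exponential moment of
  \<open>F\<close>, to which Markov's inequality applies.\<close>

lemma tau_property_upper_tail:
  assumes M: "prob_space M" and tau: "tau_property M w" and [measurable]: "F \<in> borel_measurable M"
    and bd: "\<And>x. x \<in> space M \<Longrightarrow> \<bar>F x\<bar> \<le> B" and L: "0 < L" and r: "0 < r"
    and lip: "\<And>x y. x \<in> space M \<Longrightarrow> y \<in> space M \<Longrightarrow> 0 \<le> w x y \<and> F x - F y \<le> L * sqrt (w x y)"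
  shows "measure M {x\<in>space M. r \<le> F x - (\<integral>x. F x \<partial>M)} \<le> exp (- (r\<^sup>2 / L\<^sup>2))"
proof -
  interpret prob_space M by fact
  define a where "a = (\<integral>x. F x \<partial>M)"
  \<comment> \<open>This value minimises the final exponent
    \<open>l^2 * L^2 / 4 - l * r\<close>.\<close>
  define l where "l = 2 * r / L\<^sup>2"
  have l: "0 < l" using L r by (simp add: l_def)
  have B0: "0 \<le> B" using bd not_empty by fastforce
  have intF: "integrable M F" by (rule integrable_const_bound[of _ B]) (auto intro!: AE_I2 bd)
  have ei: "integrable M (\<lambda>x. exp (c * F x))" for c
  proof (rule integrable_const_bound[of _ "exp (\<bar>c\<bar> * B)"])
    show "AE x in M. norm (exp (c * F x)) \<le> exp (\<bar>c\<bar> * B)"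
    proof (rule AE_I2)
      fix x assume "x \<in> space M"
      then have "\<bar>c * F x\<bar> \<le> \<bar>c\<bar> * B" using bd by (simp add: abs_mult mult_left_mono)
      then show "norm (exp (c * F x)) \<le> exp (\<bar>c\<bar> * B)" by simp
    qed
  qed measurable
  define P where "P = (\<integral>x. exp (l * F x) \<partial>M)"
  define Q where "Q = (\<integral>x. exp (- l * F x) \<partial>M)"
  have PQ: "exp (- (l\<^sup>2 * L\<^sup>2 / 4)) * P * Q \<le> 1"
  proof -
    have "(\<integral>\<^sup>+ x. ennreal (exp (- (l\<^sup>2 * L\<^sup>2 / 4)) * exp (l * F x)) \<partial>M) * (\<integral>\<^sup>+ x. ennreal (exp (- l * F x)) \<partial>M) \<le> 1"
    proof (rule tau_propertyD[OF tau, where B = "exp (l * B)"])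
      fix x assume x: "x \<in> space M"
      have "exp (- (l\<^sup>2 * L\<^sup>2 / 4)) * exp (l * F x) \<le> 1 * exp (l * B)"
        using bd[OF x] l by (intro mult_mono) auto
      then show "exp (- (l\<^sup>2 * L\<^sup>2 / 4)) * exp (l * F x) \<le> exp (l * B)" by simp
      have "- l * F x \<le> l * B" using bd[OF x] l mult_left_mono[of "- F x" B l] by auto
      then show "exp (- l * F x) \<le> exp (l * B)" by simp
      fix y assume y: "y \<in> space M"
      have "l * (F x - F y) \<le> l * (L * sqrt (w x y))" using lip[OF x y] l by (intro mult_left_mono) auto
      also have "\<dots> \<le> w x y + l\<^sup>2 * L\<^sup>2 / 4"
        using lip[OF x y] zero_le_power2[of "sqrt (w x y) - l * L / 2"] by (simp add: power2_eq_square algebra_simps)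
      finally have "- (l\<^sup>2 * L\<^sup>2 / 4) + l * F x + - l * F y \<le> w x y" by (simp add: algebra_simps)
      then show "exp (- (l\<^sup>2 * L\<^sup>2 / 4)) * exp (l * F x) * exp (- l * F y) \<le> exp (w x y)"
        by (simp add: exp_add[symmetric])
    qed auto
    also have "(\<integral>\<^sup>+ x. ennreal (exp (- (l\<^sup>2 * L\<^sup>2 / 4)) * exp (l * F x)) \<partial>M) = ennreal (exp (- (l\<^sup>2 * L\<^sup>2 / 4)) * P)"
      unfolding P_def using ei[of l] by (subst nn_integral_eq_integral) (auto simp: integral_mult_right)
    also have "(\<integral>\<^sup>+ x. ennreal (exp (- l * F x)) \<partial>M) = ennreal Q"
      unfolding Q_def using ei[of "-l"] by (intro nn_integral_eq_integral) auto
    finally show ?thesis by (simp add: P_def Q_def ennreal_mult[symmetric] Bochner_Integration.integral_nonneg)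
  qed
  \<comment> \<open>Jensen's inequality, by integrating the tangent line of the exponential at the
    mean.\<close>
  have "exp (- l * a) \<le> Q"
  proof -
    have "(\<integral>x. exp (- l * a) * (1 - l * (F x - a)) \<partial>M) \<le> (\<integral>x. exp (- l * F x) \<partial>M)"
    proof (rule integral_mono)
      fix x
      have "exp (- l * a) * (1 + (- l * (F x - a))) \<le> exp (- l * a) * exp (- l * (F x - a))"
        by (intro mult_left_mono exp_ge_add_one_self) auto
      also have "\<dots> = exp (- l * F x)" by (simp add: exp_add[symmetric] algebra_simps)
      finally show "exp (- l * a) * (1 - l * (F x - a)) \<le> exp (- l * F x)" by simp
    qed (use intF ei[of "-l"] in auto)
    also have "(\<integral>x. exp (- l * a) * (1 - l * (F x - a)) \<partial>M) = exp (- l * a)"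
      using intF by (simp add: a_def prob_space)
    finally show ?thesis by (simp add: Q_def)
  qed
  have P0: "0 \<le> P" unfolding P_def by (intro Bochner_Integration.integral_nonneg) auto
  have "exp (- (l\<^sup>2 * L\<^sup>2 / 4)) * P * exp (- l * a) \<le> exp (- (l\<^sup>2 * L\<^sup>2 / 4)) * P * Q"
    using \<open>exp (- l * a) \<le> Q\<close> P0 by (intro mult_left_mono) auto
  then have PP: "exp (- (l\<^sup>2 * L\<^sup>2 / 4)) * P * exp (- l * a) \<le> 1" using PQ by linarith
  have mk: "measure M {x\<in>space M. exp (l * (a + r)) \<le> exp (l * F x)} \<le> P / exp (l * (a + r))"
    unfolding P_def using ei[of l] by (intro integral_Markov_inequality_measure[where A = "{}"]) auto
  have "{x\<in>space M. r \<le> F x - a} = {x\<in>space M. exp (l * (a + r)) \<le> exp (l * F x)}"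
    using l by (auto simp: add.commute)
  then have "measure M {x\<in>space M. r \<le> F x - a} \<le> P / exp (l * (a + r))" using mk by simp
  also have "\<dots> = (exp (- (l\<^sup>2 * L\<^sup>2 / 4)) * P * exp (- l * a)) * exp (l\<^sup>2 * L\<^sup>2 / 4 - l * r)"
  proof -
    have "exp (- (l\<^sup>2 * L\<^sup>2 / 4)) * exp (- l * a) * exp (l\<^sup>2 * L\<^sup>2 / 4 - l * r) = exp (- (l * (a + r)))"
      unfolding exp_add[symmetric] by (rule arg_cong[where f = exp]) (simp add: algebra_simps)
    then have "P * exp (- (l * (a + r))) = (exp (- (l\<^sup>2 * L\<^sup>2 / 4)) * P * exp (- l * a)) * exp (l\<^sup>2 * L\<^sup>2 / 4 - l * r)"
      by (metis mult.assoc mult.commute)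
    then show ?thesis by (simp only: exp_minus divide_inverse)
  qed
  also have "\<dots> \<le> 1 * exp (l\<^sup>2 * L\<^sup>2 / 4 - l * r)" using PP by (intro mult_right_mono) auto
  also have "l\<^sup>2 * L\<^sup>2 / 4 - l * r = - (r\<^sup>2 / L\<^sup>2)" using L by (simp add: l_def power2_eq_square field_simps)
  finally show ?thesis by (simp add: a_def)
qed

lemma tau_property_concentration:
  assumes M: "prob_space M" and tau: "tau_property M w" and [measurable]: "F \<in> borel_measurable M"
    and bd: "\<And>x. x \<in> space M \<Longrightarrow> \<bar>F x\<bar> \<le> B" and L: "0 < L" and r: "0 < r"
    and lip: "\<And>x y. x \<in> space M \<Longrightarrow> y \<in> space M \<Longrightarrow> 0 \<le> w x y \<and> \<bar>F x - F y\<bar> \<le> L * sqrt (w x y)"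
  shows "measure M {x\<in>space M. r \<le> \<bar>F x - (\<integral>x. F x \<partial>M)\<bar>} \<le> 2 * exp (- (r\<^sup>2 / L\<^sup>2))"
proof -
  interpret prob_space M by fact
  let ?a = "\<integral>x. F x \<partial>M"
  let ?A = "{x\<in>space M. r \<le> F x - ?a}" and ?B = "{x\<in>space M. r \<le> - F x - (\<integral>x. - F x \<partial>M)}"
  have "measure M ?A \<le> exp (- (r\<^sup>2 / L\<^sup>2))"
  proof (rule tau_property_upper_tail[OF M tau _ bd L r])
    show "0 \<le> w x y \<and> F x - F y \<le> L * sqrt (w x y)" if "x \<in> space M" "y \<in> space M" for x y
      using lip[OF that] by linarith
  qed auto
  moreover have "measure M ?B \<le> exp (- (r\<^sup>2 / L\<^sup>2))"
  proof (rule tau_property_upper_tail[OF M tau _ _ L r])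
    show "\<bar>- F x\<bar> \<le> B" if "x \<in> space M" for x using bd[OF that] by simp
    show "0 \<le> w x y \<and> - F x - - F y \<le> L * sqrt (w x y)" if "x \<in> space M" "y \<in> space M" for x y
      using lip[OF that] by linarith
  qed auto
  moreover have "{x\<in>space M. r \<le> \<bar>F x - ?a\<bar>} = ?A \<union> ?B" using r by auto
  moreover have "measure M (?A \<union> ?B) \<le> measure M ?A + measure M ?B"
    by (rule measure_Un_le) auto
  ultimately show ?thesis by simp
qed

section \<open>The Lipschitz constant of the matching cost and its concentration\<close>

text \<open>For \<open>2 \<le> p\<close> the p-norm is at most the Euclidean norm, with constant 1.
  For \<open>p < 2\<close> Young's inequality replaces Hoelder's and yields the power of the number
  of terms.\<close>

lemma powr_sum_root_le_l2:
  fixes a :: "'i \<Rightarrow> real"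
  assumes I: "finite I" and nn: "\<And>i. i \<in> I \<Longrightarrow> 0 \<le> a i" and p: "1 \<le> p"
  shows "(\<Sum>i\<in>I. a i powr p) powr (1/p) \<le> real (card I) powr max 0 (1/p - 1/2) * sqrt (\<Sum>i\<in>I. (a i)\<^sup>2)"
proof -
  define S where "S = (\<Sum>i\<in>I. (a i)\<^sup>2)"
  have S0: "0 \<le> S" unfolding S_def by (intro sum_nonneg) auto
  show ?thesis
  proof (cases "S = 0")
    case True
    then have "\<forall>i\<in>I. a i = 0" using I by (simp add: S_def sum_nonneg_eq_0_iff)
    then have "(\<Sum>i\<in>I. a i powr p) = 0" using p by (intro sum.neutral) auto
    then show ?thesis using p by (simp add: S_def[symmetric] True)
  next
    case False
    then have S: "0 < S" using S0 by simp
    then have "I \<noteq> {}" by (auto simp: S_def)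
    then have m: "1 \<le> real (card I)" using I by (simp add: Suc_le_eq card_gt_0_iff)
    show ?thesis
    proof (cases "2 \<le> p")
      case True
      have "(\<Sum>i\<in>I. a i powr p) \<le> (\<Sum>i\<in>I. (a i)\<^sup>2 * sqrt S powr (p - 2))"
      proof (rule sum_mono)
        fix i assume i: "i \<in> I"
        have "(a i)\<^sup>2 \<le> S" unfolding S_def using i I by (intro member_le_sum) auto
        then have ai: "a i \<le> sqrt S" by (rule real_le_rsqrt)
        show "a i powr p \<le> (a i)\<^sup>2 * sqrt S powr (p - 2)"
        proof (cases "a i = 0")
          case False
          then have pos: "0 < a i" using nn[OF i] by simp
          then have "a i powr p = (a i)\<^sup>2 * a i powr (p - 2)" by (simp add: powr_diff)
          also have "\<dots> \<le> (a i)\<^sup>2 * sqrt S powr (p - 2)" using True ai pos by (intro mult_left_mono powr_mono2) auto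
          finally show ?thesis .
        qed (use p in simp)
      qed
      also have "\<dots> = sqrt S powr 2 * sqrt S powr (p - 2)" using S by (simp add: sum_distrib_right[symmetric] S_def[symmetric])
      also have "\<dots> = sqrt S powr p" by (simp only: powr_add[symmetric]) simp
      finally have "(\<Sum>i\<in>I. a i powr p) powr (1/p) \<le> (sqrt S powr p) powr (1/p)"
        using p by (intro powr_mono2 sum_nonneg) auto
      also have "\<dots> = sqrt S" using p S by (simp add: powr_powr)
      also have "\<dots> \<le> real (card I) powr max 0 (1/p - 1/2) * sqrt S"
        using ge_one_powr_ge_zero[OF m, of "max 0 (1/p - 1/2)"] S by (simp add: mult_le_cancel_right1)
      finally show ?thesis by (simp add: S_def)
    next
      case False
      define m where "m = real (card I)"
      \<comment> \<open>\<open>R\<close> is the mean square. Against it Young's inequality for the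
        single terms sums up to exactly \<open>S\<close>, without loss.\<close>
      define R where "R = S / m"
      have R: "0 < R" using m S by (simp add: R_def m_def)
      have pt: "a i powr p * R powr (1 - p/2) \<le> p/2 * (a i)\<^sup>2 + (1 - p/2) * R" if i: "i \<in> I" for i
      proof (cases "a i = 0")
        case True
        then show ?thesis using False R p by simp
      next
        case nz: False
        then have pos: "0 < a i" using nn[OF i] by simp
        have "((a i)\<^sup>2) powr (p/2) * R powr (1 - p/2) \<le> p/2 * (a i)\<^sup>2 + (1 - p/2) * R"
          using False p pos R by (intro Youngs_inequality_0) auto
        moreover have "((a i)\<^sup>2) powr (p/2) = a i powr p"
        proof -
          have "(a i)\<^sup>2 = a i powr 2" using pos by simp
          then have "((a i)\<^sup>2) powr (p/2) = a i powr (2 * (p/2))" by (simp only: powr_powr)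
          then show ?thesis by simp
        qed
        ultimately show ?thesis by simp
      qed
      have "(\<Sum>i\<in>I. a i powr p) * R powr (1 - p/2) \<le> (\<Sum>i\<in>I. p/2 * (a i)\<^sup>2 + (1 - p/2) * R)"
        unfolding sum_distrib_right by (intro sum_mono pt)
      also have "\<dots> = p/2 * S + (1 - p/2) * (m * R)"
      proof -
        have "(\<Sum>i\<in>I. p/2 * (a i)\<^sup>2) = p/2 * S" unfolding S_def by (rule sum_distrib_left[symmetric])
        moreover have "(\<Sum>i\<in>I. (1 - p/2) * R) = (1 - p/2) * (m * R)" by (simp add: m_def)
        ultimately show ?thesis by (simp only: sum.distrib)
      qed
      also have "m * R = S" using m by (simp add: R_def m_def)
      also have "p/2 * S + (1 - p/2) * S = S" by (simp add: algebra_simps)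
      finally have "(\<Sum>i\<in>I. a i powr p) \<le> S / R powr (1 - p/2)" using R by (simp add: pos_le_divide_eq)
      also have "S = m * R" using m by (simp add: R_def m_def)
      also have "m * R / R powr (1 - p/2) = m * R powr (p/2)"
      proof -
        have "R / R powr (1 - p/2) = R powr 1 / R powr (1 - p/2)" using R by simp
        also have "\<dots> = R powr (p/2)" by (simp only: powr_diff[symmetric]) simp
        finally show ?thesis by (simp add: times_divide_eq_right[symmetric] del: times_divide_eq_right)
      qed
      finally have "(\<Sum>i\<in>I. a i powr p) powr (1/p) \<le> (m * R powr (p/2)) powr (1/p)"
        using p by (intro powr_mono2 sum_nonneg) auto
      also have "\<dots> = m powr (1/p) * R powr (1/2)" using p m R by (simp add: powr_mult powr_powr m_def)
      also have "R powr (1/2) = S powr (1/2) / m powr (1/2)" using S m by (simp add: R_def powr_divide m_def)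
      also have "m powr (1/p) * (S powr (1/2) / m powr (1/2)) = m powr (1/p - 1/2) * sqrt S"
        using S by (simp add: powr_diff powr_half_sqrt)
      also have "1/p - 1/2 = max 0 (1/p - 1/2)" using False p by (simp add: max_def field_simps)
      finally show ?thesis by (simp add: S_def m_def)
    qed
  qed
qed

abbreviation samples :: "nat \<Rightarrow> ((nat \<Rightarrow> real^'n) \<times> (nat \<Rightarrow> real^'n)) measure" where
  "samples n \<equiv> PiM {..<n} (\<lambda>_. unif_cube) \<Otimes>\<^sub>M PiM {..<n} (\<lambda>_. (unif_cube :: (real^'n) measure))"

abbreviation mroot :: "real \<Rightarrow> nat \<Rightarrow> (nat \<Rightarrow> real^'n) \<times> (nat \<Rightarrow> real^'n) \<Rightarrow> real" where
  "mroot p n q \<equiv> mcost p {..<n} (fst q) (snd q) powr (1/p)"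

lemma prob_space_samples: "prob_space (samples n :: ((nat \<Rightarrow> real^'n) \<times> (nat \<Rightarrow> real^'n)) measure)"
proof -
  interpret P: prob_space "PiM {..<n} (\<lambda>_. (unif_cube :: (real^'n) measure))" by (intro prob_space_PiM prob_space_unif_cube)
  interpret PP: pair_prob_space "PiM {..<n} (\<lambda>_. (unif_cube :: (real^'n) measure))" "PiM {..<n} (\<lambda>_. (unif_cube :: (real^'n) measure))" ..
  show ?thesis by (rule PP.prob_space_axioms)
qed

lemma mcost_samples_measurable:
  assumes "1 \<le> p"
  shows "(\<lambda>q. mcost p {..<n} (fst q) (snd q)) \<in> borel_measurable (samples n :: ((nat \<Rightarrow> real^'n) \<times> (nat \<Rightarrow> real^'n)) measure)"
  using mcost_scaled_measurable[OF assms finite_lessThan measurable_fst measurable_snd, where s = 1] by simp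

lemma mcost_samples_bound:
  assumes p: "1 \<le> p"
  shows "AE q in (samples n :: ((nat \<Rightarrow> real^'n) \<times> (nat \<Rightarrow> real^'n)) measure).
    mcost p {..<n} (fst q) (snd q) \<le> real n * norm (1 :: real^'n) powr p"
proof -
  let ?P = "PiM {..<n} (\<lambda>_. (unif_cube :: (real^'n) measure))"
  have pr: "prob_space ?P" by (intro prob_space_PiM prob_space_unif_cube)
  have "AE q in ?P \<Otimes>\<^sub>M ?P. \<forall>i\<in>{..<n}. fst q i \<in> cbox 0 1" by (intro AE_pair_fst AE_PiM_unif_cube pr) simp
  moreover have "AE q in ?P \<Otimes>\<^sub>M ?P. \<forall>i\<in>{..<n}. snd q i \<in> cbox 0 1" by (intro AE_pair_snd AE_PiM_unif_cube pr) simp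
  ultimately show ?thesis
  proof eventually_elim
    case (elim q)
    then show ?case using mcost_scaled_le[OF finite_lessThan p elim, of 1] by simp
  qed
qed

lemma nn_integral_mcost_samples:
  assumes p: "1 \<le> p"
  shows "(\<integral>\<^sup>+ q. mcost p {..<n} (fst q) (snd q) \<partial>(samples n :: ((nat \<Rightarrow> real^'n) \<times> (nat \<Rightarrow> real^'n)) measure)) = ennreal (gcost p n (1 :: real^'n))"
proof -
  let ?P = "PiM {..<n} (\<lambda>_. (unif_cube :: (real^'n) measure))"
  have "sigma_finite_measure ?P" by (intro prob_space_imp_sigma_finite prob_space_PiM prob_space_unif_cube)
  note fst = sigma_finite_measure.nn_integral_fst[OF this measurable_compose[OF mcost_samples_measurable[OF p] measurable_ennreal]]
  have "(\<integral>\<^sup>+ q. mcost p {..<n} (fst q) (snd q) \<partial>(?P \<Otimes>\<^sub>M ?P)) = Gcost p {..<n} (1 :: real^'n)"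
    unfolding fst[symmetric] by (simp add: Gcost_def)
  then show ?thesis by (simp only: Gcost_eq[OF p])
qed

lemma integrable_mcost_samples:
  assumes p: "1 \<le> p"
  shows "integrable (samples n :: ((nat \<Rightarrow> real^'n) \<times> (nat \<Rightarrow> real^'n)) measure) (\<lambda>q. mcost p {..<n} (fst q) (snd q))"
    and "(\<integral>q. mcost p {..<n} (fst q) (snd q) \<partial>(samples n :: ((nat \<Rightarrow> real^'n) \<times> (nat \<Rightarrow> real^'n)) measure)) = gcost p n (1 :: real^'n)"
proof -
  show "integrable (samples n :: ((nat \<Rightarrow> real^'n) \<times> (nat \<Rightarrow> real^'n)) measure) (\<lambda>q. mcost p {..<n} (fst q) (snd q))"
    by (rule integrableI_nn_integral_finite[OF mcost_samples_measurable[OF p] _ nn_integral_mcost_samples[OF p]])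
       (auto intro: mcost_nonneg)
  show "(\<integral>q. mcost p {..<n} (fst q) (snd q) \<partial>(samples n :: ((nat \<Rightarrow> real^'n) \<times> (nat \<Rightarrow> real^'n)) measure)) = gcost p n (1 :: real^'n)"
    by (rule integral_eq_nn_integral[THEN trans])
      (auto simp: nn_integral_mcost_samples[OF p] gcost_nonneg intro: mcost_nonneg mcost_samples_measurable[OF p])
qed

text \<open>The \<open>2 * n\<close> displacements of both samples form one vector:
  \<open>mcost_root_diff\<close> bounds the change by its p-norm, while concentration needs its
  Euclidean norm. The constant 4 combines two crude bounds by 2, for
  \<open>2 powr ((p - 1) / p)\<close> and for the power of 2 in
  \<open>real (2 * n) powr ?\<beta>\<close>.\<close>

lemma mroot_lipschitz:
  fixes q q' :: "(nat \<Rightarrow> real^'n) \<times> (nat \<Rightarrow> real^'n)"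
  assumes p: "1 \<le> p"
  shows "\<bar>mroot p n q - mroot p n q'\<bar> \<le> 4 * real n powr max 0 (1/p - 1/2) *
    sqrt ((\<Sum>i<n. (norm (fst q i - fst q' i))\<^sup>2) + (\<Sum>i<n. (norm (snd q i - snd q' i))\<^sup>2))"
proof -
  let ?\<beta> = "max 0 (1/p - 1/2)"
  define a where "a j = (case j of Inl i \<Rightarrow> norm (fst q i - fst q' i) | Inr i \<Rightarrow> norm (snd q i - snd q' i))" for j :: "nat + nat"
  let ?I = "{..<n} <+> {..<n}"
  have s: "(\<Sum>j\<in>?I. f (a j)) = (\<Sum>i<n. f (norm (fst q i - fst q' i))) + (\<Sum>i<n. f (norm (snd q i - snd q' i)))" for f :: "real \<Rightarrow> real"
    by (simp add: sum.Plus a_def)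
  have an: "0 \<le> a j" for j by (cases j) (auto simp: a_def)
  have "\<bar>mroot p n q - mroot p n q'\<bar> \<le> (2 powr (p - 1) * (\<Sum>j\<in>?I. a j powr p)) powr (1/p)"
    unfolding s[of "\<lambda>t. t powr p"] by (rule mcost_root_diff[OF finite_lessThan p])
  also have "\<dots> = (2 powr (p - 1)) powr (1/p) * (\<Sum>j\<in>?I. a j powr p) powr (1/p)"
    by (intro powr_mult)
  also have "\<dots> \<le> 2 * (real (2 * n) powr ?\<beta> * sqrt (\<Sum>j\<in>?I. (a j)\<^sup>2))"
  proof (rule mult_mono)
    have "(2 powr (p - 1)) powr (1/p) = 2 powr ((p - 1) / p)" by (simp add: powr_powr)
    also have "\<dots> \<le> 2 powr 1" using p by (intro powr_mono) auto
    finally show "(2 powr (p - 1)) powr (1/p) \<le> 2" by simp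
    have "card ?I = 2 * n" by (simp add: card_Plus)
    then show "(\<Sum>j\<in>?I. a j powr p) powr (1/p) \<le> real (2 * n) powr ?\<beta> * sqrt (\<Sum>j\<in>?I. (a j)\<^sup>2)"
      using powr_sum_root_le_l2[of ?I a p] an p by simp
  qed auto
  also have "real (2 * n) powr ?\<beta> = 2 powr ?\<beta> * real n powr ?\<beta>" by (simp add: powr_mult)
  also have "2 * (2 powr ?\<beta> * real n powr ?\<beta> * sqrt (\<Sum>j\<in>?I. (a j)\<^sup>2)) \<le> 2 * (2 * real n powr ?\<beta> * sqrt (\<Sum>j\<in>?I. (a j)\<^sup>2))"
  proof (intro mult_left_mono mult_right_mono)
    have "2 powr ?\<beta> \<le> (2::real) powr 1" using p by (intro powr_mono) (auto simp: field_simps)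
    then show "2 powr ?\<beta> \<le> (2::real)" by simp
  qed (auto intro: sum_nonneg)
  finally show ?thesis by (simp add: s[of "\<lambda>t. t\<^sup>2"] mult.assoc)
qed

text \<open>Concentration is stated for functions bounded everywhere, but the points lie in the cube
  only almost surely. So the root is truncated at its almost sure bound \<open>B\<close>, which
  changes it only on a null set and does not increase its oscillation.\<close>

lemma mroot_concentration:
  assumes p: "1 \<le> p" and n: "0 < n" and r: "0 < r"
  shows "measure (samples n :: ((nat \<Rightarrow> real^'n) \<times> (nat \<Rightarrow> real^'n)) measure)
     {q\<in>space (samples n). r \<le> \<bar>mroot p n q - (\<integral>q. mroot p n q \<partial>(samples n :: ((nat \<Rightarrow> real^'n) \<times> (nat \<Rightarrow> real^'n)) measure))\<bar>}
    \<le> 2 * exp (- (r\<^sup>2 / (4 * real n powr max 0 (1/p - 1/2))\<^sup>2))"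
proof -
  let ?S = "samples n :: ((nat \<Rightarrow> real^'n) \<times> (nat \<Rightarrow> real^'n)) measure"
  let ?P = "PiM {..<n} (\<lambda>_. (unif_cube :: (real^'n) measure))"
  let ?L = "4 * real n powr max 0 (1/p - 1/2)"
  interpret S: prob_space ?S by (rule prob_space_samples)
  define B where "B = (real n * norm (1 :: real^'n) powr p) powr (1/p)"
  define F where "F q = min (mroot p n q) B" for q :: "(nat \<Rightarrow> real^'n) \<times> (nat \<Rightarrow> real^'n)"
  have mm [measurable]: "(\<lambda>q. mroot p n q) \<in> borel_measurable ?S"
    using mcost_samples_measurable[OF p] by (rule powr_real_measurable) simp
  have Fm [measurable]: "F \<in> borel_measurable ?S" unfolding F_def by measurable
  have eq: "AE q in ?S. F q = mroot p n q"
    using mcost_samples_bound[OF p]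
  proof eventually_elim
    case (elim q)
    then have "mroot p n q \<le> B" unfolding B_def using p by (intro powr_mono2 mcost_nonneg) auto
    then show ?case by (simp add: F_def)
  qed
  have int: "(\<integral>q. F q \<partial>?S) = (\<integral>q. mroot p n q \<partial>?S)" using eq by (intro integral_cong_AE) auto
  let ?a = "\<integral>q. F q \<partial>?S"
  have tau: "tau_property ?S (\<lambda>q q'. (\<Sum>i\<in>{..<n}. (norm (fst q i - fst q' i))\<^sup>2) + (\<Sum>i\<in>{..<n}. (norm (snd q i - snd q' i))\<^sup>2))"
    by (rule tau_property_pair[OF prob_space_PiM prob_space_PiM]) (intro prob_space_unif_cube tau_property_PiM tau_property_unif_cube; simp)+
  have "measure ?S {q\<in>space ?S. r \<le> \<bar>F q - ?a\<bar>} \<le> 2 * exp (- (r\<^sup>2 / ?L\<^sup>2))"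
  proof (rule tau_property_concentration[OF S.prob_space_axioms tau Fm _ _ r])
    show "\<bar>F q\<bar> \<le> B" for q by (auto simp: F_def B_def abs_le_iff min_le_iff_disj intro: order_trans[OF _ powr_ge_zero])
    show "0 < ?L" using n by simp
    fix q q' :: "(nat \<Rightarrow> real^'n) \<times> (nat \<Rightarrow> real^'n)"
    have "\<bar>F q - F q'\<bar> \<le> \<bar>mroot p n q - mroot p n q'\<bar>" by (auto simp: F_def min_def abs_if)
    also note mroot_lipschitz[OF p, of n q q']
    finally show "0 \<le> (\<Sum>i\<in>{..<n}. (norm (fst q i - fst q' i))\<^sup>2) + (\<Sum>i\<in>{..<n}. (norm (snd q i - snd q' i))\<^sup>2) \<and>
       \<bar>F q - F q'\<bar> \<le> ?L * sqrt ((\<Sum>i\<in>{..<n}. (norm (fst q i - fst q' i))\<^sup>2) + (\<Sum>i\<in>{..<n}. (norm (snd q i - snd q' i))\<^sup>2))"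
      by (auto intro!: add_nonneg_nonneg sum_nonneg)
  qed
  also have "measure ?S {q\<in>space ?S. r \<le> \<bar>F q - ?a\<bar>} = measure ?S {q\<in>space ?S. r \<le> \<bar>mroot p n q - (\<integral>q. mroot p n q \<partial>?S)\<bar>}"
    using eq by (intro S.finite_measure_eq_AE) (auto simp: int elim!: eventually_mono)
  finally show ?thesis .
qed

section \<open>Lower bound for the expected cost\<close>

lemma emeasure_unif_cube_ball_le:
  fixes x :: "real^'n"
  assumes r: "0 \<le> r"
  shows "emeasure (unif_cube :: (real^'n) measure) {y. norm (x - y) \<le> r} \<le> ennreal ((2 * r) ^ CARD('n))"
proof -
  let ?e = "r *\<^sub>R (1 :: real^'n)"
  have sub: "{y. norm (x - y) \<le> r} \<subseteq> cbox (x - ?e) (x + ?e)"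
  proof
    fix y assume "y \<in> {y. norm (x - y) \<le> r}"
    then have "\<bar>(x - y) $ i\<bar> \<le> r" for i using component_le_norm_cart[of "x - y" i] by (auto intro: order_trans)
    then show "y \<in> cbox (x - ?e) (x + ?e)" by (auto simp: mem_box_cart abs_le_iff algebra_simps)
  qed
  have "emeasure (unif_cube :: (real^'n) measure) {y. norm (x - y) \<le> r} \<le> emeasure (unif_cube :: (real^'n) measure) (cbox (x - ?e) (x + ?e))"
    using sub by (intro emeasure_mono) auto
  also have "\<dots> = emeasure lborel (cbox 0 1 \<inter> cbox (x - ?e) (x + ?e)) / 1"
    by (subst emeasure_uniform_measure) (auto simp: unif_cube_one)
  also have "\<dots> \<le> emeasure lborel (cbox (x - ?e) (x + ?e))"
    by (simp add: divide_ennreal_def emeasure_mono)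
  also have "\<dots> = (\<Prod>b\<in>(Basis :: (real^'n) set). ((x + ?e) - (x - ?e)) \<bullet> b)"
    using r by (intro emeasure_lborel_cbox) (auto simp: Basis_vec_def inner_axis)
  also have "(\<Prod>b\<in>(Basis :: (real^'n) set). ((x + ?e) - (x - ?e)) \<bullet> b) = (\<Prod>b\<in>(Basis :: (real^'n) set). 2 * r)"
    by (intro prod.cong) (auto simp: Basis_vec_def inner_axis)
  finally show ?thesis by simp
qed

text \<open>If no \<open>x i\<close> lies within distance \<open>r\<close> of \<open>y j\<close>,
  every matching pays at least \<open>r powr p\<close> for \<open>y j\<close>, as its column sums to
  1. The indicators compensate for the remaining points.\<close>

lemma mcost_ge_isolated:
  assumes p: "1 \<le> p" and r: "0 \<le> r"
  shows "real n * r powr p \<le> mcost p {..<n} x y + (\<Sum>j<n. \<Sum>i<n. r powr p * indicator {y. norm (x i - y) \<le> r} (y j))"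
proof -
  have "real n * r powr p - (\<Sum>j<n. \<Sum>i<n. r powr p * indicator {y. norm (x i - y) \<le> r} (y j)) \<le> tcost p {..<n} P x y"
    if P: "P \<in> dstoch {..<n}" for P
  proof -
    have Pnn: "0 \<le> P i j" if "i < n" "j < n" for i j using P that by (auto simp: dstoch_def)
    have col: "r powr p \<le> (\<Sum>i<n. P i j * norm (x i - y j) powr p) + (\<Sum>i<n. r powr p * indicator {y. norm (x i - y) \<le> r} (y j))"
      if j: "j < n" for j
    proof (cases "\<exists>i<n. norm (x i - y j) \<le> r")
      case True
      then obtain i where i: "i < n" "norm (x i - y j) \<le> r" by auto
      then have "r powr p = r powr p * indicator {y. norm (x i - y) \<le> r} (y j)" by simp
      also have "\<dots> \<le> (\<Sum>i<n. r powr p * indicator {y. norm (x i - y) \<le> r} (y j))"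
        using i by (intro member_le_sum[of i "{..<n}" "\<lambda>i. r powr p * indicator {y. norm (x i - y) \<le> r} (y j)"]) auto
      finally have "r powr p \<le> (\<Sum>i<n. r powr p * indicator {y. norm (x i - y) \<le> r} (y j))" .
      moreover have "0 \<le> (\<Sum>i<n. P i j * norm (x i - y j) powr p)"
        using Pnn j by (intro sum_nonneg mult_nonneg_nonneg) auto
      ultimately show ?thesis by linarith
    next
      case False
      have "r powr p = (\<Sum>i<n. P i j) * r powr p" using P j by (simp add: dstoch_def)
      also have "\<dots> \<le> (\<Sum>i<n. P i j * norm (x i - y j) powr p)"
        unfolding sum_distrib_right using False Pnn j p r by (intro sum_mono mult_left_mono powr_mono2) (auto simp: not_le intro: less_imp_le)
      finally show ?thesis by (simp add: add_increasing2 sum_nonneg)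
    qed
    have "real n * r powr p = (\<Sum>j<n. r powr p)" by simp
    also have "\<dots> \<le> (\<Sum>j<n. (\<Sum>i<n. P i j * norm (x i - y j) powr p) + (\<Sum>i<n. r powr p * indicator {y. norm (x i - y) \<le> r} (y j)))"
      by (intro sum_mono col) simp
    also have "\<dots> = tcost p {..<n} P x y + (\<Sum>j<n. \<Sum>i<n. r powr p * indicator {y. norm (x i - y) \<le> r} (y j))"
      unfolding tcost_def sum.distrib by (subst (1) sum.swap) simp
    finally show ?thesis by simp
  qed
  then have "real n * r powr p - (\<Sum>j<n. \<Sum>i<n. r powr p * indicator {y. norm (x i - y) \<le> r} (y j)) \<le> mcost p {..<n} x y"
    by (intro mcost_greatest) auto
  then show ?thesis by simp
qed

text \<open>For a fixed first sample, a random point has in the mean at most \<open>1/2\<close>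
  sample points within distance \<open>r\<close>. So the correction in
  \<open>mcost_ge_isolated\<close> uses up at most half of \<open>real n * r powr p\<close>,
  whatever the first sample is.\<close>

lemma gcost_lower_bound:
  assumes p: "1 \<le> p" and n: "0 < n"
  shows "(1/2) powr (p + 1) * 2 powr (- p / real CARD('n)) * real n powr (1 - p / real CARD('n)) \<le> gcost p n (1 :: real^'n::finite)"
proof -
  let ?D = "CARD('n)"
  let ?P = "PiM {..<n} (\<lambda>_. (unif_cube :: (real^'n) measure))"
  interpret P: prob_space ?P by (intro prob_space_PiM prob_space_unif_cube)
  \<comment> \<open>Chosen so that \<open>real n * (2 * r) ^ ?D = 1/2\<close>, where
    \<open>(2 * r) ^ ?D\<close> is the volume of the cube circumscribed about a ball of radius
    \<open>r\<close>.\<close>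
  define r where "r = 1/2 * (2 * real n) powr (- 1 / real ?D)"
  have r: "0 < r" using n by (simp add: r_def)
  have D: "0 < ?D" by simp
  have rd: "real n * (2 * r) ^ ?D = 1/2"
  proof -
    have "(2 * r) ^ ?D = ((2 * real n) powr (- 1 / real ?D)) powr real ?D" using n by (simp add: r_def powr_realpow)
    also have "\<dots> = (2 * real n) powr (-1)" by (simp add: powr_powr)
    finally show ?thesis using n by (simp add: powr_minus_divide)
  qed
  have "ennreal (real n * r powr p) \<le> (\<integral>\<^sup>+ y. ennreal (mcost p {..<n} (\<lambda>i. 1 * x i) (\<lambda>i. 1 * y i)) \<partial>?P) + ennreal (real n * r powr p / 2)"
    if x: "x \<in> space ?P" for x :: "nat \<Rightarrow> real^'n"
  proof -
    have m1: "(\<lambda>y. ennreal (mcost p {..<n} (\<lambda>i. 1 * x i) (\<lambda>i. 1 * y i))) \<in> borel_measurable ?P"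
      by (rule measurable_compose[OF mcost_scaled_measurable[OF p finite_lessThan measurable_const[OF x] measurable_ident_sets[OF refl]] measurable_ennreal])
    have m2: "(\<lambda>y. ennreal (r powr p) * indicator {y. norm (x i - y) \<le> r} (y j)) \<in> borel_measurable ?P" if "j \<in> {..<n}" for i j
    proof (rule measurable_compose[OF measurable_component_singleton[OF that]])
      show "(\<lambda>y. ennreal (r powr p) * indicator {y. norm (x i - y) \<le> r} y) \<in> borel_measurable (unif_cube :: (real^'n) measure)"
        unfolding measurable_unif_cube1 by measurable
    qed
    have "ennreal (real n * r powr p) = (\<integral>\<^sup>+ y. ennreal (real n * r powr p) \<partial>?P)" by (simp add: P.emeasure_space_1)
    also have "\<dots> \<le> (\<integral>\<^sup>+ y. ennreal (mcost p {..<n} (\<lambda>i. 1 * x i) (\<lambda>i. 1 * y i)) + (\<Sum>j<n. \<Sum>i<n. ennreal (r powr p) * indicator {y. norm (x i - y) \<le> r} (y j)) \<partial>?P)"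
    proof (rule nn_integral_mono)
      fix y :: "nat \<Rightarrow> real^'n"
      have "(\<Sum>j<n. \<Sum>i<n. ennreal (r powr p) * indicator {y. norm (x i - y) \<le> r} (y j)) = (\<Sum>j<n. \<Sum>i<n. ennreal (r powr p * indicator {y. norm (x i - y) \<le> r} (y j)))"
        by (intro sum.cong refl) (auto simp: indicator_def)
      also have "\<dots> = ennreal (\<Sum>j<n. \<Sum>i<n. r powr p * indicator {y. norm (x i - y) \<le> r} (y j))"
        by (rule sum_ennreal2) auto
      finally have e: "(\<Sum>j<n. \<Sum>i<n. ennreal (r powr p) * indicator {y. norm (x i - y) \<le> r} (y j)) = ennreal (\<Sum>j<n. \<Sum>i<n. r powr p * indicator {y. norm (x i - y) \<le> r} (y j))" .
      have "0 \<le> (\<Sum>j<n. \<Sum>i<n. r powr p * indicator {y. norm (x i - y) \<le> r} (y j))" by (intro sum_nonneg) auto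
      then show "ennreal (real n * r powr p) \<le> ennreal (mcost p {..<n} (\<lambda>i. 1 * x i) (\<lambda>i. 1 * y i)) + (\<Sum>j<n. \<Sum>i<n. ennreal (r powr p) * indicator {y. norm (x i - y) \<le> r} (y j))"
        unfolding e using mcost_ge_isolated[OF p less_imp_le[OF r], of n x y] mcost_nonneg[of "{..<n}" p x y]
        by (simp add: ennreal_plus[symmetric] ennreal_leI del: ennreal_plus)
    qed
    also have "\<dots> = (\<integral>\<^sup>+ y. ennreal (mcost p {..<n} (\<lambda>i. 1 * x i) (\<lambda>i. 1 * y i)) \<partial>?P) + (\<integral>\<^sup>+ y. (\<Sum>j<n. \<Sum>i<n. ennreal (r powr p) * indicator {y. norm (x i - y) \<le> r} (y j)) \<partial>?P)"
      by (intro nn_integral_add m1 borel_measurable_sum m2)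
    also have "(\<integral>\<^sup>+ y. (\<Sum>j<n. \<Sum>i<n. ennreal (r powr p) * indicator {y. norm (x i - y) \<le> r} (y j)) \<partial>?P)
       = (\<Sum>j<n. \<Sum>i<n. \<integral>\<^sup>+ y. ennreal (r powr p) * indicator {y. norm (x i - y) \<le> r} (y j) \<partial>?P)"
    proof (subst nn_integral_sum)
      show "(\<Sum>j<n. \<integral>\<^sup>+ y. (\<Sum>i<n. ennreal (r powr p) * indicator {y. norm (x i - y) \<le> r} (y j)) \<partial>?P) = (\<Sum>j<n. \<Sum>i<n. \<integral>\<^sup>+ y. ennreal (r powr p) * indicator {y. norm (x i - y) \<le> r} (y j) \<partial>?P)"
        by (intro sum.cong refl nn_integral_sum m2)
    qed (intro borel_measurable_sum m2)
    also have "\<dots> \<le> (\<Sum>j<n. \<Sum>i<n. ennreal (r powr p * (2 * r) ^ ?D))"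
    proof (intro sum_mono)
      fix i j assume j: "j \<in> {..<n}"
      have "(\<integral>\<^sup>+ y. ennreal (r powr p) * indicator {y. norm (x i - y) \<le> r} (y j) \<partial>?P)
         = (\<integral>\<^sup>+ y. ennreal (r powr p) * indicator {y. norm (x i - y) \<le> r} y \<partial>distr ?P unif_cube (\<lambda>y. y j))"
        by (rule nn_integral_distr[OF measurable_component_singleton[OF j], symmetric]) (simp, measurable)
      also have "distr ?P unif_cube (\<lambda>y. y j) = unif_cube" by (rule distr_PiM_component[OF prob_space_unif_cube j])
      also have "(\<integral>\<^sup>+ y. ennreal (r powr p) * indicator {y. norm (x i - y) \<le> r} y \<partial>(unif_cube :: (real^'n) measure)) = ennreal (r powr p) * emeasure (unif_cube :: (real^'n) measure) {y. norm (x i - y) \<le> r}"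
        by (intro nn_integral_cmult_indicator) simp
      also have "\<dots> \<le> ennreal (r powr p) * ennreal ((2 * r) ^ ?D)"
        using r by (intro mult_left_mono emeasure_unif_cube_ball_le) auto
      also have "\<dots> = ennreal (r powr p * (2 * r) ^ ?D)" using r by (simp add: ennreal_mult)
      finally show "(\<integral>\<^sup>+ y. ennreal (r powr p) * indicator {y. norm (x i - y) \<le> r} (y j) \<partial>?P) \<le> ennreal (r powr p * (2 * r) ^ ?D)" .
    qed
    also have "\<dots> = ennreal (\<Sum>j<n. \<Sum>i<n. r powr p * (2 * r) ^ ?D)" using r by (intro sum_ennreal2) auto
    also have "(\<Sum>j<n. \<Sum>i<n. r powr p * (2 * r) ^ ?D) = real n * r powr p * (real n * (2 * r) ^ ?D)" by simp
    also have "\<dots> = real n * r powr p / 2" unfolding rd by simp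
    finally show ?thesis by (simp add: add_left_mono)
  qed
  then have "(\<integral>\<^sup>+ x. ennreal (real n * r powr p) \<partial>?P) \<le> (\<integral>\<^sup>+ x. (\<integral>\<^sup>+ y. ennreal (mcost p {..<n} (\<lambda>i. 1 * x i) (\<lambda>i. 1 * y i)) \<partial>?P) + ennreal (real n * r powr p / 2) \<partial>?P)"
    by (rule nn_integral_mono)
  also have "\<dots> = Gcost p {..<n} (1 :: real^'n) + ennreal (real n * r powr p / 2)"
    unfolding Gcost_def
  proof (subst nn_integral_add)
    show "(\<lambda>x. \<integral>\<^sup>+ y. ennreal (mcost p {..<n} (\<lambda>i. 1 * x i) (\<lambda>i. 1 * y i)) \<partial>?P) \<in> borel_measurable ?P"
    proof (rule P.borel_measurable_nn_integral)
      show "(\<lambda>(x, y). ennreal (mcost p {..<n} (\<lambda>i. 1 * x i) (\<lambda>i. 1 * y i))) \<in> borel_measurable (?P \<Otimes>\<^sub>M ?P)"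
        using measurable_compose[OF mcost_scaled_measurable[OF p finite_lessThan measurable_fst measurable_snd, where s = 1] measurable_ennreal]
        by (simp add: case_prod_beta')
    qed
  qed (auto simp: P.emeasure_space_1)
  also have "\<dots> = ennreal (gcost p n (1 :: real^'n) + real n * r powr p / 2)"
    using p by (simp add: Gcost_eq gcost_nonneg)
  finally have "ennreal (real n * r powr p) \<le> ennreal (gcost p n (1 :: real^'n) + real n * r powr p / 2)"
    by (simp add: P.emeasure_space_1)
  then have "real n * r powr p \<le> gcost p n (1 :: real^'n) + real n * r powr p / 2"
    by (subst (asm) ennreal_le_iff) (auto simp: gcost_nonneg)
  moreover have "(1/2) powr (p + 1) * 2 powr (- p / real ?D) * real n powr (1 - p / real ?D) = real n * r powr p / 2"
  proof -
    have "r powr p = (1/2) powr p * (2 powr (- p / real ?D) * real n powr (- p / real ?D))"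
    proof -
      have "r powr p = (1/2) powr p * (2 powr (- 1 / real ?D * p) * real n powr (- 1 / real ?D * p))"
        unfolding r_def by (simp only: powr_mult powr_powr)
      then show ?thesis by simp
    qed
    moreover have "real n powr (1 - p / real ?D) = real n * real n powr (- p / real ?D)"
      using n powr_add[of "real n" 1 "- p / real ?D"] by simp
    moreover have "(1/2::real) powr (p + 1) = (1/2) powr p / 2" by (simp add: powr_add)
    ultimately show ?thesis by simp
  qed
  ultimately show ?thesis by linarith
qed

section \<open>Almost sure and mean convergence\<close>

lemma powr_mult_exp_neg_tendsto_0:
  fixes c \<eta> s :: real
  assumes "0 < c" "0 < \<eta>"
  shows "(\<lambda>n. real n powr s * exp (- c * real n powr \<eta>)) \<longlonglongrightarrow> 0"
  using assms by real_asymp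

lemma summable_exp_neg_powr:
  fixes c \<eta> :: real
  assumes "0 < c" "0 < \<eta>"
  shows "summable (\<lambda>n. exp (- c * real n powr \<eta>))"
proof (rule summable_comparison_test_ev)
  show "summable (\<lambda>n. real n powr (-2))" by (subst summable_real_powr_iff) simp
  have "\<forall>\<^sub>F n in sequentially. real n powr 2 * exp (- c * real n powr \<eta>) < 1"
    using order_tendstoD(2)[OF powr_mult_exp_neg_tendsto_0[OF assms, of 2], of 1] by simp
  then show "\<forall>\<^sub>F n in sequentially. norm (exp (- c * real n powr \<eta>)) \<le> real n powr (-2)"
    using eventually_gt_at_top[of 0]
  proof eventually_elim
    case (elim n)
    then show ?case by (simp add: powr_minus_divide pos_le_divide_eq mult.commute)
  qed
qed

text \<open>Jensen's inequality for the concave root, obtained by integrating Young's inequality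
  between \<open>Z x powr p\<close> and its mean \<open>E\<close>.\<close>

lemma expectation_root_le:
  fixes Z :: "'a \<Rightarrow> real"
  assumes M: "prob_space M" and p: "1 \<le> p" and nn: "\<And>x. x \<in> space M \<Longrightarrow> 0 \<le> Z x"
    and Z: "integrable M Z" and Zp: "integrable M (\<lambda>x. Z x powr p)" and t: "0 < (\<integral>x. Z x powr p \<partial>M)"
  shows "(\<integral>x. Z x \<partial>M) \<le> (\<integral>x. Z x powr p \<partial>M) powr (1/p)"
proof -
  interpret prob_space M by fact
  define E where "E = (\<integral>x. Z x powr p \<partial>M)"
  have E: "0 < E" using t by (simp add: E_def)
  have pt: "Z x * E powr (1 - 1/p) \<le> 1/p * Z x powr p + (1 - 1/p) * E" if x: "x \<in> space M" for x
  proof (cases "Z x = 0")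
    case True
    moreover have "0 \<le> (1 - 1/p) * E" using p E by (simp add: zero_le_mult_iff)
    ultimately show ?thesis using p by simp
  next
    case False
    then have "0 < Z x" using nn[OF x] by simp
    then have "(Z x powr p) powr (1/p) * E powr (1 - 1/p) \<le> 1/p * Z x powr p + (1 - 1/p) * E"
      using p E by (intro Youngs_inequality_0) auto
    then show ?thesis using p nn[OF x] by (simp add: powr_powr)
  qed
  have "(\<integral>x. Z x * E powr (1 - 1/p) \<partial>M) \<le> (\<integral>x. 1/p * Z x powr p + (1 - 1/p) * E \<partial>M)"
    using Z Zp by (intro integral_mono pt integrable_mult_left Bochner_Integration.integrable_add integrable_mult_right integrable_const)
  also have "\<dots> = 1/p * E + (1 - 1/p) * E" using Zp by (subst Bochner_Integration.integral_add) (auto simp: E_def prob_space)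
  also have "\<dots> = E" by (simp add: algebra_simps)
  finally have "(\<integral>x. Z x \<partial>M) * E powr (1 - 1/p) \<le> E" by simp
  then have "(\<integral>x. Z x \<partial>M) \<le> E / E powr (1 - 1/p)" using E by (simp add: pos_le_divide_eq)
  also have "\<dots> = E powr 1 / E powr (1 - 1/p)" using E by simp
  also have "\<dots> = E powr (1/p)" by (simp only: powr_diff[symmetric]) simp
  finally show ?thesis by (simp add: E_def)
qed

lemma scaled_cost_eq:
  assumes n: "0 < n" and p: "1 \<le> p"
  shows "scaled_cost p n x (y :: nat \<Rightarrow> real^'n::finite) = real n powr (p / real CARD('n) - 1) * mcost p {..<n} x y"
proof -
  have "real n powr (p / real CARD('n)) / real n = real n powr (p / real CARD('n) - 1)"
    using n by (simp add: powr_diff)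
  then show ?thesis by (simp add: scaled_cost_def Wasserstein_empirical[OF n p] flip: times_divide_eq_left)
qed

definition gcost_limit :: "'n::finite itself \<Rightarrow> real \<Rightarrow> real" where
  "gcost_limit (_ :: 'n itself) p = lim (\<lambda>n. gcost p n (1 :: real^'n) / real n powr (1 - p / real CARD('n)))"

text \<open>The root of the cost is of size \<open>n powr (1/p - 1/D)\<close> and its Lipschitz
  constant of size \<open>n powr max 0 (1/p - 1/2)\<close>; this exponent measures by how much the
  former exceeds the latter.\<close>

definition tail_exponent :: "real \<Rightarrow> real \<Rightarrow> real" where
  "tail_exponent p D = 1/p - 1/D - max 0 (1/p - 1/2)"

section \<open>Limits for a pair of sequences with product uniform law\<close>

context
  fixes p :: real and M :: "'w measure" and X Y :: "nat \<Rightarrow> 'w \<Rightarrow> real^'n::finite"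
  assumes d: "3 \<le> CARD('n)" and p: "1 \<le> p" "p < real CARD('n)" and M: "prob_space M"
    and XY: "(\<lambda>\<omega>. (\<lambda>i. X i \<omega>, \<lambda>i. Y i \<omega>)) \<in> M \<rightarrow>\<^sub>M (\<Pi>\<^sub>M i\<in>UNIV. borel) \<Otimes>\<^sub>M (\<Pi>\<^sub>M i\<in>UNIV. borel)"
    and law: "distr M ((\<Pi>\<^sub>M i\<in>UNIV. borel) \<Otimes>\<^sub>M (\<Pi>\<^sub>M i\<in>UNIV. borel)) (\<lambda>\<omega>. (\<lambda>i. X i \<omega>, \<lambda>i. Y i \<omega>))
      = unif_seq \<Otimes>\<^sub>M (unif_seq :: (nat \<Rightarrow> real^'n) measure)"
begin

interpretation M: prob_space M by (rule M)

abbreviation "sample_cost n \<omega> \<equiv> scaled_cost p n (\<lambda>i. X i \<omega>) (\<lambda>i. Y i \<omega>)"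

definition "first_pts n \<omega> = ((\<lambda>i\<in>{..<n}. X i \<omega>), (\<lambda>i\<in>{..<n}. Y i \<omega>))"

lemma first_pts_measurable: "first_pts n \<in> M \<rightarrow>\<^sub>M samples n"
proof -
  have "(\<lambda>\<omega>. X i \<omega>) \<in> borel_measurable M" "(\<lambda>\<omega>. Y i \<omega>) \<in> borel_measurable M" for i
    using measurable_compose[OF measurable_compose[OF XY measurable_fst] measurable_component_singleton[of i UNIV]]
      measurable_compose[OF measurable_compose[OF XY measurable_snd] measurable_component_singleton[of i UNIV]] by simp_all
  then show ?thesis unfolding first_pts_def[abs_def]
    by (intro measurable_Pair measurable_restrict) simp_all
qed

lemma distr_first_pts: "distr M (samples n) (first_pts n) = samples n"
proof -
  let ?U = "unif_cube :: (real^'n) measure"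
  let ?B = "\<Pi>\<^sub>M i\<in>(UNIV :: nat set). (borel :: (real^'n) measure)"
  let ?P = "PiM {..<n} (\<lambda>_. ?U)"
  interpret S: product_prob_space "\<lambda>_. ?U" "UNIV :: nat set" by (intro product_prob_spaceI prob_space_unif_cube)
  interpret P: prob_space ?P by (intro prob_space_PiM prob_space_unif_cube)
  have r: "(\<lambda>x. restrict x {..<n}) \<in> (unif_seq :: (nat \<Rightarrow> real^'n) measure) \<rightarrow>\<^sub>M ?P" by measurable
  have d1: "distr unif_seq ?P (\<lambda>x. restrict x {..<n}) = ?P" by (rule S.distr_PiM_restrict_finite) auto
  have sB: "sets ?B = sets (unif_seq :: (nat \<Rightarrow> real^'n) measure)" by (intro sets_PiM_cong) auto
  have rB: "(\<lambda>x. restrict x {..<n}) \<in> ?B \<rightarrow>\<^sub>M ?P" using r measurable_cong_sets[OF sB refl, of ?P] by simp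
  have rr: "(\<lambda>z. (restrict (fst z) {..<n}, restrict (snd z) {..<n})) \<in> ?B \<Otimes>\<^sub>M ?B \<rightarrow>\<^sub>M samples n"
    by (intro measurable_Pair measurable_compose[OF measurable_fst rB] measurable_compose[OF measurable_snd rB])
  have "distr M (samples n) (first_pts n) = distr (distr M (?B \<Otimes>\<^sub>M ?B) (\<lambda>\<omega>. (\<lambda>i. X i \<omega>, \<lambda>i. Y i \<omega>))) (samples n) (\<lambda>z. (restrict (fst z) {..<n}, restrict (snd z) {..<n}))"
    by (subst distr_distr[OF rr XY]) (simp add: first_pts_def[abs_def] comp_def restrict_def cong: if_cong)
  also have "\<dots> = distr (unif_seq \<Otimes>\<^sub>M unif_seq) (samples n) (\<lambda>(x, y). (restrict x {..<n}, restrict y {..<n}))"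
    by (simp add: law case_prod_beta')
  also have "\<dots> = distr unif_seq ?P (\<lambda>x. restrict x {..<n}) \<Otimes>\<^sub>M distr unif_seq ?P (\<lambda>x. restrict x {..<n})"
    by (rule pair_measure_distr[symmetric, OF r r]) (simp add: d1 P.sigma_finite_measure_axioms)
  finally show ?thesis by (simp add: d1)
qed

lemma cost_first_pts:
  assumes "0 < n"
  shows "sample_cost n \<omega> = real n powr (p / real CARD('n) - 1) * mcost p {..<n} (fst (first_pts n \<omega>)) (snd (first_pts n \<omega>))"
  unfolding scaled_cost_eq[OF assms p(1)] first_pts_def fst_conv snd_conv
  by (intro arg_cong2[where f = "(*)"] refl mcost_cong) auto

lemma integrable_cost: "0 < n \<Longrightarrow> integrable M (sample_cost n)"
  and integral_cost: "0 < n \<Longrightarrow> (\<integral>\<omega>. sample_cost n \<omega> \<partial>M) = gcost p n (1 :: real^'n) / real n powr (1 - p / real CARD('n))"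
proof -
  assume n: "0 < n"
  have i: "integrable (distr M (samples n) (first_pts n)) (\<lambda>q. mcost p {..<n} (fst q) (snd q))"
    unfolding distr_first_pts by (rule integrable_mcost_samples[OF p(1)])
  then have i2: "integrable M (\<lambda>\<omega>. mcost p {..<n} (fst (first_pts n \<omega>)) (snd (first_pts n \<omega>)))"
    by (rule integrable_distr[OF first_pts_measurable])
  then show "integrable M (sample_cost n)" by (simp add: cost_first_pts[OF n])
  have "(\<integral>\<omega>. mcost p {..<n} (fst (first_pts n \<omega>)) (snd (first_pts n \<omega>)) \<partial>M)
    = (\<integral>q. mcost p {..<n} (fst q) (snd q) \<partial>distr M (samples n) (first_pts n))"
    by (rule integral_distr[symmetric, OF first_pts_measurable mcost_samples_measurable[OF p(1)]])
  also have "\<dots> = gcost p n (1 :: real^'n)" unfolding distr_first_pts by (rule integrable_mcost_samples[OF p(1)])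
  finally have "(\<integral>\<omega>. sample_cost n \<omega> \<partial>M) = real n powr (p / real CARD('n) - 1) * gcost p n (1 :: real^'n)" by (simp add: cost_first_pts[OF n])
  then show "(\<integral>\<omega>. sample_cost n \<omega> \<partial>M) = gcost p n (1 :: real^'n) / real n powr (1 - p / real CARD('n))"
    using n powr_minus_divide[of "real n" "1 - p / real CARD('n)"] by simp
qed

lemma gcost_tendsto: "(\<lambda>n. gcost p n (1 :: real^'n) / real n powr (1 - p / real CARD('n))) \<longlonglongrightarrow> gcost_limit TYPE('n) p"
  unfolding gcost_limit_def using convergent_gcost[OF d p] by (rule convergent_LIMSEQ_iff[THEN iffD1])

lemma gcost_limit_pos: "0 < gcost_limit TYPE('n) p"
proof -
  let ?c = "(1/2) powr (p + 1) * 2 powr (- p / real CARD('n)) :: real"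
  have "?c \<le> gcost_limit TYPE('n) p"
  proof (rule LIMSEQ_le_const[OF gcost_tendsto], intro exI[of _ 1] allI impI)
    fix n :: nat assume "1 \<le> n"
    then show "?c \<le> gcost p n (1 :: real^'n) / real n powr (1 - p / real CARD('n))"
      using gcost_lower_bound[OF p(1), of n, where 'n = 'n] by (simp add: pos_le_divide_eq)
  qed
  moreover have "0 < ?c" by simp
  ultimately show ?thesis by linarith
qed

lemma integral_cost_tendsto: "(\<lambda>n. \<integral>\<omega>. sample_cost n \<omega> \<partial>M) \<longlonglongrightarrow> gcost_limit TYPE('n) p"
  by (rule Lim_transform_eventually[OF gcost_tendsto]) (use eventually_gt_at_top[of 0] in eventually_elim, simp add: integral_cost)

lemma tail_exponent_pos: "0 < tail_exponent p (real CARD('n))"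
  using d p by (auto simp: tail_exponent_def max_def field_simps)

definition "cost_root n \<omega> = sample_cost n \<omega> powr (1/p)"
definition "mean_root n = (\<integral>\<omega>. cost_root n \<omega> \<partial>M)"

lemma cost_nonneg: "0 \<le> sample_cost n \<omega>" by (simp add: scaled_cost_def)

lemma cost_root_eq: "0 < n \<Longrightarrow> cost_root n \<omega> = real n powr (1/real CARD('n) - 1/p) * mroot p n (first_pts n \<omega>)"
proof -
  assume n: "0 < n"
  have "(p / real CARD('n) - 1) * (1/p) = 1/real CARD('n) - 1/p" using p by (simp add: left_diff_distrib diff_divide_distrib)
  then show ?thesis unfolding cost_root_def cost_first_pts[OF n] by (simp only: powr_mult powr_powr)
qed

lemma cost_root_powr: "cost_root n \<omega> powr p = sample_cost n \<omega>"
  using p cost_nonneg by (simp add: cost_root_def powr_powr)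

lemma cost_root_measurable: "0 < n \<Longrightarrow> cost_root n \<in> borel_measurable M"
  unfolding cost_root_def[abs_def] using borel_measurable_integrable[OF integrable_cost[of n]]
  by (intro powr_real_measurable) auto

lemma mroot_samples_measurable: "mroot p n \<in> borel_measurable (samples n :: ((nat \<Rightarrow> real^'n) \<times> (nat \<Rightarrow> real^'n)) measure)"
  using mcost_samples_measurable[OF p(1)] by (rule powr_real_measurable) simp

lemma cost_bound:
  assumes n: "0 < n"
  shows "AE \<omega> in M. sample_cost n \<omega> \<le> real n powr (p / real CARD('n)) * norm (1 :: real^'n) powr p"
proof -
  have "AE q in distr M (samples n) (first_pts n). mcost p {..<n} (fst q) (snd q) \<le> real n * norm (1 :: real^'n) powr p"
    unfolding distr_first_pts by (rule mcost_samples_bound[OF p(1)])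
  then have "AE \<omega> in M. mcost p {..<n} (fst (first_pts n \<omega>)) (snd (first_pts n \<omega>)) \<le> real n * norm (1 :: real^'n) powr p"
    by (rule AE_distrD[OF first_pts_measurable])
  then show ?thesis
  proof eventually_elim
    case (elim \<omega>)
    have "sample_cost n \<omega> \<le> real n powr (p / real CARD('n) - 1) * (real n * norm (1 :: real^'n) powr p)"
      unfolding cost_first_pts[OF n] using elim by (intro mult_left_mono) auto
    also have "\<dots> = real n powr (p / real CARD('n)) * norm (1 :: real^'n) powr p"
      using n by (simp add: powr_diff)
    finally show ?case .
  qed
qed

lemma integrable_cost_root:
  assumes n: "0 < n"
  shows "integrable M (cost_root n)"
proof (rule M.integrable_const_bound[OF _ cost_root_measurable[OF n]])
  show "AE \<omega> in M. norm (cost_root n \<omega>) \<le> (real n powr (p / real CARD('n)) * norm (1 :: real^'n) powr p) powr (1/p)"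
    using cost_bound[OF n]
  proof eventually_elim
    case (elim \<omega>)
    then show ?case unfolding cost_root_def using p cost_nonneg by (auto intro!: powr_mono2)
  qed
qed

lemma mean_root_eq: "0 < n \<Longrightarrow> mean_root n = real n powr (1/real CARD('n) - 1/p) * (\<integral>q. mroot p n q \<partial>(samples n :: ((nat \<Rightarrow> real^'n) \<times> (nat \<Rightarrow> real^'n)) measure))"
proof -
  assume n: "0 < n"
  have "(\<integral>\<omega>. mroot p n (first_pts n \<omega>) \<partial>M) = (\<integral>q. mroot p n q \<partial>distr M (samples n) (first_pts n))"
    by (rule integral_distr[symmetric, OF first_pts_measurable mroot_samples_measurable])
  then show ?thesis by (simp add: mean_root_def cost_root_eq[OF n] distr_first_pts)
qed

text \<open>A deviation \<open>r\<close> of the rescaled root is one of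
  \<open>r * n powr (1/p - 1/d)\<close> for the root itself. Divided by the Lipschitz constant this
  is \<open>r / 4 * n powr tail_exponent\<close>, whose square appears in the exponent.\<close>

lemma cost_root_tail:
  assumes n: "0 < n" and r: "0 < r"
  shows "measure M {\<omega>\<in>space M. r \<le> \<bar>cost_root n \<omega> - mean_root n\<bar>} \<le> 2 * exp (- (r\<^sup>2 / 16) * real n powr (2 * tail_exponent p (real CARD('n))))"
proof -
  let ?S = "samples n :: ((nat \<Rightarrow> real^'n) \<times> (nat \<Rightarrow> real^'n)) measure"
  let ?m = "\<integral>q. mroot p n q \<partial>?S"
  let ?k = "real n powr (1/real CARD('n) - 1/p)"
  have k: "0 < ?k" using n by simp
  define A where "A = {q\<in>space ?S. r / ?k \<le> \<bar>mroot p n q - ?m\<bar>}"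
  have [measurable]: "mroot p n \<in> borel_measurable ?S" by (rule mroot_samples_measurable)
  have A: "A \<in> sets ?S" unfolding A_def by measurable
  have eq: "{\<omega>\<in>space M. r \<le> \<bar>cost_root n \<omega> - mean_root n\<bar>} = first_pts n -` A \<inter> space M"
  proof -
    have "\<bar>cost_root n \<omega> - mean_root n\<bar> = ?k * \<bar>mroot p n (first_pts n \<omega>) - ?m\<bar>" for \<omega>
      unfolding cost_root_eq[OF n] mean_root_eq[OF n] right_diff_distrib[symmetric] abs_mult using k by simp
    then show ?thesis using k measurable_space[OF first_pts_measurable, of _ n]
      by (auto simp: A_def pos_divide_le_eq mult.commute)
  qed
  have "measure M {\<omega>\<in>space M. r \<le> \<bar>cost_root n \<omega> - mean_root n\<bar>} = measure (distr M ?S (first_pts n)) A"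
    unfolding eq by (rule measure_distr[symmetric, OF first_pts_measurable]) (rule A)
  also have "\<dots> \<le> 2 * exp (- ((r / ?k)\<^sup>2 / (4 * real n powr max 0 (1/p - 1/2))\<^sup>2))"
    unfolding distr_first_pts A_def using r k by (intro mroot_concentration p n) auto
  also have "(r / ?k)\<^sup>2 / (4 * real n powr max 0 (1/p - 1/2))\<^sup>2 = r\<^sup>2 / 16 * real n powr (2 * tail_exponent p (real CARD('n)))"
  proof -
    have "(real n powr (tail_exponent p (real CARD('n))))\<^sup>2 = real n powr (2 * tail_exponent p (real CARD('n)))"
      by (simp add: power2_eq_square powr_add[symmetric])
    moreover have "real n powr (tail_exponent p (real CARD('n))) = 1 / (?k * real n powr max 0 (1/p - 1/2))"
    proof -
      have "?k * real n powr max 0 (1/p - 1/2) = real n powr (- tail_exponent p (real CARD('n)))"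
        unfolding powr_add[symmetric] by (simp add: tail_exponent_def algebra_simps)
      then show ?thesis using n by (simp add: powr_minus_divide)
    qed
    ultimately have "(1 / (?k * real n powr max 0 (1/p - 1/2)))\<^sup>2 = real n powr (2 * tail_exponent p (real CARD('n)))"
      by simp
    moreover have "(r / ?k)\<^sup>2 / (4 * real n powr max 0 (1/p - 1/2))\<^sup>2 = r\<^sup>2 / 16 * (1 / (?k * real n powr max 0 (1/p - 1/2)))\<^sup>2"
      by (simp add: power_divide power_mult_distrib)
    ultimately show ?thesis by (simp only:)
  qed
  finally show ?thesis by simp
qed

text \<open>For each fixed \<open>r\<close> the tails are summable, so Borel-Cantelli applies;
  countably many values of \<open>r\<close> exhaust all deviations. The index starts at
  \<open>Suc n\<close> because the tail bound holds for positive sample sizes.\<close>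

lemma cost_root_minus_mean_AE: "AE \<omega> in M. (\<lambda>n. cost_root n \<omega> - mean_root n) \<longlonglongrightarrow> 0"
proof -
  have ev: "AE \<omega> in M. \<forall>\<^sub>F n in sequentially. \<bar>cost_root (Suc n) \<omega> - mean_root (Suc n)\<bar> < r" if r: "0 < r" for r
  proof -
    let ?A = "\<lambda>n. {\<omega>\<in>space M. r \<le> \<bar>cost_root (Suc n) \<omega> - mean_root (Suc n)\<bar>}"
    have sm: "summable (\<lambda>n. measure M (?A n))"
    proof (rule summable_comparison_test')
      have "summable (\<lambda>n. exp (- (r\<^sup>2 / 16) * real n powr (2 * tail_exponent p (real CARD('n)))))"
        using r tail_exponent_pos by (intro summable_exp_neg_powr) auto
      then have "summable (\<lambda>n. exp (- (r\<^sup>2 / 16) * real (Suc n) powr (2 * tail_exponent p (real CARD('n)))))" by (subst summable_Suc_iff)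
      then show "summable (\<lambda>n. 2 * exp (- (r\<^sup>2 / 16) * real (Suc n) powr (2 * tail_exponent p (real CARD('n)))))" by (rule summable_mult)
      show "norm (measure M (?A n)) \<le> 2 * exp (- (r\<^sup>2 / 16) * real (Suc n) powr (2 * tail_exponent p (real CARD('n))))" if "0 \<le> n" for n
        using cost_root_tail[OF zero_less_Suc r, of n] by simp
    qed
    have [measurable]: "cost_root (Suc n) \<in> borel_measurable M" for n by (rule cost_root_measurable) simp
    have "AE \<omega> in M. \<forall>\<^sub>F n in sequentially. \<omega> \<in> space M - ?A n"
      by (rule borel_cantelli_AE1[OF _ _ sm]) (auto simp: less_top[symmetric])
    then show ?thesis
    proof eventually_elim
      case (elim \<omega>)
      then show ?case by eventually_elim auto
    qed
  qed
  have "AE \<omega> in M. \<forall>k. \<forall>\<^sub>F n in sequentially. \<bar>cost_root (Suc n) \<omega> - mean_root (Suc n)\<bar> < inverse (real (Suc k))"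
    by (subst AE_all_countable) (intro allI ev, simp)
  then show ?thesis
  proof eventually_elim
    case (elim \<omega>)
    have "(\<lambda>n. cost_root (Suc n) \<omega> - mean_root (Suc n)) \<longlonglongrightarrow> 0"
    proof (rule tendstoI)
      fix e :: real assume "0 < e"
      then obtain k where k: "inverse (real (Suc k)) < e" using reals_Archimedean by blast
      show "\<forall>\<^sub>F n in sequentially. dist (cost_root (Suc n) \<omega> - mean_root (Suc n)) 0 < e"
        using elim[rule_format, of k] by eventually_elim (use k in auto)
    qed
    then show ?case by (rule LIMSEQ_imp_Suc)
  qed
qed

text \<open>A converse of Jensen's inequality up to a small error: outside the exceptional event the
  cost is at most \<open>(mean_root n + r) powr p\<close>. On it, the trivial bound by the diameter
  \<open>norm 1\<close> of the cube grows only polynomially in \<open>n\<close>, while the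
  probability decays like a stretched exponential.\<close>

lemma integral_cost_le:
  assumes n: "0 < n" and r: "0 < r"
  shows "(\<integral>\<omega>. sample_cost n \<omega> \<partial>M) \<le> (mean_root n + r) powr p + norm (1 :: real^'n) powr p * (2 * (real n powr (p / real CARD('n)) * exp (- (r\<^sup>2 / 16) * real n powr (2 * tail_exponent p (real CARD('n))))))"
proof -
  let ?A = "{\<omega>\<in>space M. r \<le> \<bar>cost_root n \<omega> - mean_root n\<bar>}"
  let ?K = "real n powr (p / real CARD('n)) * norm (1 :: real^'n) powr p"
  have [measurable]: "cost_root n \<in> borel_measurable M" by (rule cost_root_measurable[OF n])
  have A: "?A \<in> sets M" by measurable
  have "(\<integral>\<omega>. sample_cost n \<omega> \<partial>M) \<le> (\<integral>\<omega>. (mean_root n + r) powr p + ?K * indicator ?A \<omega> \<partial>M)"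
  proof (rule integral_mono_AE[OF integrable_cost[OF n]])
    show "integrable M (\<lambda>\<omega>. (mean_root n + r) powr p + ?K * indicator ?A \<omega>)"
      using A by (intro Bochner_Integration.integrable_add M.integrable_const integrable_mult_right integrable_real_indicator) (auto simp: less_top[symmetric])
    show "AE \<omega> in M. sample_cost n \<omega> \<le> (mean_root n + r) powr p + ?K * indicator ?A \<omega>"
      using cost_bound[OF n] AE_space
    proof eventually_elim
      case (elim \<omega>)
      show ?case
      proof (cases "\<omega> \<in> ?A")
        case True
        then show ?thesis using elim by (simp add: add_increasing)
      next
        case False
        then have "cost_root n \<omega> \<le> mean_root n + r" using elim by auto
        moreover have "0 \<le> cost_root n \<omega>" by (simp add: cost_root_def)
        ultimately have "cost_root n \<omega> powr p \<le> (mean_root n + r) powr p" using p by (intro powr_mono2) auto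
        then show ?thesis using False by (simp add: cost_root_powr)
      qed
    qed
  qed
  also have "\<dots> = (mean_root n + r) powr p + ?K * measure M ?A"
    using A by (subst Bochner_Integration.integral_add) (auto simp: M.prob_space less_top[symmetric] intro!: integrable_real_indicator)
  also have "\<dots> \<le> (mean_root n + r) powr p + ?K * (2 * exp (- (r\<^sup>2 / 16) * real n powr (2 * tail_exponent p (real CARD('n)))))"
    by (intro add_left_mono mult_left_mono cost_root_tail n r) auto
  finally show ?thesis by (simp add: mult_ac)
qed

text \<open>The limit is known for the mean of the cost, but concentration holds around the mean of
  the root. The latter is at most the root of the former by Jensen, and
  \<open>integral_cost_le\<close> gives the matching lower bound.\<close>

lemma mean_root_tendsto: "mean_root \<longlonglongrightarrow> (gcost_limit TYPE('n) p) powr (1/p)"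
proof (rule tendstoI)
  fix e :: real assume e: "0 < e"
  define \<phi> where "\<phi> n = (\<integral>\<omega>. sample_cost n \<omega> \<partial>M)" for n
  have \<phi>: "\<phi> \<longlonglongrightarrow> gcost_limit TYPE('n) p" unfolding \<phi>_def[abs_def] by (rule integral_cost_tendsto)
  \<comment> \<open>The lower bound loses \<open>r\<close> twice, once in
    \<open>integral_cost_le\<close> and once in approaching the limit.\<close>
  define r where "r = e / 2"
  have r: "0 < r" using e by (simp add: r_def)
  define t where "t n = \<phi> n - norm (1 :: real^'n) powr p * (2 * (real n powr (p / real CARD('n)) * exp (- (r\<^sup>2 / 16) * real n powr (2 * tail_exponent p (real CARD('n))))))" for n
  have "t \<longlonglongrightarrow> gcost_limit TYPE('n) p - norm (1 :: real^'n) powr p * (2 * 0)"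
    unfolding t_def using r tail_exponent_pos by (intro tendsto_intros \<phi> powr_mult_exp_neg_tendsto_0) auto
  then have t: "t \<longlonglongrightarrow> gcost_limit TYPE('n) p" by simp
  have tp: "(\<lambda>n. t n powr (1/p)) \<longlonglongrightarrow> (gcost_limit TYPE('n) p) powr (1/p)" using gcost_limit_pos by (intro tendsto_powr t tendsto_const) auto
  have \<phi>p: "(\<lambda>n. \<phi> n powr (1/p)) \<longlonglongrightarrow> (gcost_limit TYPE('n) p) powr (1/p)" using gcost_limit_pos by (intro tendsto_powr \<phi> tendsto_const) auto
  have "\<forall>\<^sub>F n in sequentially. (gcost_limit TYPE('n) p) powr (1/p) - r < t n powr (1/p)" using r by (intro order_tendstoD(1)[OF tp]) simp
  moreover have "\<forall>\<^sub>F n in sequentially. \<phi> n powr (1/p) < (gcost_limit TYPE('n) p) powr (1/p) + r" using r by (intro order_tendstoD(2)[OF \<phi>p]) simp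
  moreover have "\<forall>\<^sub>F n in sequentially. 0 < t n" using gcost_limit_pos by (intro order_tendstoD(1)[OF t])
  moreover have "\<forall>\<^sub>F n in sequentially. 0 < \<phi> n" using gcost_limit_pos by (intro order_tendstoD(1)[OF \<phi>])
  ultimately show "\<forall>\<^sub>F n in sequentially. dist (mean_root n) ((gcost_limit TYPE('n) p) powr (1/p)) < e"
    using eventually_gt_at_top[of 0]
  proof eventually_elim
    case (elim n)
    have a0: "0 \<le> mean_root n" unfolding mean_root_def by (intro Bochner_Integration.integral_nonneg) (simp add: cost_root_def)
    have "t n \<le> (mean_root n + r) powr p" using integral_cost_le[OF elim(5) r] by (simp add: t_def \<phi>_def)
    then have "t n powr (1/p) \<le> ((mean_root n + r) powr p) powr (1/p)" using elim p by (intro powr_mono2) auto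
    also have "\<dots> = mean_root n + r" using p a0 r by (simp add: powr_powr)
    finally have lo: "(gcost_limit TYPE('n) p) powr (1/p) - r < mean_root n + r" using elim by simp
    have "mean_root n \<le> (\<integral>\<omega>. cost_root n \<omega> powr p \<partial>M) powr (1/p)"
      unfolding mean_root_def using elim integrable_cost[OF elim(5)] integrable_cost_root[OF elim(5)]
      by (intro expectation_root_le[OF M p(1)]) (auto simp: cost_root_powr \<phi>_def, simp add: cost_root_def)
    then have "mean_root n < (gcost_limit TYPE('n) p) powr (1/p) + r" using elim by (simp add: cost_root_powr \<phi>_def)
    then show ?case using lo by (simp add: r_def dist_real_def abs_less_iff)
  qed
qed

lemma cost_AE_tendsto: "AE \<omega> in M. (\<lambda>n. sample_cost n \<omega>) \<longlonglongrightarrow> gcost_limit TYPE('n) p"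
  using cost_root_minus_mean_AE
proof eventually_elim
  case (elim \<omega>)
  have "(\<lambda>n. (cost_root n \<omega> - mean_root n) + mean_root n) \<longlonglongrightarrow> 0 + (gcost_limit TYPE('n) p) powr (1/p)" by (intro tendsto_add elim mean_root_tendsto)
  then have "(\<lambda>n. cost_root n \<omega> powr p) \<longlonglongrightarrow> ((gcost_limit TYPE('n) p) powr (1/p)) powr p"
    using gcost_limit_pos by (intro tendsto_powr) auto
  then show ?case using p gcost_limit_pos by (simp add: cost_root_powr powr_powr)
qed

text \<open>Scheffe's argument: convergence of the means reduces the claim to the negative parts,
  which are dominated by the limit.\<close>

lemma cost_L1_tendsto: "(\<lambda>n. \<integral>\<omega>. \<bar>sample_cost n \<omega> - gcost_limit TYPE('n) p\<bar> \<partial>M) \<longlonglongrightarrow> 0"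
proof -
  let ?h = "\<lambda>n \<omega>. max 0 (gcost_limit TYPE('n) p - sample_cost (Suc n) \<omega>)"
  have i: "integrable M (sample_cost (Suc n))" for n by (rule integrable_cost) simp
  have [measurable]: "sample_cost (Suc n) \<in> borel_measurable M" for n using i by (rule borel_measurable_integrable)
  have "(\<lambda>n. \<integral>\<omega>. ?h n \<omega> \<partial>M) \<longlonglongrightarrow> (\<integral>\<omega>. 0 \<partial>M)"
  proof (rule integral_dominated_convergence[where w = "\<lambda>_. gcost_limit TYPE('n) p"])
    show "AE \<omega> in M. (\<lambda>n. ?h n \<omega>) \<longlonglongrightarrow> 0"
      using cost_AE_tendsto
    proof eventually_elim
      case (elim \<omega>)
      have "(\<lambda>n. ?h n \<omega>) \<longlonglongrightarrow> max 0 (gcost_limit TYPE('n) p - gcost_limit TYPE('n) p)"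
        by (intro tendsto_max tendsto_const tendsto_diff LIMSEQ_Suc[OF elim])
      then show ?case by simp
    qed
    show "AE \<omega> in M. norm (?h n \<omega>) \<le> gcost_limit TYPE('n) p" for n
      using gcost_limit_pos cost_nonneg by (intro AE_I2) (auto simp: max_def)
  qed auto
  moreover have "(\<lambda>n. (\<integral>\<omega>. sample_cost (Suc n) \<omega> \<partial>M) - gcost_limit TYPE('n) p) \<longlonglongrightarrow> gcost_limit TYPE('n) p - gcost_limit TYPE('n) p"
    by (intro tendsto_diff tendsto_const LIMSEQ_Suc[OF integral_cost_tendsto])
  ultimately have "(\<lambda>n. ((\<integral>\<omega>. sample_cost (Suc n) \<omega> \<partial>M) - gcost_limit TYPE('n) p) + 2 * (\<integral>\<omega>. ?h n \<omega> \<partial>M)) \<longlonglongrightarrow> (gcost_limit TYPE('n) p - gcost_limit TYPE('n) p) + 2 * 0"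
    by (intro tendsto_add tendsto_mult tendsto_const) auto
  moreover have "((\<integral>\<omega>. sample_cost (Suc n) \<omega> \<partial>M) - gcost_limit TYPE('n) p) + 2 * (\<integral>\<omega>. ?h n \<omega> \<partial>M) = (\<integral>\<omega>. \<bar>sample_cost (Suc n) \<omega> - gcost_limit TYPE('n) p\<bar> \<partial>M)" for n
  proof -
    have ih: "integrable M (?h n)" using i by (intro integrable_max) auto
    \<comment> \<open>The identity \<open>\<bar>x\<bar> = x + 2 * max 0 (- x)\<close> under the
      integral.\<close>
    have "(\<integral>\<omega>. \<bar>sample_cost (Suc n) \<omega> - gcost_limit TYPE('n) p\<bar> \<partial>M) = (\<integral>\<omega>. (sample_cost (Suc n) \<omega> - gcost_limit TYPE('n) p) + 2 * ?h n \<omega> \<partial>M)"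
      by (intro Bochner_Integration.integral_cong) (auto simp: max_def)
    also have "\<dots> = (\<integral>\<omega>. sample_cost (Suc n) \<omega> - gcost_limit TYPE('n) p \<partial>M) + (\<integral>\<omega>. 2 * ?h n \<omega> \<partial>M)"
      using i ih by (intro Bochner_Integration.integral_add) auto
    also have "(\<integral>\<omega>. sample_cost (Suc n) \<omega> - gcost_limit TYPE('n) p \<partial>M) = (\<integral>\<omega>. sample_cost (Suc n) \<omega> \<partial>M) - gcost_limit TYPE('n) p"
      using i by (subst Bochner_Integration.integral_diff) (auto simp: M.prob_space)
    finally show ?thesis by simp
  qed
  ultimately show ?thesis by (simp add: LIMSEQ_imp_Suc)
qed

end

text \<open>The coordinate maps of the product space satisfy the assumptions of the preceding
  context, so its convergence of the means identifies the limit that defines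
  \<open>f_bi_infty\<close>.\<close>

lemma f_bi_infty_eq:
  assumes d: "3 \<le> CARD('n::finite)" and p: "1 \<le> p" "p < real CARD('n)"
  shows "f_bi_infty TYPE('n) p = lim (\<lambda>n. gcost p n (1 :: real^'n) / real n powr (1 - p / real CARD('n)))"
proof -
  let ?S = "unif_seq :: (nat \<Rightarrow> real^'n) measure"
  let ?B = "\<Pi>\<^sub>M i\<in>(UNIV :: nat set). (borel :: (real^'n) measure)"
  interpret S: prob_space ?S by (intro prob_space_PiM prob_space_unif_cube)
  interpret SS: pair_prob_space ?S ?S ..
  have s: "sets (?S \<Otimes>\<^sub>M ?S) = sets (?B \<Otimes>\<^sub>M ?B)" by (intro sets_pair_measure_cong sets_PiM_cong) auto
  have m: "(\<lambda>z. (\<lambda>i. fst z i, \<lambda>i. snd z i)) \<in> ?S \<Otimes>\<^sub>M ?S \<rightarrow>\<^sub>M ?B \<Otimes>\<^sub>M ?B"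
    using measurable_ident_sets[OF s] by simp
  have law: "distr (?S \<Otimes>\<^sub>M ?S) (?B \<Otimes>\<^sub>M ?B) (\<lambda>z. (\<lambda>i. fst z i, \<lambda>i. snd z i)) = ?S \<Otimes>\<^sub>M ?S"
    using distr_id2[OF s[symmetric]] by simp
  show ?thesis
    using integral_cost_tendsto[OF d p SS.prob_space_axioms m law]
    unfolding f_bi_infty_def gcost_limit_def by (rule limI)
qed

theorem mainTheorem6:
  fixes M :: "'w measure"
    and X Y :: "nat \<Rightarrow> 'w \<Rightarrow> real ^ 'n::finite"
    and p :: real
  assumes "CARD('n) \<ge> 3" and "1 \<le> p" and "p < real CARD('n)"
    and "prob_space M"
    and "prob_space.indep_vars M (\<lambda>_. borel) X UNIV"
    and "prob_space.indep_vars M (\<lambda>_. borel) Y UNIV"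
    and "prob_space.indep_var M
      (\<Pi>\<^sub>M i\<in>UNIV. borel) (\<lambda>\<omega> i. X i \<omega>) (\<Pi>\<^sub>M i\<in>UNIV. borel) (\<lambda>\<omega> i. Y i \<omega>)"
    and "\<And>i. distr M borel (X i) = unif_cube"
    and "\<And>i. distr M borel (Y i) = unif_cube"
  shows "0 < f_bi_infty TYPE('n) p \<and>
    (\<forall>n>0. integrable M (\<lambda>\<omega>. scaled_cost p n (\<lambda>i. X i \<omega>) (\<lambda>i. Y i \<omega>))) \<and>
    (\<lambda>n. \<integral>\<omega>. scaled_cost p n (\<lambda>i. X i \<omega>) (\<lambda>i. Y i \<omega>) \<partial>M) \<longlonglongrightarrow> f_bi_infty TYPE('n) p \<and>
    (AE \<omega> in M. (\<lambda>n. scaled_cost p n (\<lambda>i. X i \<omega>) (\<lambda>i. Y i \<omega>)) \<longlonglongrightarrow> f_bi_infty TYPE('n) p) \<and>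
    (\<lambda>n. \<integral>\<omega>. \<bar>scaled_cost p n (\<lambda>i. X i \<omega>) (\<lambda>i. Y i \<omega>) - f_bi_infty TYPE('n) p\<bar> \<partial>M) \<longlonglongrightarrow> 0"
proof -
  interpret M: prob_space M by fact
  let ?B = "\<Pi>\<^sub>M i\<in>(UNIV :: nat set). (borel :: (real^'n) measure)"
  have rX: "X i \<in> borel_measurable M" and rY: "Y i \<in> borel_measurable M" for i
    using assms(5,6) by (auto simp: M.indep_vars_def)
  have dX: "distr M ?B (\<lambda>\<omega> i. X i \<omega>) = unif_seq"
    using M.indep_vars_iff_distr_eq_PiM[where I = UNIV and M' = "\<lambda>_. borel" and X = X] assms(5) rX by (simp add: assms(8) restrict_def)
  have dY: "distr M ?B (\<lambda>\<omega> i. Y i \<omega>) = unif_seq"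
    using M.indep_vars_iff_distr_eq_PiM[where I = UNIV and M' = "\<lambda>_. borel" and X = Y] assms(6) rY by (simp add: assms(9) restrict_def)
  note joint = assms(7)[unfolded M.indep_var_distribution_eq]
  have XY: "(\<lambda>\<omega>. (\<lambda>i. X i \<omega>, \<lambda>i. Y i \<omega>)) \<in> M \<rightarrow>\<^sub>M ?B \<Otimes>\<^sub>M ?B"
    using joint by (intro measurable_Pair) auto
  \<comment> \<open>Independence within each sequence makes both marginals \<open>unif_seq\<close>,
    and independence of the sequences makes the joint law their product.\<close>
  have law: "distr M (?B \<Otimes>\<^sub>M ?B) (\<lambda>\<omega>. (\<lambda>i. X i \<omega>, \<lambda>i. Y i \<omega>)) = unif_seq \<Otimes>\<^sub>M unif_seq"
    using joint by (simp add: dX dY)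
  note ctx = assms(1-4) XY law
  have f: "f_bi_infty TYPE('n) p = gcost_limit TYPE('n) p"
    unfolding gcost_limit_def by (rule f_bi_infty_eq[OF assms(1-3)])
  show ?thesis
    unfolding f using gcost_limit_pos[OF ctx] integrable_cost[OF ctx] integral_cost_tendsto[OF ctx] cost_AE_tendsto[OF ctx] cost_L1_tendsto[OF ctx]
    by blast
qed

end
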